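(* There is a polynomial-time $\frac{e-1}{(2e+o(1))\ln p}$-approximation algorithm for the max-min problem $$\max_{S_R\subseteq S_A:\ |S_R|\le K}\ \ \min_{u}\Big\{\mathbf 1^{\intercal}u\ \Big|\ c_f^{\intercal}u\ge 1\ \ \forall f\in F_i,\ \forall i\in S_R\cup S_B;\ \ u\ge 0\Big\},$$ where $e$ is Euler's number and $o(1)$ denotes a quantity depending only on $p$ that tends to $0$ as $p\to\infty$. That is, the algorithm outputs in polynomial time a set $S_R\subseteq S_A$ with $|S_R|\le K$ whose inner minimum value is at least $\frac{e-1}{(2e+o(1))\ln p}$ times the optimal value of the max-min problem.
   Context: Setting: $S_A$ and $S_B$ are disjoint finite sets of vehicles, $K$ is a budget, and there are $N$ scenarios $\xi$. Each scenario $\xi$ has a finite set $D(\xi)$ of requests and an explicitly listed finite set $E(\xi)$ of hyperedges; each hyperedge $f\in E(\xi)$ consists of exactly one vehicle of $S_A\cup S_B$ and a nonempty set of at most $p-1$ requests of $D(\xi)$, and has a value $v_f>0$. Here $p\ge 2$ is one plus the maximum vehicle capacity. Hyperedge sets of different scenarios are regarded as disjoint. $F_i$ is the set of all hyperedges (over all scenarios) containing vehicle $i$. Let $G=S_A\cup S_B\cup\bigcup_\xi D(\xi)$. The variables are $u=(u_{g,\xi})$ for $g\in G$ and scenarios $\xi$. For $f\in E(\xi_0)$ the coefficient vector $c_f$ has entries $c_f(g,\xi)=N/v_f$ if $g\in f$ and $\xi=\xi_0$, and $c_f(g,\xi)=0$ otherwise. Polynomial time means polynomial in the size of the instance. *)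

theory Defs
  imports
    Complex_Main
    "HOL-Computational_Algebra.Polynomial"
    "HOL-Library.Discrete_Functions"
begin

section \<open>The max-min problem\<close>

text \<open>
  Vehicles and requests are named by natural numbers, and a hyperedge is the set of its vehicle
  and its requests. Scenarios are \<open>0, \<dots>, N - 1\<close>. As hyperedge sets of different
  scenarios are regarded as disjoint, a hyperedge is always handled together with its scenario,
  as a pair \<open>(\<xi>, f)\<close> with \<open>f \<in> E \<xi>\<close>. Values are rational so that instances are finite
  objects with a size.
\<close>

record inst =
  cap_p :: nat                         \<comment> \<open>one plus the maximum vehicle capacity\<close>
  budget :: nat
  SA :: "nat set"
  SB :: "nat set"
  scen :: nat                          \<comment> \<open>the number \<open>N\<close> of scenarios\<close>
  req :: "nat \<Rightarrow> nat set"
  edges :: "nat \<Rightarrow> nat set set"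
  val :: "nat \<Rightarrow> nat set \<Rightarrow> rat"

definition valid_inst :: "inst \<Rightarrow> bool" where
  "valid_inst I \<longleftrightarrow>
     cap_p I \<ge> 2 \<and>
     finite (SA I) \<and> finite (SB I) \<and> SA I \<inter> SB I = {} \<and>
     (\<forall>\<xi><scen I.
        finite (req I \<xi>) \<and> req I \<xi> \<inter> (SA I \<union> SB I) = {} \<and> finite (edges I \<xi>) \<and>
        (\<forall>f\<in>edges I \<xi>.
           f \<subseteq> SA I \<union> SB I \<union> req I \<xi> \<and>
           card (f \<inter> (SA I \<union> SB I)) = 1 \<and>
           f \<inter> req I \<xi> \<noteq> {} \<and> card (f \<inter> req I \<xi>) \<le> cap_p I - 1 \<and>
           val I \<xi> f > 0))"

text \<open>The index set \<open>G\<close>, the sets \<open>F\<^sub>i\<close> and the coefficient vectors \<open>c\<^sub>f\<close>:\<close>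

definition ground :: "inst \<Rightarrow> nat set" where
  "ground I = SA I \<union> SB I \<union> (\<Union>\<xi><scen I. req I \<xi>)"

definition F :: "inst \<Rightarrow> nat \<Rightarrow> (nat \<times> nat set) set" where
  "F I i = {(\<xi>, f). \<xi> < scen I \<and> f \<in> edges I \<xi> \<and> i \<in> f}"

definition coef :: "inst \<Rightarrow> nat \<times> nat set \<Rightarrow> nat \<Rightarrow> nat \<Rightarrow> real" where
  "coef I = (\<lambda>(\<xi>\<^sub>0, f) g \<xi>.
     if g \<in> f \<and> \<xi> = \<xi>\<^sub>0 then real (scen I) / real_of_rat (val I \<xi>\<^sub>0 f) else 0)"

definition total :: "inst \<Rightarrow> (nat \<Rightarrow> nat \<Rightarrow> real) \<Rightarrow> real" where
  "total I u = (\<Sum>g\<in>ground I. \<Sum>\<xi><scen I. u g \<xi>)"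

definition inner_feasible :: "inst \<Rightarrow> nat set \<Rightarrow> (nat \<Rightarrow> nat \<Rightarrow> real) \<Rightarrow> bool" where
  "inner_feasible I S u \<longleftrightarrow>
     (\<forall>i \<in> S \<union> SB I. \<forall>f \<in> F I i. (\<Sum>g\<in>ground I. \<Sum>\<xi><scen I. coef I f g \<xi> * u g \<xi>) \<ge> 1) \<and>
     (\<forall>g\<in>ground I. \<forall>\<xi><scen I. u g \<xi> \<ge> 0)"

text \<open>
  For valid instances and \<open>S \<subseteq> SA I\<close> the inner linear program is feasible and its objective is
  bounded below by \<open>0\<close>, so the infimum below is a minimum.
\<close>

definition inner_min :: "inst \<Rightarrow> nat set \<Rightarrow> real" where
  "inner_min I S = (INF u\<in>{u. inner_feasible I S u}. total I u)"

definition outer_feasible :: "inst \<Rightarrow> nat set \<Rightarrow> bool" where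
  "outer_feasible I S \<longleftrightarrow> S \<subseteq> SA I \<and> card S \<le> budget I"

definition max_min :: "inst \<Rightarrow> real" where
  "max_min I = Max (inner_min I ` {S. outer_feasible I S})"


section \<open>Machine model\<close>

text \<open>
  Structured programs for a random access machine with natural number arithmetic, under the
  logarithmic cost criterion (Aho, Hopcroft and Ullman, The Design and Analysis of Computer
  Algorithms, Chapter 1): every number that is produced or read is charged its number of
  binary digits. This model is polynomially related to Turing machines. The memory consists of
  unbounded arrays; a program mentions finitely many of them, and a scalar variable is an array
  used at index \<open>0\<close> only.
\<close>

definition bits :: "nat \<Rightarrow> nat" where  \<comment> \<open>the number \<open>0\<close> has one binary digit\<close>
  "bits n = floor_log n + 1"

type_synonym mem = "string \<Rightarrow> nat \<Rightarrow> nat"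

datatype expr =
    Const nat
  | Read string expr
  | Plus expr expr
  | Minus expr expr  \<comment> \<open>truncated at \<open>0\<close>\<close>
  | Times expr expr
  | Div expr expr

fun eval :: "expr \<Rightarrow> mem \<Rightarrow> nat" where
  "eval (Const n) m = n"
| "eval (Read x a) m = m x (eval a m)"
| "eval (Plus a b) m = eval a m + eval b m"
| "eval (Minus a b) m = eval a m - eval b m"
| "eval (Times a b) m = eval a m * eval b m"
| "eval (Div a b) m = eval a m div eval b m"

fun eval_cost :: "expr \<Rightarrow> mem \<Rightarrow> nat" where
  "eval_cost (Const n) m = bits n"
| "eval_cost (Read x a) m = eval_cost a m + bits (eval (Read x a) m)"
| "eval_cost (Plus a b) m = eval_cost a m + eval_cost b m + bits (eval (Plus a b) m)"
| "eval_cost (Minus a b) m = eval_cost a m + eval_cost b m + bits (eval (Minus a b) m)"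
| "eval_cost (Times a b) m = eval_cost a m + eval_cost b m + bits (eval (Times a b) m)"
| "eval_cost (Div a b) m = eval_cost a m + eval_cost b m + bits (eval (Div a b) m)"

datatype prog =
    Skip
  | Write string expr expr  \<comment> \<open>array, index, value\<close>
  | Seq prog prog
  | Cond expr prog prog
  | While expr prog

text \<open>\<open>exec P m t m'\<close>: started in \<open>m\<close>, program \<open>P\<close> halts in \<open>m'\<close> at total cost \<open>t\<close>.
  Conditions are true iff nonzero.\<close>

inductive exec :: "prog \<Rightarrow> mem \<Rightarrow> nat \<Rightarrow> mem \<Rightarrow> bool" where
  Skip: "exec Skip m 1 m"
| Write: "exec (Write x a b) m (1 + eval_cost a m + eval_cost b m)
            (m(x := (m x)(eval a m := eval b m)))"
| Seq: "exec P m t m' \<Longrightarrow> exec Q m' t' m'' \<Longrightarrow> exec (Seq P Q) m (1 + t + t') m''"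
| CondTrue: "eval b m \<noteq> 0 \<Longrightarrow> exec P m t m' \<Longrightarrow> exec (Cond b P Q) m (1 + eval_cost b m + t) m'"
| CondFalse: "eval b m = 0 \<Longrightarrow> exec Q m t m' \<Longrightarrow> exec (Cond b P Q) m (1 + eval_cost b m + t) m'"
| WhileTrue: "eval b m \<noteq> 0 \<Longrightarrow> exec P m t m' \<Longrightarrow> exec (While b P) m' t' m'' \<Longrightarrow>
     exec (While b P) m (1 + eval_cost b m + t + t') m''"
| WhileFalse: "eval b m = 0 \<Longrightarrow> exec (While b P) m (1 + eval_cost b m) m"

inductive_cases SkipE: "exec Skip m t m'"
inductive_cases WriteE: "exec (Write x a b) m t m'"
inductive_cases SeqE: "exec (Seq P Q) m t m'"
inductive_cases CondE: "exec (Cond b P Q) m t m'"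
inductive_cases WhileE: "exec (While b P) m t m'"

lemma exec_deterministic:
  "exec P m t m' \<Longrightarrow> exec P m s m'' \<Longrightarrow> s = t \<and> m'' = m'"
proof (induction arbitrary: s m'' rule: exec.induct)
  case Skip
  then show ?case by (rule SkipE) simp
next
  case Write
  then show ?case by (rule WriteE) simp
next
  case (Seq P m t m\<^sub>1 Q t' m\<^sub>2)
  from Seq.prems show ?case by (rule SeqE) (auto dest!: Seq.IH)
next
  case (CondTrue b m P t m' Q)
  from CondTrue.prems show ?case by (rule CondE) (use CondTrue.hyps in \<open>auto dest!: CondTrue.IH\<close>)
next
  case (CondFalse b m Q t m' P)
  from CondFalse.prems show ?case by (rule CondE) (use CondFalse.hyps in \<open>auto dest!: CondFalse.IH\<close>)
next
  case (WhileTrue b m P t m\<^sub>1 t' m\<^sub>2)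
  from WhileTrue.prems show ?case by (rule WhileE) (use WhileTrue.hyps in \<open>auto dest!: WhileTrue.IH\<close>)
next
  case (WhileFalse b m P)
  from WhileFalse.prems show ?case by (rule WhileE) (use WhileFalse.hyps in simp_all)
qed

definition load :: "nat list \<Rightarrow> mem" where
  "load l = (\<lambda>_ _. 0)(''input'' := (\<lambda>j. if j < length l then l ! j else 0))"

definition returns :: "mem \<Rightarrow> nat list \<Rightarrow> bool" where
  "returns m l \<longleftrightarrow> (\<forall>j<length l. m ''output'' j = l ! j)"

definition bit_size :: "nat list \<Rightarrow> nat" where
  "bit_size l = (\<Sum>n\<leftarrow>l. bits n)"


section \<open>Encoding of instances and solutions\<close>

text \<open>
  A finite set is listed, without repetitions and in any order, after its cardinality. Hence an
  instance has several encodings, all of the same bit size.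
\<close>

definition enc_family :: "('a \<Rightarrow> nat list \<Rightarrow> bool) \<Rightarrow> 'a set \<Rightarrow> nat list \<Rightarrow> bool" where
  "enc_family enc A l \<longleftrightarrow>
     (\<exists>xs ls. distinct xs \<and> set xs = A \<and> list_all2 enc xs ls \<and> l = length xs # concat ls)"

definition enc_set :: "nat set \<Rightarrow> nat list \<Rightarrow> bool" where
  "enc_set = enc_family (\<lambda>n l. l = [n])"

definition enc_edge :: "inst \<Rightarrow> nat \<Rightarrow> nat set \<Rightarrow> nat list \<Rightarrow> bool" where
  "enc_edge I \<xi> f l \<longleftrightarrow>
     (\<exists>k. enc_set f k \<and>
        l = nat (fst (quotient_of (val I \<xi> f))) # nat (snd (quotient_of (val I \<xi> f))) # k)"

definition enc_scenario :: "inst \<Rightarrow> nat \<Rightarrow> nat list \<Rightarrow> bool" where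
  "enc_scenario I \<xi> l \<longleftrightarrow>
     (\<exists>d e. enc_set (req I \<xi>) d \<and> enc_family (enc_edge I \<xi>) (edges I \<xi>) e \<and> l = d @ e)"

definition enc_inst :: "inst \<Rightarrow> nat list \<Rightarrow> bool" where
  "enc_inst I l \<longleftrightarrow>
     (\<exists>a b ss. enc_set (SA I) a \<and> enc_set (SB I) b \<and>
        list_all2 (enc_scenario I) [0..<scen I] ss \<and>
        l = cap_p I # budget I # a @ b @ scen I # concat ss)"


section \<open>Polynomial-time approximation algorithms\<close>

text \<open>
  Program \<open>P\<close> is a polynomial-time algorithm with approximation guarantee \<open>\<alpha>\<close>, where the
  guarantee may depend on the parameter \<open>p\<close> of the instance.
\<close>

definition poly_time_approx :: "prog \<Rightarrow> (nat \<Rightarrow> real) \<Rightarrow> bool" where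
  "poly_time_approx P \<alpha> \<longleftrightarrow>
     (\<exists>q :: nat poly. \<forall>I l. valid_inst I \<and> enc_inst I l \<longrightarrow>
        (\<exists>t m S k. exec P (load l) t m \<and> t \<le> poly q (bit_size l) \<and>
           enc_set S k \<and> returns m k \<and>
           outer_feasible I S \<and> inner_min I S \<ge> \<alpha> (cap_p I) * max_min I))"

end

theory Submission
  imports Defs "HOL-Analysis.Convex" "HOL-Analysis.Harmonic_Numbers"
begin

text \<open>
  For every scenario the inner program asks for weights such that the members of each hyperedge
  weigh at least its value. The hyperedges are served online: as long as one is violated, the
  weights of its members are doubled and increased by an equal share of a fraction of the value.
  Against any feasible \<open>x\<close>, such a step costs at most \<open>5/4\<close> of the value and raises the
  potential \<open>\<Sum> x ln (w / x + 1 / D)\<close>, with \<open>D = 8 p\<close>, by at least \<open>ln 2\<close> times the value;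
  hence the final cost is at most \<open>60/31 ln (480 p)\<close> times the optimum, and \<open>60/31 < 2\<close>.
  This needs neither linear programming duality nor an LP solver.

  After serving \<open>S\<^sub>B\<close>, the algorithm repeatedly serves a vehicle of \<open>S\<^sub>A\<close> whose service raises the
  cost most. The current weights plus the increments that each vehicle of a set \<open>T\<close> would cause on
  its own are feasible for \<open>T\<close>, so one of these increments makes up a \<open>1 / |T|\<close> fraction of the
  distance to the optimum of \<open>T\<close>. This gives the factor \<open>1 - 1 / e\<close>, as for submodular functions.

  The weights are integers: values are scaled by the product of all denominators and by \<open>4 p\<close>.
\<close>

section \<open>Online covering\<close>

text \<open>As a set function the inner minimum need not be submodular: in one scenario with
  hyperedges \<open>{A, r, s}\<close>, \<open>{B, r}\<close> and \<open>{C, s}\<close> of value 1,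
  adding \<open>B\<close> to \<open>{A}\<close> gains 0, but adding it to \<open>{A, C}\<close>
  gains 1. The greedy choice therefore acts on the online cost, and two comparisons are kept apart.
  For a competing set \<open>T\<close>, feasibility alone shows that suitable weights cost at least
  the exact minimum of \<open>T\<close>; only the chosen set has its cost compared with its own
  minimum. Hence the logarithm is paid once. As for the constants, an increment by a fraction
  \<open>1/m\<close> of the value, together with \<open>2/3\<close> as lower bound of
  \<open>ln 2\<close>, leads to the factor \<open>3/2 * (1 + 1/m)\<close>, and 4 is the least
  integer \<open>m\<close> that keeps it below 2. What remains below 2 absorbs the linearization of
  \<open>ln\<close> and, for large \<open>p\<close>, the constant 480. Since only members of
  violated hyperedges are doubled, no weight exceeds three times the largest value. So all stored
  numbers stay short, and one bound on their bits and one on the loop counts yield the running time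
  of the whole program.\<close>

type_synonym edge = "nat set \<times> nat"

definition covers :: "(nat \<Rightarrow> real) \<Rightarrow> edge \<Rightarrow> bool" where
  "covers x e \<longleftrightarrow> real (snd e) \<le> sum x (fst e)"

definition step :: "edge \<Rightarrow> (nat \<Rightarrow> nat) \<Rightarrow> nat \<Rightarrow> nat" where
  "step e w = (if sum w (fst e) < snd e
     then (\<lambda>c. if c \<in> fst e then 2 * w c + snd e div (4 * card (fst e)) else w c) else w)"

text \<open>A fixed number of rounds replaces a loop until the edge is covered: eight always suffice
  by \<open>covers_relax\<close>, and \<open>step\<close> is the identity from then on.\<close>

definition relax :: "edge \<Rightarrow> (nat \<Rightarrow> nat) \<Rightarrow> nat \<Rightarrow> nat" where
  "relax e = step e ^^ 8"

definition relax_all :: "edge list \<Rightarrow> (nat \<Rightarrow> nat) \<Rightarrow> nat \<Rightarrow> nat" where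
  "relax_all es = fold relax es"

text \<open>The lower bound on the value makes the integer increment in \<open>step\<close> at least
  1, so rounding down loses at most a factor 2.\<close>

definition wf_edge :: "nat \<Rightarrow> edge \<Rightarrow> bool" where
  "wf_edge p e \<longleftrightarrow> finite (fst e) \<and> fst e \<noteq> {} \<and> card (fst e) \<le> p \<and> 4 * card (fst e) \<le> snd e"

section \<open>Monotonicity of the doubling steps and coverage after eight of them\<close>

lemma relax_all_append: "relax_all (es @ es') w = relax_all es' (relax_all es w)"
  by (simp add: relax_all_def)

lemma relax_all_Nil [simp]: "relax_all [] w = w"
  by (simp add: relax_all_def)

lemma relax_all_Cons [simp]: "relax_all (e # es) w = relax_all es (relax e w)"
  by (simp add: relax_all_def)

lemma step_ge: "w \<le> step e w"
  by (auto simp: step_def le_fun_def)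

lemma funpow_step_ge: "w \<le> (step e ^^ k) w"
  by (induction k) (auto intro: order_trans step_ge)

lemma relax_ge: "w \<le> relax e w"
  unfolding relax_def by (rule funpow_step_ge)

lemma relax_all_ge: "w \<le> relax_all es w"
proof (induction es arbitrary: w)
  case (Cons e es)
  show ?case using order_trans[OF relax_ge Cons.IH] by simp
qed simp

lemma covers_mono: "covers (\<lambda>c. real (w c)) e \<Longrightarrow> w \<le> w' \<Longrightarrow> covers (\<lambda>c. real (w' c)) e"
  using sum_mono[of "fst e" "\<lambda>c. real (w c)" "\<lambda>c. real (w' c)"]
  by (auto simp: covers_def le_fun_def)

lemma covers_iff: "covers (\<lambda>c. real (w c)) e \<longleftrightarrow> snd e \<le> sum w (fst e)"
  by (simp add: covers_def flip: of_nat_sum)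

lemma relax_covers: "covers (\<lambda>c. real (w c)) e \<Longrightarrow> relax e w = w"
proof -
  assume "covers (\<lambda>c. real (w c)) e"
  then have "step e w = w" by (simp add: covers_iff step_def)
  then have "(step e ^^ k) w = w" for k by (induction k) auto
  then show ?thesis by (simp add: relax_def)
qed

lemma relax_all_covers: "(\<And>e. e \<in> set es \<Longrightarrow> covers (\<lambda>c. real (w c)) e) \<Longrightarrow> relax_all es w = w"
  by (induction es) (auto simp: relax_covers)

text \<open>Even without the doubling, each step on an uncovered edge adds
  \<open>card C * a\<close>. This is at least an eighth of \<open>V\<close>: the quarter accounts
  for 4, and rounding down for 2, because \<open>a + 1 \<le> 2 * a\<close>.\<close>

lemma covers_relax:
  assumes "wf_edge p e"
  shows "covers (\<lambda>c. real (relax e w c)) e"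
proof -
  obtain C V where e: "e = (C, V)" by fastforce
  have C: "finite C" "C \<noteq> {}" "4 * card C \<le> V" using assms by (auto simp: wf_edge_def e)
  define a where "a = V div (4 * card C)"
  have "card C > 0" using C by (simp add: card_gt_0_iff)
  then have "a \<ge> 1" using C unfolding a_def by (simp add: div_greater_zero_iff Suc_leI)
  have "V < 4 * card C * (a + 1)"
    using dividend_less_div_times[of "4 * card C" V] \<open>card C > 0\<close> unfolding a_def by (simp add: algebra_simps)
  also have "\<dots> \<le> 4 * card C * (2 * a)" using \<open>a \<ge> 1\<close> by (intro mult_le_mono) auto
  finally have V: "V \<le> 8 * (card C * a)" by simp
  have "covers (\<lambda>c. real ((step e ^^ k) w c)) e \<or> k * V \<le> 8 * sum ((step e ^^ k) w) C" for k
  proof (induction k)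
    case (Suc k)
    let ?w = "(step e ^^ k) w"
    show ?case
    proof (cases "covers (\<lambda>c. real (?w c)) e")
      case True
      then show ?thesis using covers_mono[OF _ step_ge] by simp
    next
      case False
      then have "step e ?w = (\<lambda>c. if c \<in> C then 2 * ?w c + a else ?w c)"
        by (auto simp: covers_iff step_def e a_def)
      then have "sum (step e ?w) C = 2 * sum ?w C + card C * a"
        by (simp add: sum.distrib sum_distrib_left)
      with V Suc False show ?thesis by (simp add: algebra_simps)
    qed
  qed simp
  from this[of 8] show ?thesis by (auto simp: relax_def covers_iff e)
qed

lemma covers_relax_all:
  "e \<in> set es \<Longrightarrow> (\<And>e. e \<in> set es \<Longrightarrow> wf_edge p e) \<Longrightarrow> covers (\<lambda>c. real (relax_all es w c)) e"
proof (induction es arbitrary: w)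
  case (Cons e' es)
  show ?case
  proof (cases "e \<in> set es")
    case False
    then have "e = e'" using Cons.prems by simp
    then show ?thesis using covers_mono[OF covers_relax relax_all_ge] Cons.prems(2)[of e] by auto
  qed (use Cons in auto)
qed simp

text \<open>Before it is doubled, a member weighs less than the value of the violated edge. This
  prevents repeated doubling from producing long numbers.\<close>

lemma step_le:
  assumes "finite (fst e)" "snd e \<le> B" "\<And>c. w c \<le> 3 * B"
  shows "step e w c \<le> 3 * B"
proof (cases "sum w (fst e) < snd e \<and> c \<in> fst e")
  case True
  then have "w c \<le> sum w (fst e)" using assms by (intro member_le_sum) auto
  moreover have "snd e div (4 * card (fst e)) \<le> snd e" by (rule div_le_dividend)
  ultimately have "2 * w c + snd e div (4 * card (fst e)) \<le> 3 * B"
    using True assms(2) by linarith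
  then show ?thesis using True by (simp add: step_def)
qed (use assms in \<open>auto simp: step_def\<close>)

lemma funpow_step_outside: "c \<notin> fst e \<Longrightarrow> (step e ^^ k) w c = w c"
  by (induction k) (auto simp: step_def)

text \<open>Minus the relative entropy of \<open>x\<close> with respect to \<open>w + x / D\<close>.
  The shift by \<open>1 / D\<close> keeps the logarithm finite where \<open>w\<close> is zero;
  coordinates with \<open>x c = 0\<close> contribute nothing.\<close>

definition potential :: "nat set \<Rightarrow> real \<Rightarrow> (nat \<Rightarrow> real) \<Rightarrow> (nat \<Rightarrow> nat) \<Rightarrow> real" where
  "potential U D x w = (\<Sum>c\<in>U. x c * ln (real (w c) / x c + 1 / D))"

section \<open>Gain of potential against cost in one step\<close>

lemma ln_concave_bound:
  assumes "0 \<le> q" "q \<le> (1::real)"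
  shows "q * ln 2 \<le> ln (1 + q)"
proof -
  have "(1 - q) * ln 1 + q * ln 2 \<le> ln ((1 - q) *\<^sub>R 1 + q *\<^sub>R (2::real))"
    by (rule concave_onD[OF ln_concave]) (use assms in auto)
  then show ?thesis by (simp add: algebra_simps)
qed

text \<open>The step multiplies the argument of the logarithm by \<open>1 + q\<close>. For
  \<open>q \<ge> 1\<close> the gain is at least \<open>x * ln 2\<close>. For \<open>q < 1\<close>
  the coordinate \<open>x\<close> exceeds \<open>D * a\<close>, hence \<open>V\<close>; then
  \<open>x * q \<ge> V\<close>, and \<open>ln (1 + q)\<close> lies above its chord
  \<open>q * ln 2\<close>.\<close>

lemma coordinate_gain:
  fixes w x a V D :: real
  assumes "0 \<le> w" "w \<le> V" "0 \<le> x" "0 < D" "V \<le> D * a" "0 < V"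
  shows "ln 2 * min x V \<le> x * ln ((2 * w + a) / x + 1 / D) - x * ln (w / x + 1 / D)"
proof (cases "x = 0")
  case False
  with assms have x: "x > 0" by simp
  define q where "q = (w + a) / (w + x / D)"
  have a: "a > 0" using assms by (metis less_le_trans zero_less_mult_pos)
  have pos: "w + x / D > 0" using x assms by (simp add: add_nonneg_pos)
  have q0: "q \<ge> 0" using pos a assms by (simp add: q_def)
  have y: "w / x + 1 / D > 0" using x assms by (simp add: add_nonneg_pos)
  have "w / x + 1 / D = (w + x / D) / x" using x by (simp add: field_simps)
  moreover have "(w + x / D) * (1 + q) = w + x / D + (w + a)"
  proof -
    have "(w + x / D) * q = w + a" using pos by (simp add: q_def)
    then show ?thesis by (simp add: distrib_left)
  qed
  ultimately have "(w / x + 1 / D) * (1 + q) = (w + x / D + (w + a)) / x"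
    by simp
  also have "\<dots> = (2 * w + a) / x + 1 / D" using x by (simp add: field_simps)
  finally have "ln ((2 * w + a) / x + 1 / D) = ln (w / x + 1 / D) + ln (1 + q)"
    using y q0 ln_mult[of "w / x + 1 / D" "1 + q"] by simp
  then have eq: "x * ln ((2 * w + a) / x + 1 / D) - x * ln (w / x + 1 / D) = x * ln (1 + q)"
    by (simp add: algebra_simps)
  show ?thesis
  proof (cases "q \<ge> 1")
    case True
    then have "ln 2 \<le> ln (1 + q)" by simp
    then have "ln 2 * min x V \<le> ln (1 + q) * x" using x assms q0 by (intro mult_mono) auto
    then show ?thesis unfolding eq by (simp add: mult.commute)
  next
    case False
    then have "w + a < w + x / D" using pos by (simp add: q_def)
    then have "D * a < x" using assms by (simp add: field_simps)
    then have "V < x" using assms by simp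
    \<comment> \<open>The two summands are compared separately: \<open>V < x\<close> settles the one
      with \<open>w\<close>, and \<open>V \<le> D * a\<close> the other.\<close>
    have "V * (w + x / D) \<le> x * (w + a)"
    proof -
      have "V * w \<le> x * w" using \<open>V < x\<close> assms by (intro mult_right_mono) auto
      moreover have "V * (x / D) \<le> x * a"
        using mult_left_mono[OF assms(5), of x] assms x by (simp add: field_simps)
      ultimately show ?thesis by (simp add: algebra_simps)
    qed
    then have "V \<le> x * q" using pos by (simp add: q_def pos_le_divide_eq)
    then have "ln 2 * V \<le> ln 2 * (x * q)" by (intro mult_left_mono) auto
    also have "\<dots> = x * (q * ln 2)" by simp
    also have "\<dots> \<le> x * ln (1 + q)"
      using ln_concave_bound[OF q0] False x by (intro mult_left_mono) auto
    finally show ?thesis using \<open>V < x\<close> by (simp add: eq min_def)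
  qed
qed (use assms in simp)

lemma step_potential:
  assumes U: "finite U" "fst e \<subseteq> U" and e: "wf_edge p e" and D: "D = 8 * real p"
    and x: "\<And>c. x c \<ge> 0" "covers x e"
  shows "real (sum (step e w) U) - real (sum w U) \<le> 15 / 8 * (potential U D x (step e w) - potential U D x w)"
proof (cases "sum w (fst e) < snd e")
  case True
  obtain C V where eq: "e = (C, V)" by fastforce
  define a where "a = V div (4 * card C)"
  have C: "finite C" "C \<noteq> {}" "4 * card C \<le> V" "card C \<le> p" "C \<subseteq> U"
    using e U by (auto simp: wf_edge_def eq)
  have viol: "sum w C < V" using True by (simp add: eq)
  then have st: "step e w = (\<lambda>c. if c \<in> C then 2 * w c + a else w c)"
    by (auto simp: step_def eq a_def)
  have c0: "card C > 0" using C by (simp add: card_gt_0_iff)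
  then have "a \<ge> 1" using C unfolding a_def by (simp add: div_greater_zero_iff Suc_leI)
  have "V < 4 * card C * (a + 1)"
    using dividend_less_div_times[of "4 * card C" V] c0 unfolding a_def by (simp add: algebra_simps)
  also have "\<dots> \<le> 4 * card C * (2 * a)" using \<open>a \<ge> 1\<close> by (intro mult_le_mono) auto
  \<comment> \<open>This is the origin of \<open>D = 8 * p\<close>: 4 from the quarter, 2 from
    rounding down, and \<open>p\<close> as bound on the number of members.\<close>
  also have "\<dots> \<le> 8 * p * a" using C by simp
  finally have "real V \<le> real (8 * p * a)" by linarith
  then have VD: "real V \<le> D * real a" by (simp add: D)
  have ca: "4 * (card C * a) \<le> V" unfolding a_def
    using div_times_less_eq_dividend[of V "4 * card C"] by (simp add: algebra_simps)
  have "sum (step e w) U = sum w (U - C) + sum (step e w) C"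
    using U C by (subst sum.subset_diff[of C U]) (auto simp: st)
  also have "sum (step e w) C = 2 * sum w C + card C * a"
    by (simp add: st sum.distrib sum_distrib_left)
  finally have "sum (step e w) U = sum w U + sum w C + card C * a"
    using U C by (simp add: sum.subset_diff[of C U w])
  then have "4 * (sum (step e w) U) \<le> 4 * sum w U + 5 * V" using viol ca by simp
  then have "real (4 * (sum (step e w) U)) \<le> real (4 * sum w U + 5 * V)" by linarith
  then have cost: "real (sum (step e w) U) - real (sum w U) \<le> 5 / 4 * real V" by simp
  have wV: "real (w c) \<le> real V" if "c \<in> C" for c
    using that member_le_sum[of c C w] C viol by simp
  have V0: "real V > 0" using viol by simp
  have D0: "D > 0" using C c0 by (simp add: D)
  \<comment> \<open>The gain of a coordinate is only known up to \<open>V\<close>, so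
    \<open>x\<close> is cut off there. Nothing essential is lost: either no coordinate is cut and
    \<open>x\<close> covers the edge, or a single one that is cut already contributes
    \<open>V\<close>.\<close>
  have "real V \<le> (\<Sum>c\<in>C. min (x c) (real V))"
  proof (cases "\<forall>c\<in>C. x c \<le> real V")
    case True
    then have "(\<Sum>c\<in>C. min (x c) (real V)) = sum x C" by (intro sum.cong) auto
    then show ?thesis using x(2) by (simp add: covers_def eq)
  next
    case False
    then obtain c where c: "c \<in> C" "x c > real V" by force
    then have "real V = min (x c) (real V)" by simp
    also have "\<dots> \<le> (\<Sum>c\<in>C. min (x c) (real V))"
      using c C x by (intro member_le_sum[of c C "\<lambda>c. min (x c) (real V)"]) auto
    finally show ?thesis .
  qed
  then have "ln 2 * real V \<le> (\<Sum>c\<in>C. ln 2 * min (x c) (real V))"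
    by (subst sum_distrib_left[symmetric]) (intro mult_left_mono, auto)
  also have "\<dots> \<le> (\<Sum>c\<in>C. x c * ln ((2 * real (w c) + real a) / x c + 1 / D) - x c * ln (real (w c) / x c + 1 / D))"
    by (intro sum_mono coordinate_gain) (use wV V0 D0 VD x in auto)
  also have "\<dots> = (\<Sum>c\<in>C. x c * ln (real (step e w c) / x c + 1 / D) - x c * ln (real (w c) / x c + 1 / D))"
    by (intro sum.cong) (auto simp: st)
  also have "\<dots> = (\<Sum>c\<in>U. x c * ln (real (step e w c) / x c + 1 / D) - x c * ln (real (w c) / x c + 1 / D))"
    using U C by (intro sum.mono_neutral_left) (auto simp: st)
  also have "\<dots> = potential U D x (step e w) - potential U D x w"
    by (simp add: potential_def sum_subtractf)
  finally have "ln 2 * real V \<le> potential U D x (step e w) - potential U D x w" .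
  moreover have "2 / 3 * real V \<le> ln 2 * real V" using ln2_ge_two_thirds V0 by (intro mult_right_mono) auto
  ultimately show ?thesis using cost by (simp add: algebra_simps)
qed (simp add: step_def)

lemma funpow_step_potential:
  assumes "finite U" "fst e \<subseteq> U" "wf_edge p e" "D = 8 * real p" "\<And>c. x c \<ge> 0" "covers x e"
  shows "real (sum ((step e ^^ k) w) U) - real (sum w U)
    \<le> 15 / 8 * (potential U D x ((step e ^^ k) w) - potential U D x w)"
proof (induction k)
  case (Suc k)
  then show ?case using step_potential[OF assms, of "(step e ^^ k) w"] by simp
qed simp

lemma relax_all_potential:
  assumes "finite U" "D = 8 * real p" "\<And>c. x c \<ge> 0"
    and "\<And>e. e \<in> set es \<Longrightarrow> fst e \<subseteq> U \<and> wf_edge p e \<and> covers x e"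
  shows "real (sum (relax_all es w) U) - real (sum w U)
    \<le> 15 / 8 * (potential U D x (relax_all es w) - potential U D x w)"
  using assms(4)
proof (induction es arbitrary: w)
  case (Cons e es)
  have "real (sum (relax_all es (relax e w)) U) - real (sum (relax e w) U)
    \<le> 15 / 8 * (potential U D x (relax_all es (relax e w)) - potential U D x (relax e w))"
    by (rule Cons.IH) (use Cons.prems in auto)
  moreover have "real (sum (relax e w) U) - real (sum w U)
    \<le> 15 / 8 * (potential U D x (relax e w) - potential U D x w)"
    unfolding relax_def by (rule funpow_step_potential) (use assms Cons.prems in auto)
  ultimately show ?case unfolding relax_all_Cons by argo
qed simp

section \<open>From the potential to the competitive ratio\<close>

lemma ln_le_linear: "x > 0 \<Longrightarrow> M > 0 \<Longrightarrow> ln x \<le> ln M + x / M - (1::real)"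
  using ln_le_minus_one[of "x / M"] by (simp add: ln_div)

text \<open>The final weights are controlled only through the cost that is to be bounded. The
  tangent of \<open>ln\<close> at 60 turns them into a small multiple of this cost, which can later
  be moved to the other side. Any point above 30 would leave the resulting factor below 2.\<close>

lemma potential_le:
  assumes "finite U" "D \<ge> 1" "\<And>c. x c \<ge> 0"
  shows "potential U D x w \<le> ln 60 * sum x U + real (sum w U) / 60"
proof -
  have "x c * ln (real (w c) / x c + 1 / D) \<le> ln 60 * x c + real (w c) / 60" for c
  proof (cases "x c = 0")
    case False
    then have x: "x c > 0" using assms(3)[of c] by simp
    have "ln (real (w c) / x c + 1 / D) \<le> ln 60 + (real (w c) / x c + 1 / D) / 60 - 1"
      using x assms by (intro ln_le_linear add_nonneg_pos) auto
    \<comment> \<open>As \<open>D \<ge> 1\<close>, the summand \<open>1 / D / 60\<close> is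
      swallowed by the \<open>- 1\<close> of the tangent.\<close>
    also have "\<dots> \<le> ln 60 + real (w c) / x c / 60"
      using assms by (simp add: field_simps)
    finally have "x c * ln (real (w c) / x c + 1 / D) \<le> x c * (ln 60 + real (w c) / x c / 60)"
      using x by (intro mult_left_mono) auto
    then show ?thesis using x by (simp add: algebra_simps)
  qed simp
  then have "potential U D x w \<le> (\<Sum>c\<in>U. ln 60 * x c + real (w c) / 60)"
    unfolding potential_def by (intro sum_mono)
  then show ?thesis by (simp add: sum.distrib sum_distrib_left sum_divide_distrib)
qed

text \<open>
  \<open>15/8\<close> is \<open>5/4\<close> divided by the lower bound \<open>2/3\<close> of \<open>ln 2\<close>, and \<open>60/31\<close> is
  \<open>(15/8) / (1 - (15/8) / 60)\<close>, where \<open>60\<close> is the point at which \<open>ln\<close> is linearized in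
  \<open>potential_le\<close>.
\<close>

definition ratio :: "nat \<Rightarrow> real" where
  "ratio p = 60 / 31 * ln (480 * real p)"

text \<open>At weight zero the potential is \<open>- ln D * sum x U\<close>, which is where
  \<open>ln p\<close> enters. The final cost reappears on the right with coefficient
  \<open>1/32\<close>; solving for it turns \<open>15/8\<close> into \<open>60/31\<close>.\<close>

lemma relax_all_competitive:
  assumes U: "finite U" and p: "p \<ge> 1" and x: "\<And>c. x c \<ge> 0"
    and es: "\<And>e. e \<in> set es \<Longrightarrow> fst e \<subseteq> U \<and> wf_edge p e \<and> covers x e"
  shows "real (sum (relax_all es (\<lambda>_. 0)) U) \<le> ratio p * sum x U"
proof -
  let ?w = "relax_all es (\<lambda>_. 0)" and ?D = "8 * real p"
  have "potential U ?D x (\<lambda>_. 0) = - ln ?D * sum x U"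
    using p by (simp add: potential_def sum_negf ln_div sum_distrib_right[symmetric] flip: sum_distrib_left)
  then have "real (sum ?w U) \<le> 15 / 8 * (potential U ?D x ?w + ln ?D * sum x U)"
    using relax_all_potential[OF U refl x es, where w = "\<lambda>_. 0"] by simp
  also have "\<dots> \<le> 15 / 8 * (ln 60 * sum x U + real (sum ?w U) / 60 + ln ?D * sum x U)"
    using potential_le[of U ?D x ?w] U p x by simp
  also have "\<dots> = 15 / 8 * ((ln 60 + ln ?D) * sum x U) + real (sum ?w U) / 32"
    by (simp add: algebra_simps)
  also have "ln 60 + ln ?D = ln (480 * real p)"
    using ln_mult[of 60 ?D] p by simp
  finally show ?thesis by (simp add: ratio_def)
qed

subsection \<open>Greedy choice of the vehicles\<close>

locale greedy_covering =
  fixes U :: "nat set" and p :: nat and es :: "nat \<Rightarrow> edge list"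
    and cand :: "nat set" and bs :: "nat list"
  assumes finite_U: "finite U" and finite_SA: "finite cand" and p_pos: "p \<ge> 1"
    and edge: "e \<in> set (es i) \<Longrightarrow> fst e \<subseteq> U \<and> wf_edge p e"
begin

definition cost :: "(nat \<Rightarrow> nat) \<Rightarrow> nat" where
  "cost w = sum w U"

definition serve :: "nat \<Rightarrow> (nat \<Rightarrow> nat) \<Rightarrow> nat \<Rightarrow> nat" where
  "serve i = relax_all (es i)"

definition base :: "nat \<Rightarrow> nat" where
  "base = fold serve bs (\<lambda>_. 0)"

text \<open>A relation rather than a function, so that the program may break ties in any
  way.\<close>

inductive greedy :: "nat set \<Rightarrow> (nat \<Rightarrow> nat) \<Rightarrow> bool" where
  greedy_base: "greedy {} base"
| greedy_step: "greedy S w \<Longrightarrow> i \<in> cand - S \<Longrightarrow>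
    (\<And>j. j \<in> cand - S \<Longrightarrow> cost (serve j w) \<le> cost (serve i w)) \<Longrightarrow> greedy (insert i S) (serve i w)"

definition feasible :: "nat set \<Rightarrow> (nat \<Rightarrow> real) \<Rightarrow> bool" where
  "feasible S x \<longleftrightarrow> (\<forall>i\<in>S \<union> set bs. \<forall>e\<in>set (es i). covers x e)"

lemma serve_ge: "w \<le> serve i w"
  by (simp add: serve_def relax_all_ge)

lemma fold_serve_ge: "w \<le> fold serve is w"
proof (induction "is" arbitrary: w)
  case (Cons i "is")
  show ?case using order_trans[OF serve_ge Cons.IH] by simp
qed simp

lemma serve_covers: "e \<in> set (es i) \<Longrightarrow> covers (\<lambda>c. real (serve i w c)) e"
  unfolding serve_def using edge by (intro covers_relax_all) auto

lemma feasible_mono: "feasible S (\<lambda>c. real (w c)) \<Longrightarrow> w \<le> w' \<Longrightarrow> feasible S (\<lambda>c. real (w' c))"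
  unfolding feasible_def by (blast intro: covers_mono[of w _ w'])

lemma fold_serve_covers:
  "i \<in> set is \<Longrightarrow> e \<in> set (es i) \<Longrightarrow> covers (\<lambda>c. real (fold serve is w c)) e"
proof (induction "is" arbitrary: w)
  case (Cons j "is")
  show ?case
  proof (cases "i \<in> set is")
    case False
    then have "e \<in> set (es j)" using Cons.prems by simp
    then have "covers (\<lambda>c. real (fold serve is (serve j w) c)) e"
      by (rule covers_mono[OF serve_covers fold_serve_ge])
    then show ?thesis by simp
  qed (use Cons in auto)
qed simp

lemma feasible_base: "feasible {} (\<lambda>c. real (base c))"
  unfolding feasible_def base_def by (simp add: fold_serve_covers)

lemma greedy_feasible: "greedy S w \<Longrightarrow> feasible S (\<lambda>c. real (w c))"
proof (induction rule: greedy.induct)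
  case (greedy_step S w i)
  then have "feasible S (\<lambda>c. real (serve i w c))"
    by (intro feasible_mono[OF _ serve_ge])
  then show ?case using serve_covers[of _ i w] unfolding feasible_def by blast
qed (rule feasible_base)

lemma greedy_subset: "greedy S w \<Longrightarrow> S \<subseteq> cand"
  by (induction rule: greedy.induct) auto

lemma fold_serve_eq: "fold serve is w = relax_all (concat (map es is)) w"
  by (induction "is" arbitrary: w) (auto simp: serve_def relax_all_append)

text \<open>Rejected trials leave no trace: the weights are those of a single online run from zero
  over the vehicles served. So \<open>relax_all_competitive\<close> applies to the run as a whole,
  whatever the order of the choices.\<close>

lemma greedy_relax_all:
  "greedy S w \<Longrightarrow> \<exists>is. set is = S \<union> set bs \<and> w = fold serve is (\<lambda>_. 0)"
proof (induction rule: greedy.induct)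
  case greedy_base
  then show ?case by (auto simp: base_def)
next
  case (greedy_step S w i)
  then obtain "is" where "set is = S \<union> set bs" "w = fold serve is (\<lambda>_. 0)" by blast
  then show ?case by (intro exI[of _ "is @ [i]"]) auto
qed

lemma greedy_competitive:
  assumes "greedy S w" "\<And>c. x c \<ge> 0" "feasible S x"
  shows "real (cost w) \<le> ratio p * sum x U"
proof -
  obtain "is" where i: "set is = S \<union> set bs" "w = relax_all (concat (map es is)) (\<lambda>_. 0)"
    using greedy_relax_all[OF assms(1)] fold_serve_eq by auto
  show ?thesis unfolding cost_def i(2)
  proof (rule relax_all_competitive)
    fix e assume "e \<in> set (concat (map es is))"
    then obtain j where j: "j \<in> S \<union> set bs" "e \<in> set (es j)" using i(1) by auto
    then show "fst e \<subseteq> U \<and> wf_edge p e \<and> covers x e"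
      using edge[OF j(2)] assms(3) unfolding feasible_def by blast
  qed (use finite_U p_pos assms in auto)
qed

lemma greedy_augment:
  assumes "greedy S w" and T: "T \<subseteq> cand" and lower: "\<And>w'. feasible T (\<lambda>c. real (w' c)) \<Longrightarrow> v \<le> real (cost w')"
    and gain: "\<And>j. j \<in> cand - S \<Longrightarrow> cost (serve j w) \<le> g"
    and g: "cost w \<le> g" and n: "card T \<le> n"
  shows "v \<le> real (cost w) + real n * (real g - real (cost w))"
proof -
  \<comment> \<open>Truncated subtraction is exact here, since serving never lowers a weight. The
    combined weights are again natural numbers, which is why \<open>lower\<close> speaks of integral
    coverings.\<close>
  define w' where "w' = (\<lambda>c. w c + (\<Sum>j\<in>T. serve j w c - w c))"
  have fT: "finite T" using T finite_SA by (rule finite_subset)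
  have "w \<le> w'" by (simp add: w'_def le_fun_def)
  have ge: "serve j w \<le> w'" if "j \<in> T" for j
  proof (rule le_funI)
    fix c
    have "serve j w c - w c \<le> (\<Sum>j\<in>T. serve j w c - w c)"
      using fT that by (intro member_le_sum) auto
    then show "serve j w c \<le> w' c" by (simp add: w'_def)
  qed
  have "feasible T (\<lambda>c. real (w' c))"
    unfolding feasible_def
  proof (intro ballI)
    fix i e assume i: "i \<in> T \<union> set bs" and e: "e \<in> set (es i)"
    show "covers (\<lambda>c. real (w' c)) e"
    proof (cases "i \<in> T")
      case True
      show ?thesis by (rule covers_mono[OF serve_covers[OF e] ge[OF True]])
    next
      case False
      then show ?thesis using greedy_feasible[OF assms(1)] i e
        by (intro covers_mono[OF _ \<open>w \<le> w'\<close>]) (auto simp: feasible_def)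
    qed
  qed
  then have "v \<le> real (cost w')" by (rule lower)
  moreover have "(\<Sum>c\<in>U. serve j w c - w c) = cost (serve j w) - cost w" for j
    unfolding cost_def using serve_ge[of w j] by (intro sum_subtractf_nat) (auto simp: le_fun_def)
  moreover have "cost w' = cost w + (\<Sum>j\<in>T. \<Sum>c\<in>U. serve j w c - w c)"
    unfolding w'_def cost_def sum.distrib by (subst sum.swap) simp
  ultimately have "v \<le> real (cost w + (\<Sum>j\<in>T. cost (serve j w) - cost w))" by simp
  also have "\<dots> \<le> real (cost w + n * (g - cost w))"
  proof -
    \<comment> \<open>A vehicle of \<open>T\<close> that was chosen before has all its edges
      covered, so its increment is zero. This is why the maximum over \<open>cand - S\<close>
      controls every vehicle of \<open>T\<close>.\<close>
    have "cost (serve j w) - cost w \<le> g - cost w" if "j \<in> T" for j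
    proof (cases "j \<in> S")
      case True
      then have "serve j w = w" unfolding serve_def
        by (intro relax_all_covers) (use greedy_feasible[OF assms(1)] in \<open>auto simp: feasible_def\<close>)
      then show ?thesis by simp
    next
      case False
      then show ?thesis using gain[of j] that T by (intro diff_le_mono) auto
    qed
    then have "(\<Sum>j\<in>T. cost (serve j w) - cost w) \<le> card T * (g - cost w)"
      using sum_bounded_above[of T "\<lambda>j. cost (serve j w) - cost w" "g - cost w"] by simp
    also have "\<dots> \<le> n * (g - cost w)" using n by simp
    finally show ?thesis by linarith
  qed
  finally show ?thesis using g by (simp add: of_nat_diff)
qed

text \<open>By \<open>greedy_augment\<close>, each choice reduces the gap \<open>v - cost w\<close>
  to at most \<open>1 - 1 / n\<close> times its size. The number of rounds is \<open>card S\<close>,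
  while \<open>n\<close> only bounds the competitor \<open>T\<close>.\<close>

lemma greedy_lower:
  assumes "greedy S w" and T: "T \<subseteq> cand" "card T \<le> n" and n: "n \<ge> 1"
    and lower: "\<And>w'. feasible T (\<lambda>c. real (w' c)) \<Longrightarrow> v \<le> real (cost w')"
  shows "(1 - (1 - 1 / real n) ^ card S) * v \<le> real (cost w)"
  using assms(1)
proof (induction rule: greedy.induct)
  case (greedy_step S w i)
  have mono: "cost w \<le> cost (serve i w)"
    unfolding cost_def using serve_ge[of w i] by (intro sum_mono) (auto simp: le_fun_def)
  have "v \<le> real (cost w) + real n * (real (cost (serve i w)) - real (cost w))"
    by (rule greedy_augment[OF greedy_step.hyps(1) T(1) lower])
      (use greedy_step.hyps mono T in auto)
  then have "v / n + (1 - 1 / n) * real (cost w) \<le> real (cost (serve i w))"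
    using n by (simp add: field_simps)
  moreover have "(1 - 1 / n) * ((1 - (1 - 1 / n) ^ card S) * v) \<le> (1 - 1 / n) * real (cost w)"
    using n greedy_step.IH by (intro mult_left_mono) (auto simp: field_simps)
  moreover have "card (insert i S) = Suc (card S)"
    using greedy_step.hyps(2) finite_subset[OF greedy_subset[OF greedy_step.hyps(1)] finite_SA]
    by (intro card_insert_disjoint) auto
  ultimately show ?case by (simp add: algebra_simps)
qed simp

lemma greedy_approx:
  assumes gr: "greedy S w" and S: "card S = n" and T: "T \<subseteq> cand" "card T \<le> n" and "v \<ge> 0"
    and lower: "\<And>w'. feasible T (\<lambda>c. real (w' c)) \<Longrightarrow> v \<le> real (cost w')"
  shows "(1 - exp (-1)) * v \<le> real (cost w)"
\<comment> \<open>Without any choice the power bound gives nothing; but then \<open>T\<close> is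
  empty, and the weights are feasible for it.\<close>
proof (cases "n = 0")
  case True
  then have "T = {}" using T finite_subset[OF T(1) finite_SA] by simp
  then have "v \<le> real (cost w)"
    using lower[of w] greedy_feasible[OF gr] by (auto simp: feasible_def)
  moreover have "exp (-1) * v \<ge> 0" using assms by simp
  ultimately show ?thesis by (simp add: algebra_simps)
next
  case False
  have "(1 - 1 / real n) ^ n \<le> exp (- 1 / real n) ^ n"
    using False exp_ge_add_one_self[of "- 1 / real n"] by (intro power_mono) (auto simp: field_simps)
  also have "\<dots> = exp (-1)" using False by (simp flip: exp_of_nat_mult)
  finally have "(1 - exp (-1)) * v \<le> (1 - (1 - 1 / real n) ^ n) * v"
    using assms by (intro mult_right_mono) auto
  then show ?thesis using greedy_lower[OF gr T _ lower] False S by force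
qed

end

section \<open>Cost of loop programs\<close>

text \<open>Sizes are counted in units of \<open>b\<close>: over a memory with entries below
  \<open>2 ^ b\<close>, a value has at most \<open>b * esize e\<close> bits. Only stored numbers
  have to fit into \<open>b\<close> bits; intermediate results may be longer. \<open>ecost\<close>
  measures the cost of an evaluation in the same unit.\<close>

fun esize :: "expr \<Rightarrow> nat" where
  "esize (Const n) = bits n"
| "esize (Read x a) = 1 + esize a"
| "esize (Plus a b) = 1 + esize a + esize b"
| "esize (Minus a b) = 1 + esize a + esize b"
| "esize (Times a b) = 1 + esize a + esize b"
| "esize (Div a b) = 1 + esize a + esize b"

fun ecost :: "expr \<Rightarrow> nat" where
  "ecost (Const n) = bits n"
| "ecost (Read x a) = ecost a + 1"
| "ecost (Plus a b) = ecost a + ecost b + (1 + esize a + esize b)"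
| "ecost (Minus a b) = ecost a + ecost b + (1 + esize a + esize b)"
| "ecost (Times a b) = ecost a + ecost b + (1 + esize a + esize b)"
| "ecost (Div a b) = ecost a + ecost b + (1 + esize a + esize b)"

fun reads :: "expr \<Rightarrow> string set" where
  "reads (Const n) = {}"
| "reads (Read x a) = insert x (reads a)"
| "reads (Plus a b) = reads a \<union> reads b"
| "reads (Minus a b) = reads a \<union> reads b"
| "reads (Times a b) = reads a \<union> reads b"
| "reads (Div a b) = reads a \<union> reads b"

fun pcost :: "prog \<Rightarrow> nat" where
  "pcost Skip = 1"
| "pcost (Write x a e) = 1 + ecost a + ecost e"
| "pcost (Seq P Q) = 1 + pcost P + pcost Q"
| "pcost (Cond e P Q) = 1 + ecost e + pcost P + pcost Q"
| "pcost (While e P) = 1 + ecost e + pcost P"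

fun depth :: "prog \<Rightarrow> nat" where
  "depth Skip = 0"
| "depth (Write x a e) = 0"
| "depth (Seq P Q) = max (depth P) (depth Q)"
| "depth (Cond e P Q) = max (depth P) (depth Q)"
| "depth (While e P) = Suc (depth P)"

fun writes :: "prog \<Rightarrow> string set" where
  "writes Skip = {}"
| "writes (Write x a e) = {x}"
| "writes (Seq P Q) = writes P \<union> writes Q"
| "writes (Cond e P Q) = writes P \<union> writes Q"
| "writes (While e P) = writes P"

lemma eval_cong: "(\<And>x. x \<in> reads e \<Longrightarrow> m x = m' x) \<Longrightarrow> eval e m = eval e m'"
  by (induction e) auto

lemma exec_frame: "exec P m t m' \<Longrightarrow> x \<notin> writes P \<Longrightarrow> m' x = m x"
  by (induction rule: exec.induct) auto

section \<open>Bit lengths of values and the cost of expressions\<close>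

lemma less_two_power_bits: "n < 2 ^ bits n"
proof (cases "n = 0")
  case False
  then show ?thesis using floor_log_exp2_gt[of n] by (simp add: bits_def)
qed (simp add: bits_def)

lemma bits_le: "n < 2 ^ b \<Longrightarrow> b \<ge> 1 \<Longrightarrow> bits n \<le> b"
proof (cases "n = 0")
  case False
  assume "n < 2 ^ b" "b \<ge> 1"
  then have "2 ^ floor_log n < (2::nat) ^ b"
    using le_less_trans[OF floor_log_exp2_le[of n]] False by blast
  then have "floor_log n < b" by simp
  then show ?thesis by (simp add: bits_def)
qed (simp add: bits_def)

definition bounded_mem :: "nat \<Rightarrow> mem \<Rightarrow> bool" where
  "bounded_mem b m \<longleftrightarrow> (\<forall>x i. m x i < 2 ^ b)"

lemma esize_pos: "esize e \<ge> 1"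
  by (induction e) (simp_all add: bits_def)

text \<open>Bit lengths add up under products, and a sum has at most one bit more than its longer
  summand. The 1 that \<open>esize\<close> counts for an operator pays for this bit, as
  \<open>b \<ge> 1\<close>.\<close>

lemma eval_less:
  assumes "bounded_mem b m" "b \<ge> 1"
  shows "eval e m < 2 ^ (b * esize e)"
proof (induction e)
  case (Const n)
  have "n < 2 ^ bits n" by (rule less_two_power_bits)
  also have "\<dots> \<le> 2 ^ (b * bits n)" using assms by (intro power_increasing) auto
  finally show ?case by simp
next
  case (Read x a)
  have "m x (eval a m) < 2 ^ b" using assms by (simp add: bounded_mem_def)
  also have "\<dots> \<le> 2 ^ (b * esize (Read x a))" by (intro power_increasing) auto
  finally show ?case by simp
next
  case (Plus e f)
  have "(2::nat) ^ (b * esize e) \<le> 2 ^ (b * esize e + b * esize f)"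
    "(2::nat) ^ (b * esize f) \<le> 2 ^ (b * esize e + b * esize f)" by (auto intro!: power_increasing)
  then have "eval (Plus e f) m < 2 ^ (Suc (b * esize e + b * esize f))"
    using Plus unfolding eval.simps power_Suc by linarith
  also have "\<dots> \<le> 2 ^ (b * esize (Plus e f))"
    using assms by (intro power_increasing) (auto simp: algebra_simps)
  finally show ?case .
next
  case (Minus e f)
  then have "eval (Minus e f) m < 2 ^ (b * esize e)" by simp
  also have "\<dots> \<le> 2 ^ (b * esize (Minus e f))" by (intro power_increasing mult_le_mono) auto
  finally show ?case .
next
  case (Times e f)
  then have "eval (Times e f) m < 2 ^ (b * esize e) * 2 ^ (b * esize f)"
    by (simp add: mult_strict_mono)
  also have "\<dots> = 2 ^ (b * esize e + b * esize f)" by (simp add: power_add)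
  also have "\<dots> \<le> 2 ^ (b * esize (Times e f))"
    by (intro power_increasing) (auto simp: algebra_simps)
  finally show ?case .
next
  case (Div e f)
  then have "eval (Div e f) m < 2 ^ (b * esize e)"
    using le_less_trans[OF div_le_dividend] by simp
  also have "\<dots> \<le> 2 ^ (b * esize (Div e f))" by (intro power_increasing mult_le_mono) auto
  finally show ?case .
qed

lemma bits_eval_le: "bounded_mem b m \<Longrightarrow> b \<ge> 1 \<Longrightarrow> bits (eval e m) \<le> b * esize e"
  using eval_less[of b m e] esize_pos[of e] by (intro bits_le) auto

lemma eval_cost_le: "bounded_mem b m \<Longrightarrow> b \<ge> 1 \<Longrightarrow> eval_cost e m \<le> b * ecost e"
proof (induction e)
  case (Read x a)
  have "bits (m x (eval a m)) \<le> b"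
    using Read.prems by (intro bits_le) (auto simp: bounded_mem_def)
  then show ?case using Read by (simp add: algebra_simps)
next
  case (Plus e f)
  show ?case using Plus bits_eval_le[of b m "Plus e f"] by (simp add: algebra_simps)
next
  case (Minus e f)
  show ?case using Minus bits_eval_le[of b m "Minus e f"] by (simp add: algebra_simps)
next
  case (Times e f)
  show ?case using Times bits_eval_le[of b m "Times e f"] by (simp add: algebra_simps)
next
  case (Div e f)
  show ?case using Div bits_eval_le[of b m "Div e f"] by (simp add: algebra_simps)
qed simp

section \<open>Counting loops and timed total correctness\<close>

definition For :: "string \<Rightarrow> expr \<Rightarrow> prog \<Rightarrow> prog" where
  "For x e P = Seq (Write x (Const 0) (Const 0))
     (While (Minus e (Read x (Const 0)))
        (Seq P (Write x (Const 0) (Plus (Read x (Const 0)) (Const 1)))))"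

definition put :: "mem \<Rightarrow> string \<Rightarrow> nat \<Rightarrow> nat \<Rightarrow> mem" where
  "put m x i v = m(x := (m x)(i := v))"

lemma put_same [simp]: "put m x i v x = (m x)(i := v)"
  by (simp add: put_def)

lemma put_other [simp]: "y \<noteq> x \<Longrightarrow> put m x i v y = m y"
  by (simp add: put_def)

lemma writes_For [simp]: "writes (For x e P) = insert x (writes P)"
  by (auto simp: For_def)

text \<open>\<open>b\<close> bounds the bits of every stored number, and \<open>L\<close> the number
  of rounds of every loop. With these two bounds fixed, the running time depends only on the shape
  of the program.\<close>

locale resources =
  fixes b L :: nat
  assumes L_less: "Suc L < 2 ^ b"
begin

text \<open>Each level of nesting contributes a factor \<open>L + 1\<close>: at most
  \<open>L\<close> rounds and the last test of the condition.\<close>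

definition time :: "prog \<Rightarrow> nat" where
  "time P = pcost P * (L + 1) ^ depth P * b"

text \<open>A timed total correctness statement for one concrete initial memory, which spares a
  language of assertions. The bound on the memory is built in as assumption and conclusion, so the
  rules pass it on silently.\<close>

definition ok :: "prog \<Rightarrow> mem \<Rightarrow> (mem \<Rightarrow> bool) \<Rightarrow> bool" where
  "ok P m R \<longleftrightarrow> (bounded_mem b m \<longrightarrow>
     (\<exists>t m'. exec P m t m' \<and> t \<le> time P \<and> bounded_mem b m' \<and> R m'))"

lemma b_pos: "b \<ge> 1"
  using L_less by (cases b) auto

lemma mono_time: "c \<le> pcost P \<Longrightarrow> d \<le> depth P \<Longrightarrow> c * (L + 1) ^ d * b \<le> time P"
  unfolding time_def by (intro mult_le_mono power_increasing) auto

lemma ok_frame: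
  assumes "ok P m R"
    and "\<And>m'. R m' \<Longrightarrow> bounded_mem b m' \<Longrightarrow> (\<And>x. x \<notin> writes P \<Longrightarrow> m' x = m x) \<Longrightarrow> R' m'"
  shows "ok P m R'"
  using assms exec_frame unfolding ok_def by meson

lemma ok_weaken: "ok P m R \<Longrightarrow> (\<And>m'. R m' \<Longrightarrow> R' m') \<Longrightarrow> ok P m R'"
  unfolding ok_def by blast

lemma ok_Skip: "R m \<Longrightarrow> ok Skip m R"
  unfolding ok_def using exec.Skip[of m] mono_time[of 1 Skip 0] b_pos by fastforce

lemma ok_Write:
  assumes "eval e m < 2 ^ b" "R (put m x (eval a m) (eval e m))"
  shows "ok (Write x a e) m R"
  unfolding ok_def
proof (intro impI exI conjI)
  assume m: "bounded_mem b m"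
  show "exec (Write x a e) m (1 + eval_cost a m + eval_cost e m) (put m x (eval a m) (eval e m))"
    unfolding put_def by (rule exec.Write)
  have "1 + eval_cost a m + eval_cost e m \<le> b + b * ecost a + b * ecost e"
    using eval_cost_le[OF m b_pos, of a] eval_cost_le[OF m b_pos, of e] b_pos by simp
  then show "1 + eval_cost a m + eval_cost e m \<le> time (Write x a e)"
    by (simp add: time_def algebra_simps)
  show "bounded_mem b (put m x (eval a m) (eval e m))"
    using m assms by (simp add: bounded_mem_def put_def)
qed (rule assms)

lemma ok_Seq: "ok P m (\<lambda>m'. ok Q m' R) \<Longrightarrow> ok (Seq P Q) m R"
  unfolding ok_def
proof (rule impI)
  assume *: "bounded_mem b m \<longrightarrow> (\<exists>t m'. exec P m t m' \<and> t \<le> time P \<and> bounded_mem b m' \<and>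
    (bounded_mem b m' \<longrightarrow> (\<exists>t m''. exec Q m' t m'' \<and> t \<le> time Q \<and> bounded_mem b m'' \<and> R m'')))"
    and "bounded_mem b m"
  then obtain t m' t' m'' where e: "exec P m t m'" "t \<le> time P" "exec Q m' t' m''" "t' \<le> time Q"
    "bounded_mem b m''" "R m''" by blast
  have "1 + t + t' \<le> time (Seq P Q)"
  proof -
    let ?d = "depth (Seq P Q)"
    have "time P \<le> pcost P * (L + 1) ^ ?d * b" "time Q \<le> pcost Q * (L + 1) ^ ?d * b"
      unfolding time_def by (intro mult_le_mono power_increasing; simp)+
    moreover have "1 \<le> 1 * (L + 1) ^ ?d * b" using b_pos by simp
    moreover have "time (Seq P Q) = 1 * (L + 1) ^ ?d * b + pcost P * (L + 1) ^ ?d * b + pcost Q * (L + 1) ^ ?d * b"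
      unfolding time_def by (simp add: algebra_simps)
    ultimately show ?thesis using e by linarith
  qed
  with e show "\<exists>t m'. exec (Seq P Q) m t m' \<and> t \<le> time (Seq P Q) \<and> bounded_mem b m' \<and> R m'"
    using exec.Seq by blast
qed

lemma time_Cond:
  assumes "bounded_mem b m" "t \<le> time P \<or> t \<le> time Q"
  shows "1 + eval_cost e m + t \<le> time (Cond e P Q)"
proof -
  let ?d = "depth (Cond e P Q)"
  have "time P \<le> pcost P * (L + 1) ^ ?d * b" "time Q \<le> pcost Q * (L + 1) ^ ?d * b"
    unfolding time_def by (intro mult_le_mono power_increasing; simp)+
  then have t: "t \<le> pcost P * (L + 1) ^ ?d * b + pcost Q * (L + 1) ^ ?d * b" using assms by linarith
  have "1 + eval_cost e m \<le> (1 + ecost e) * b"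
    using eval_cost_le[OF assms(1) b_pos, of e] b_pos by (simp add: algebra_simps)
  also have "(1 + ecost e) * b \<le> (1 + ecost e) * (L + 1) ^ ?d * b"
    using mult_le_mono2[of 1 "(L + 1) ^ ?d" "1 + ecost e"] by (intro mult_le_mono) auto
  finally show ?thesis using t unfolding time_def by (simp add: algebra_simps)
qed

lemma ok_Cond:
  assumes "eval e m \<noteq> 0 \<Longrightarrow> ok P m R" "eval e m = 0 \<Longrightarrow> ok Q m R"
  shows "ok (Cond e P Q) m R"
  unfolding ok_def
proof (rule impI)
  assume m: "bounded_mem b m"
  show "\<exists>t m'. exec (Cond e P Q) m t m' \<and> t \<le> time (Cond e P Q) \<and> bounded_mem b m' \<and> R m'"
  proof (cases "eval e m = 0")
    case True
    then obtain t m' where "exec Q m t m'" "t \<le> time Q" "bounded_mem b m'" "R m'"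
      using assms(2) m unfolding ok_def by blast
    then show ?thesis using exec.CondFalse[OF True] time_Cond[OF m, of t P Q] by blast
  next
    case False
    then obtain t m' where "exec P m t m'" "t \<le> time P" "bounded_mem b m'" "R m'"
      using assms(1) m unfolding ok_def by blast
    then show ?thesis using exec.CondTrue[OF False] time_Cond[OF m, of t P Q] by blast
  qed
qed

text \<open>The loop bound \<open>e\<close> is reevaluated before every iteration, so the body must not change it.\<close>

lemma ok_For:
  assumes n: "eval e m = n" "n \<le> L"
    and x: "x \<notin> writes P" "reads e \<inter> insert x (writes P) = {}"
    and init: "Inv 0 (put m x 0 0)"
    and body: "\<And>k m'. k < n \<Longrightarrow> m' x 0 = k \<Longrightarrow> (\<And>y. y \<notin> insert x (writes P) \<Longrightarrow> m' y = m y) \<Longrightarrow>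
      bounded_mem b m' \<Longrightarrow> Inv k m' \<Longrightarrow> ok P m' (\<lambda>m''. Inv (Suc k) (put m'' x 0 (Suc k)))"
    and final: "\<And>m'. (\<And>y. y \<notin> insert x (writes P) \<Longrightarrow> m' y = m y) \<Longrightarrow> bounded_mem b m' \<Longrightarrow> Inv n m' \<Longrightarrow> R m'"
  shows "ok (For x e P) m R"
  unfolding ok_def
proof (rule impI)
  assume m: "bounded_mem b m"
  let ?c = "Minus e (Read x (Const 0))"
  let ?inc = "Write x (Const 0) (Plus (Read x (Const 0)) (Const 1))"
  let ?fr = "\<lambda>m'. \<forall>y. y \<notin> insert x (writes P) \<longrightarrow> m' y = m y"
  define W where "W = (1 + ecost ?c) * b"
  define T where "T = 1 + time P + (1 + ecost (Const 0) + ecost (Plus (Read x (Const 0)) (Const 1))) * b"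
  have ev: "eval e m' = n" if "?fr m'" for m'
    using eval_cong[of e m' m] that x n by blast
  \<comment> \<open>Induction on the number \<open>j\<close> of remaining rounds. \<open>W\<close>
    bounds a test of the condition and \<open>T\<close> the body with the increment of the counter;
    the separate \<open>W\<close> is the last, failing test.\<close>
  have "\<exists>t m''. exec (While ?c (Seq P ?inc)) m' t m'' \<and> t \<le> W + j * (W + T) \<and> bounded_mem b m'' \<and> ?fr m'' \<and> Inv n m''"
    if "j \<le> n" "m' x 0 = n - j" "?fr m'" "bounded_mem b m'" "Inv (n - j) m'" for j m'
    using that
  proof (induction j arbitrary: m')
    case 0
    have "1 + eval_cost ?c m' \<le> W"
      using eval_cost_le[OF 0(4) b_pos, of ?c] b_pos by (simp add: W_def algebra_simps)
    moreover have "exec (While ?c (Seq P ?inc)) m' (1 + eval_cost ?c m') m'"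
      using ev[OF 0(3)] 0(2) by (intro exec.WhileFalse) simp
    ultimately show ?case using 0 by auto
  next
    case (Suc j)
    define k where "k = n - Suc j"
    have k: "k < n" "Suc k = n - j" using Suc.prems by (auto simp: k_def)
    have "ok P m' (\<lambda>m''. Inv (Suc k) (put m'' x 0 (Suc k)))"
      by (rule body) (use Suc.prems k in \<open>auto simp: k_def\<close>)
    then obtain t m1 where m1: "exec P m' t m1" "t \<le> time P" "bounded_mem b m1" "Inv (Suc k) (put m1 x 0 (Suc k))"
      using Suc.prems(4) unfolding ok_def by blast
    let ?m2 = "put m1 x 0 (Suc k)"
    have x1: "m1 x 0 = k" using exec_frame[OF m1(1) x(1)] Suc.prems by (simp add: k_def)
    let ?ti = "1 + eval_cost (Const 0) m1 + eval_cost (Plus (Read x (Const 0)) (Const 1)) m1"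
    have "exec ?inc m1 ?ti (put m1 x (eval (Const 0) m1) (eval (Plus (Read x (Const 0)) (Const 1)) m1))"
      unfolding put_def by (rule exec.Write)
    then have inc: "exec ?inc m1 ?ti ?m2" using x1 by simp
    have ti: "?ti \<le> (1 + ecost (Const 0) + ecost (Plus (Read x (Const 0)) (Const 1))) * b"
    proof -
      have "?ti \<le> b + b * ecost (Const 0) + b * ecost (Plus (Read x (Const 0)) (Const 1))"
        using eval_cost_le[OF m1(3) b_pos, of "Const 0"] b_pos
          eval_cost_le[OF m1(3) b_pos, of "Plus (Read x (Const 0)) (Const 1)"] by linarith
      then show ?thesis by (simp only: distrib_left mult_1_right mult.commute[of _ b])
    qed
    have bd: "bounded_mem b ?m2"
      using m1(3) k(1) n L_less by (auto simp: bounded_mem_def put_def)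
    have fr: "?fr ?m2" using exec_frame[OF m1(1)] Suc.prems(3) by auto
    have inv2: "Inv (n - j) ?m2" using m1(4) k by simp
    have x2: "?m2 x 0 = n - j" using k by simp
    obtain t' m'' where m'': "exec (While ?c (Seq P ?inc)) ?m2 t' m''" "t' \<le> W + j * (W + T)"
      "bounded_mem b m''" "?fr m''" "Inv n m''"
      using Suc.IH[OF _ x2 fr bd inv2] Suc_leD[OF Suc.prems(1)] by blast
    have "eval ?c m' \<noteq> 0" using ev[OF Suc.prems(3)] Suc.prems(1,2) by simp
    then have ex: "exec (While ?c (Seq P ?inc)) m' (1 + eval_cost ?c m' + (1 + t + ?ti) + t') m''"
      using exec.WhileTrue exec.Seq m1(1) inc m''(1) by blast
    have "1 + eval_cost ?c m' \<le> W"
      using eval_cost_le[OF Suc.prems(4) b_pos, of ?c] b_pos by (simp add: W_def algebra_simps)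
    then have "1 + eval_cost ?c m' + (1 + t + ?ti) + t' \<le> W + Suc j * (W + T)"
      using m1(2) ti m''(2) unfolding T_def mult_Suc by linarith
    then show ?case using ex m'' by blast
  qed
  note loop = this
  have bd0: "bounded_mem b (put m x 0 0)" using m by (auto simp: bounded_mem_def put_def)
  obtain t m' where t: "exec (While ?c (Seq P ?inc)) (put m x 0 0) t m'" "t \<le> W + n * (W + T)"
    "bounded_mem b m'" "?fr m'" "Inv n m'"
    using loop[of n "put m x 0 0"] init bd0 by auto
  have "exec (Write x (Const 0) (Const 0)) m (1 + eval_cost (Const 0) m + eval_cost (Const 0) m)
      (put m x (eval (Const 0) m) (eval (Const 0) m))"
    unfolding put_def by (rule exec.Write)
  then have "exec (Write x (Const 0) (Const 0)) m (1 + bits 0 + bits 0) (put m x 0 0)" by simp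
  then have ex: "exec (For x e P) m (1 + (1 + bits 0 + bits 0) + t) m'"
    unfolding For_def using t(1) by (rule exec.Seq)
  have "1 + (1 + bits 0 + bits 0) + t \<le> time (For x e P)"
  proof -
    define X where "X = (L + 1) ^ depth P"
    define i where "i = 1 + ecost (Const 0) + ecost (Plus (Read x (Const 0)) (Const 1))"
    define c where "c = 1 + (1 + bits 0 + bits 0)"
    have X: "X \<ge> 1" by (simp add: X_def)
    have Xb: "1 \<le> X * b" "b \<le> X * b" using X b_pos by auto
    have W: "W \<le> (1 + ecost ?c) * (X * b)"
      unfolding W_def using Xb by (intro mult_le_mono) auto
    have "i * b \<le> i * (X * b)" using Xb by (intro mult_le_mono) auto
    then have T: "T \<le> (1 + pcost P + i) * (X * b)"
      using Xb unfolding T_def time_def X_def[symmetric] i_def[symmetric] distrib_right mult.assoc by linarith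
    have "t \<le> (L + 1) * (W + T)"
    proof -
      have "n * (W + T) \<le> L * (W + T)" using n by (intro mult_le_mono1)
      moreover have "(L + 1) * (W + T) = L * (W + T) + (W + T)" by (simp only: distrib_right mult_1_left)
      ultimately show ?thesis using t(2) by linarith
    qed
    also have "\<dots> \<le> (L + 1) * ((1 + ecost ?c) * (X * b) + (1 + pcost P + i) * (X * b))"
      using W T by (intro mult_le_mono add_mono) auto
    finally have t: "t \<le> (1 + ecost ?c + (1 + pcost P + i)) * ((L + 1) * (X * b))"
      by (simp only: algebra_simps)
    have "1 * 1 \<le> (L + 1) * (X * b)" using Xb by (intro mult_le_mono) auto
    then have "c * 1 \<le> c * ((L + 1) * (X * b))" unfolding mult_1 by (rule mult_le_mono2)
    then have "c + t \<le> (c + (1 + ecost ?c + (1 + pcost P + i))) * ((L + 1) * (X * b))"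
      using t by (simp only: distrib_right mult_1_right)
    also have "\<dots> = time (For x e P)"
      unfolding time_def For_def c_def i_def X_def by (simp add: algebra_simps)
    finally show ?thesis by (simp only: c_def)
  qed
  then show "\<exists>t m'. exec (For x e P) m t m' \<and> t \<le> time (For x e P) \<and> bounded_mem b m' \<and> R m'"
    using ex t final by blast
qed

end

section \<open>The greedy algorithm as a program\<close>

abbreviation scalar :: "string \<Rightarrow> expr" where
  "scalar x \<equiv> Read x (Const 0)"

abbreviation assign :: "string \<Rightarrow> expr \<Rightarrow> prog" where
  "assign x e \<equiv> Write x (Const 0) e"

abbreviation input :: "expr \<Rightarrow> expr" where
  "input e \<equiv> Read ''input'' e"

abbreviation element_expr :: expr where
  "element_expr \<equiv> input (Plus (scalar ''base'') (Plus (Const 3) (scalar ''j'')))"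

abbreviation code_expr :: expr where
  "code_expr \<equiv> Plus (Times element_expr (scalar ''N'')) (Read ''SC'' (scalar ''e''))"

text \<open>The first pass decides whether the edge is violated, the second one updates its members.
  \<open>tot\<close> follows the cost of \<open>w2\<close>; it is increased before the old weight of
  the member is overwritten.\<close>

definition step_prog :: prog where
  "step_prog =
     Seq (assign ''s'' (Const 0))
    (Seq (For ''j'' (scalar ''sz'') (assign ''s'' (Plus (scalar ''s'') (Read ''w2'' code_expr))))
    (Cond (Minus (scalar ''val'') (scalar ''s''))
       (For ''j'' (scalar ''sz'')
         (Seq (assign ''c'' code_expr)
         (Seq (assign ''tot'' (Plus (scalar ''tot'') (Plus (Read ''w2'' (scalar ''c'')) (scalar ''add''))))
         (Write ''w2'' (scalar ''c'') (Plus (Times (Const 2) (Read ''w2'' (scalar ''c''))) (scalar ''add''))))))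
       Skip))"

definition relax_prog :: prog where
  "relax_prog =
     Seq (assign ''val'' (Times (Times (input (scalar ''base''))
            (Div (scalar ''Q'') (input (Plus (scalar ''base'') (Const 1))))) (Times (Const 4) (input (Const 0)))))
    (Seq (assign ''add'' (Div (scalar ''val'') (Times (Const 4) (scalar ''sz''))))
    (For ''r'' (Const 8) step_prog))"

abbreviation fetch_prog :: "prog \<Rightarrow> prog" where
  "fetch_prog P \<equiv>
     Seq (assign ''base'' (Read ''ST'' (scalar ''e'')))
    (Seq (assign ''sz'' (input (Plus (scalar ''base'') (Const 2)))) P)"

text \<open>With truncated subtraction the sum of both differences is the absolute difference, which
  vanishes exactly if the element is the vehicle \<open>v\<close>.\<close>

definition serve_prog :: prog where
  "serve_prog = For ''e'' (scalar ''ne'') (fetch_prog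
    (Seq (assign ''hit'' (Const 0))
    (Seq (For ''j'' (scalar ''sz'')
       (Cond (Plus (Minus element_expr (scalar ''v'')) (Minus (scalar ''v'') element_expr))
          Skip (assign ''hit'' (Const 1))))
    (Cond (scalar ''hit'') relax_prog Skip))))"

text \<open>Indices are built from the names of vehicles and requests and may be exponential in the
  input size, so an array cannot be copied by running through its index range. The hyperedges reach
  exactly the indices in \<open>U\<close>; elsewhere the arrays are kept zero.\<close>

definition copy_prog :: "string \<Rightarrow> string \<Rightarrow> prog" where
  "copy_prog X Y = For ''e'' (scalar ''ne'') (fetch_prog
    (For ''j'' (scalar ''sz'')
      (Seq (assign ''c'' code_expr) (Write Y (scalar ''c'') (Read X (scalar ''c''))))))"

abbreviation env_vars :: "string set" where
  "env_vars \<equiv> {''input'', ''ST'', ''SC'', ''N'', ''ne'', ''Q'', ''na'', ''nb''}"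

definition base_prog :: prog where
  "base_prog =
     Seq (For ''i'' (scalar ''nb'')
       (Seq (assign ''v'' (input (Plus (Const 4) (Plus (scalar ''na'') (scalar ''i''))))) serve_prog))
    (Seq (copy_prog ''w2'' ''w'') (assign ''totw'' (scalar ''tot'')))"

definition try_prog :: prog where
  "try_prog = Seq (copy_prog ''w'' ''w2'') (Seq (assign ''tot'' (scalar ''totw'')) serve_prog)"

text \<open>The inner condition is nonzero iff \<open>best \<le> tot\<close>. A weak comparison is
  required so that the first candidate is recorded even if its cost is zero.\<close>

definition select_prog :: prog where
  "select_prog = For ''i'' (scalar ''na'')
     (Seq (assign ''v'' (input (Plus (Const 3) (scalar ''i''))))
     (Cond (Read ''ch'' (scalar ''v'')) Skip
       (Seq try_prog
       (Cond (Minus (Plus (scalar ''tot'') (Const 1)) (scalar ''best''))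
         (Seq (assign ''best'' (scalar ''tot'')) (assign ''bv'' (scalar ''v''))) Skip))))"

text \<open>The selection remembers only the name of the best vehicle, so its trial is repeated
  before its weights are adopted. The shift of the output index leaves room for the cardinality at
  index 0.\<close>

definition extend_prog :: prog where
  "extend_prog =
     Seq (assign ''best'' (Const 0))
    (Seq select_prog
    (Seq (assign ''v'' (scalar ''bv''))
    (Seq try_prog
    (Seq (copy_prog ''w2'' ''w'')
    (Seq (assign ''totw'' (scalar ''tot''))
    (Seq (Write ''ch'' (scalar ''v'') (Const 1))
    (Write ''output'' (Plus (scalar ''t'') (Const 1)) (scalar ''v''))))))))"

text \<open>Under truncated subtraction, \<open>na - (na - K)\<close> is the minimum of
  \<open>na\<close> and the budget \<open>K\<close>. The budget itself may be exponential in the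
  input size and would not do as a loop bound.\<close>

definition greedy_prog :: prog where
  "greedy_prog =
     Seq base_prog
    (Seq (assign ''n'' (Minus (scalar ''na'') (Minus (scalar ''na'') (input (Const 1)))))
    (Seq (For ''t'' (scalar ''n'') extend_prog)
    (Write ''output'' (Const 0) (scalar ''n''))))"

lemma writes_step_prog [simp]: "writes step_prog = {''s'', ''j'', ''c'', ''tot'', ''w2''}"
  by (simp add: step_prog_def insert_commute)

lemma writes_relax_prog [simp]:
  "writes relax_prog = {''val'', ''add'', ''r'', ''s'', ''j'', ''c'', ''tot'', ''w2''}"
  by (simp add: relax_prog_def insert_commute)

lemma writes_serve_prog [simp]:
  "writes serve_prog = {''e'', ''base'', ''sz'', ''hit'', ''val'', ''add'', ''r'', ''s'', ''j'', ''c'', ''tot'', ''w2''}"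
  by (simp add: serve_prog_def insert_commute)

lemma writes_copy_prog [simp]: "writes (copy_prog X Y) = {''e'', ''base'', ''sz'', ''j'', ''c'', Y}"
  by (simp add: copy_prog_def insert_commute)

lemma writes_try_prog [simp]:
  "writes try_prog = {''e'', ''base'', ''sz'', ''hit'', ''val'', ''add'', ''r'', ''s'', ''j'', ''c'', ''tot'', ''w2''}"
  by (simp add: try_prog_def insert_commute)

lemma writes_select_prog [simp]:
  "writes select_prog = {''i'', ''v'', ''e'', ''base'', ''sz'', ''hit'', ''val'', ''add'', ''r'', ''s'', ''j'', ''c'', ''tot'',
     ''w2'', ''best'', ''bv''}"
  by (simp add: select_prog_def insert_commute)

lemma writes_extend_prog [simp]:
  "writes extend_prog = {''i'', ''v'', ''e'', ''base'', ''sz'', ''hit'', ''val'', ''add'', ''r'', ''s'', ''j'', ''c'', ''tot'',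
     ''w2'', ''best'', ''bv'', ''w'', ''totw'', ''ch'', ''output''}"
  by (simp add: extend_prog_def insert_commute)

section \<open>The table of hyperedges and the covering problem that it describes\<close>

locale table =
  fixes inp ST SC :: "nat \<Rightarrow> nat" and N ne Q nb :: nat
begin

text \<open>Hyperedges are read in place: \<open>ST e\<close> is a position in the input, where the
  numerator, the denominator, the number of members and the members follow one another. This
  explains the offsets here and in the next definitions.\<close>

definition sz :: "nat \<Rightarrow> nat" where
  "sz e = inp (ST e + 2)"

definition element :: "nat \<Rightarrow> nat \<Rightarrow> nat" where
  "element e j = inp (ST e + (3 + j))"

text \<open>
  The factor \<open>4 p\<close> ensures that the increment \<open>weight e div (4 * sz e)\<close> in a step is positive.
\<close>

definition weight :: "nat \<Rightarrow> nat" where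
  "weight e = inp (ST e) * (Q div inp (ST e + 1)) * (4 * inp 0)"

text \<open>The weight of element \<open>g\<close> in scenario \<open>\<xi>\<close> is stored at index \<open>g * N + \<xi>\<close>.\<close>

definition code :: "nat \<Rightarrow> nat \<Rightarrow> nat" where
  "code e j = element e j * N + SC e"

definition table_edge :: "nat \<Rightarrow> edge" where
  "table_edge e = (code e ` {..<sz e}, weight e)"

definition has :: "nat \<Rightarrow> nat \<Rightarrow> bool" where
  "has v e \<longleftrightarrow> (\<exists>j<sz e. element e j = v)"

definition es :: "nat \<Rightarrow> edge list" where
  "es v = map table_edge (filter (has v) [0..<ne])"

text \<open>Only pairs that occur in some hyperedge carry a weight. All other variables of the inner
  program can be set to zero.\<close>

definition U :: "nat set" where
  "U = (\<Union>e<ne. code e ` {..<sz e})"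

definition cand :: "nat set" where
  "cand = (\<lambda>k. inp (3 + k)) ` {..<inp 2}"

definition bs :: "nat list" where
  "bs = map (\<lambda>k. inp (4 + (inp 2 + k))) [0..<nb]"

end

text \<open>\<open>B\<close> bounds the scaled values. The last two assumptions make room for each
  weight, which is at most \<open>3 * B\<close> by \<open>step_le\<close>, and for the total cost;
  \<open>L8\<close> admits the eight rounds of \<open>relax\<close>.\<close>

locale edge_table = table inp ST SC N ne Q nb + resources b L
  for inp ST SC :: "nat \<Rightarrow> nat" and N ne Q nb b L :: nat +
  fixes B :: nat
  assumes ne: "ne \<le> L" and na: "inp 2 \<le> L" and nb: "nb \<le> L" and L8: "8 \<le> L"
    and sz: "e < ne \<Longrightarrow> 0 < sz e \<and> sz e \<le> inp 0 \<and> sz e \<le> L"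
    and inj_code: "e < ne \<Longrightarrow> inj_on (code e) {..<sz e}"
    and code_less: "e < ne \<Longrightarrow> j < sz e \<Longrightarrow> code e j < 2 ^ b"
    and weight: "e < ne \<Longrightarrow> 4 * sz e \<le> weight e \<and> weight e \<le> B"
    and inj_SA: "inj_on (\<lambda>k. inp (3 + k)) {..<inp 2}"
    and p1: "1 \<le> inp 0"
    and B: "3 * B < 2 ^ b" "card U * (3 * B) + 1 < 2 ^ b"
begin

lemma wf_table_edge: "e < ne \<Longrightarrow> fst (table_edge e) \<subseteq> U \<and> wf_edge (inp 0) (table_edge e)"
  using sz[of e] weight[of e] card_image[OF inj_code[of e]]
  by (auto simp: table_edge_def U_def wf_edge_def)

sublocale greedy_covering U "inp 0" es cand bs
proof
  show "finite U" by (simp add: U_def)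
  show "finite cand" by (simp add: cand_def)
  fix e i assume "e \<in> set (es i)"
  then obtain k where "k < ne" "e = table_edge k" by (auto simp: es_def)
  then show "fst e \<subseteq> U \<and> wf_edge (inp 0) e" using wf_table_edge by blast
qed (rule p1)

definition env :: "mem \<Rightarrow> bool" where
  "env m \<longleftrightarrow> m ''input'' = inp \<and> m ''ST'' = ST \<and> m ''SC'' = SC \<and>
     m ''N'' 0 = N \<and> m ''ne'' 0 = ne \<and> m ''Q'' 0 = Q \<and>
     m ''na'' 0 = inp 2 \<and> m ''nb'' 0 = nb"

lemma env_frame:
  assumes "env m" "\<And>x. x \<notin> A \<Longrightarrow> m' x = m x" "A \<inter> env_vars = {}"
  shows "env m'"
proof -
  have eq: "m' x = m x" if "x \<in> env_vars" for x
  proof (rule assms(2), rule notI)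
    assume "x \<in> A"
    then have "x \<in> A \<inter> env_vars" using that by (rule IntI)
    then show False unfolding assms(3) by (rule emptyE)
  qed
  have "m' ''input'' = m ''input''" "m' ''ST'' = m ''ST''" "m' ''SC'' = m ''SC''" "m' ''N'' = m ''N''"
    "m' ''ne'' = m ''ne''" "m' ''Q'' = m ''Q''" "m' ''na'' = m ''na''" "m' ''nb'' = m ''nb''"
    by (rule eq, simp)+
  with assms(1) show ?thesis by (simp add: env_def)
qed

lemma env_put: "env m \<Longrightarrow> x \<notin> env_vars \<Longrightarrow> env (put m x i v)"
  by (rule env_frame[where A = "{x}"]) simp_all

lemma env_simps:
  assumes "env m"
  shows "m ''input'' = inp" "m ''ST'' = ST" "m ''SC'' = SC" "m ''N'' 0 = N" "m ''ne'' 0 = ne" "m ''Q'' 0 = Q"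
    "m ''na'' 0 = inp 2" "m ''nb'' 0 = nb"
  using assms by (auto simp: env_def)

lemma env_less:
  assumes "env m" "bounded_mem b m"
  shows "inp i < 2 ^ b" "ST i < 2 ^ b"
  using assms(2) unfolding bounded_mem_def env_simps(1,2)[OF assms(1), symmetric] by blast+

definition small :: "(nat \<Rightarrow> nat) \<Rightarrow> bool" where
  "small w \<longleftrightarrow> (\<forall>c. w c \<le> 3 * B) \<and> (\<forall>c. c \<notin> U \<longrightarrow> w c = 0)"

lemma small_cost: "small w \<Longrightarrow> cost w + 1 < 2 ^ b"
  using sum_bounded_above[of U w "3 * B"] B(2) by (simp add: small_def cost_def)

lemma small_less: "small w \<Longrightarrow> w c < 2 ^ b"
  using B(1) le_less_trans unfolding small_def by blast

lemma small_step: "e < ne \<Longrightarrow> small w \<Longrightarrow> small (step (table_edge e) w)"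
proof -
  assume e: "e < ne" and w: "small w"
  have "fst (table_edge e) \<subseteq> U" "finite (fst (table_edge e))" "snd (table_edge e) \<le> B"
    using wf_table_edge[OF e] weight[OF e] by (auto simp: table_edge_def)
  then have "step (table_edge e) w c \<le> 3 * B" "c \<notin> U \<Longrightarrow> step (table_edge e) w c = 0" for c
    using step_le[of "table_edge e" B w] funpow_step_outside[of c "table_edge e" 1 w] w
    by (auto simp: small_def)
  then show ?thesis by (simp add: small_def)
qed

lemma small_funpow_step: "e < ne \<Longrightarrow> small w \<Longrightarrow> small ((step (table_edge e) ^^ k) w)"
  by (induction k) (auto simp: small_step)

lemma small_relax: "e < ne \<Longrightarrow> small w \<Longrightarrow> small (relax (table_edge e) w)"
  by (simp add: relax_def small_funpow_step)

lemma small_relax_all: "(\<And>e. e \<in> set xs \<Longrightarrow> e < ne) \<Longrightarrow> small w \<Longrightarrow> small (relax_all (map table_edge xs) w)"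
  by (induction xs arbitrary: w) (auto simp: small_relax)

lemma small_serve: "small w \<Longrightarrow> small (serve v w)"
  unfolding serve_def es_def by (rule small_relax_all) auto

lemma sum_code: "e < ne \<Longrightarrow> sum w (code e ` {..<sz e}) = (\<Sum>i<sz e. w (code e i))"
  using inj_code by (simp add: sum.reindex)

lemma image_lessThan_Suc: "f ` {..<Suc k} = insert (f k) (f ` {..<k})"
  by (auto simp: less_Suc_eq)

section \<open>Correctness of the subprograms\<close>

lemma step_prog_ok:
  assumes m: "env m" "m ''e'' 0 = e" "e < ne" "m ''base'' 0 = ST e" "m ''sz'' 0 = inp (ST e + 2)"
    "m ''val'' 0 = weight e" "m ''add'' 0 = weight e div (4 * sz e)"
    "m ''w2'' = w" "m ''tot'' 0 = cost w" "small w"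
  shows "ok step_prog m (\<lambda>m'. m' ''w2'' = step (table_edge e) w \<and> m' ''tot'' 0 = cost (step (table_edge e) w))"
proof -
  define a where "a = weight e div (4 * sz e)"
  have env: "m ''input'' = inp" "m ''SC'' = SC" "m ''N'' 0 = N" using m(1) by (auto simp: env_def)
  have szL: "sz e \<le> L" using sz m by blast
  \<comment> \<open>Every stored number must fit into \<open>b\<close> bits, including each partial
    sum; the cost of \<open>w\<close> dominates them all.\<close>
  have partial: "(\<Sum>i<k. w (code e i)) < 2 ^ b" if "k \<le> sz e" for k
  proof -
    have "(\<Sum>i<k. w (code e i)) \<le> (\<Sum>i<sz e. w (code e i))"
      using that by (intro sum_mono2) auto
    also have "\<dots> = sum w (fst (table_edge e))" using m by (simp add: sum_code table_edge_def)
    also have "\<dots> \<le> cost w" unfolding cost_def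
      using wf_table_edge[of e] m finite_U by (intro sum_mono2) auto
    finally show ?thesis using small_cost[OF m(10)] by simp
  qed
  show ?thesis
    unfolding step_prog_def
  proof (rule ok_Seq, rule ok_Write, simp, rule ok_Seq,
      rule ok_For[where n = "sz e" and Inv = "\<lambda>k m'. m' ''s'' 0 = (\<Sum>i<k. w (code e i))"], goal_cases)
    case (6 k m')
    then show ?case
      using m env partial[of "Suc k"] by (intro ok_Write) (simp_all add: code_def element_def)
  next
    case (7 m1)
    let ?s = "\<Sum>i<sz e. w (code e i)"
    have fr: "m1 y = m y" if "y \<notin> {''s'', ''j''}" for y using 7(1)[of y] that by auto
    have s: "m1 ''s'' 0 = ?s" using 7 by simp
    show ?case
    proof (rule ok_Cond)
      assume "eval (Minus (scalar ''val'') (scalar ''s'')) m1 \<noteq> 0"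
      then have viol: "sum w (fst (table_edge e)) < weight e"
        using s fr[of "''val''"] m by (simp add: sum_code table_edge_def)
      have st: "step (table_edge e) w = (\<lambda>c. if c \<in> code e ` {..<sz e} then 2 * w c + a else w c)"
        using viol card_image[OF inj_code[OF m(3)]] by (auto simp: step_def table_edge_def a_def)
      have sub: "code e ` {..<sz e} \<subseteq> U" using m by (auto simp: U_def)
      have cst: "cost (step (table_edge e) w) = cost w + (\<Sum>i<sz e. w (code e i) + a)"
      proof -
        have "cost (step (table_edge e) w) = (\<Sum>c\<in>U. w c + (if c \<in> code e ` {..<sz e} then w c + a else 0))"
          unfolding cost_def st by (intro sum.cong) auto
        also have "\<dots> = cost w + (\<Sum>c\<in>code e ` {..<sz e}. w c + a)"
          unfolding sum.distrib[of w] cost_def using finite_U sub by (simp add: sum.If_cases Int_absorb1 sum.distrib)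
        finally show ?thesis using inj_code[OF m(3)] by (simp add: sum.reindex)
      qed
      show "ok (For ''j'' (scalar ''sz'')
         (Seq (assign ''c'' code_expr)
         (Seq (assign ''tot'' (Plus (scalar ''tot'') (Plus (Read ''w2'' (scalar ''c'')) (scalar ''add''))))
         (Write ''w2'' (scalar ''c'') (Plus (Times (Const 2) (Read ''w2'' (scalar ''c''))) (scalar ''add''))))))
         m1 (\<lambda>m'. m' ''w2'' = step (table_edge e) w \<and> m' ''tot'' 0 = cost (step (table_edge e) w))"
      proof (rule ok_For[where n = "sz e" and Inv = "\<lambda>k m'.
          m' ''w2'' = (\<lambda>c. if c \<in> code e ` {..<k} then 2 * w c + a else w c) \<and>
          m' ''tot'' 0 = cost w + (\<Sum>i<k. w (code e i) + a)"], goal_cases)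
        case (6 k m')
        have fr': "m' y = m y" if "y \<notin> {''s'', ''j'', ''c'', ''tot'', ''w2''}" for y
          using 6(3)[of y] fr[of y] that by auto
        have "cost w + (\<Sum>i<Suc k. w (code e i) + a) \<le> cost (step (table_edge e) w)"
          unfolding cst using 6(1) by (intro add_left_mono sum_mono2) auto
        then have tot: "cost w + (\<Sum>i<Suc k. w (code e i) + a) < 2 ^ b"
          using small_cost[OF small_step[OF m(3,10)]] by simp
        \<comment> \<open>A member met twice would be doubled twice; injectivity of
          \<open>code e\<close> excludes this.\<close>
        have new: "code e k \<notin> code e ` {..<k}"
          using inj_onD[OF inj_code[OF m(3)], of k] 6(1) by force
        have "step (table_edge e) w (code e k) = 2 * w (code e k) + a" using 6(1) by (auto simp: st)
        then have w2: "2 * w (code e k) + a < 2 ^ b"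
          using small_less[OF small_step[OF m(3,10)], of "code e k"] by simp
        have vals: "m' ''input'' (m' ''base'' 0 + (3 + m' ''j'' 0)) * m' ''N'' 0 + m' ''SC'' (m' ''e'' 0) = code e k"
          "m' ''add'' 0 = a"
          using 6(2) m env by (simp_all add: fr' code_def element_def a_def)
        have Inv: "m' ''w2'' (code e k) = w (code e k)" "m' ''tot'' 0 = cost w + (\<Sum>i<k. w (code e i) + a)"
          using 6(5) new by auto
        show ?case
          using tot w2 code_less[OF m(3) 6(1)]
          by (intro ok_Seq ok_Write; simp add: vals Inv)
            (rule ext, subst conjunct1[OF 6(5)], simp add: image_lessThan_Suc)
      qed (use m fr[of "''sz''"] fr[of "''w2''"] fr[of "''tot''"] szL cst in \<open>simp_all add: st sz_def\<close>)
    next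
      assume "eval (Minus (scalar ''val'') (scalar ''s'')) m1 = 0"
      then have "step (table_edge e) w = w"
        using s fr[of "''val''"] m by (simp add: step_def sum_code table_edge_def)
      then show "ok Skip m1 (\<lambda>m'. m' ''w2'' = step (table_edge e) w \<and> m' ''tot'' 0 = cost (step (table_edge e) w))"
        using m fr by (intro ok_Skip) simp
    qed
  qed (use m env szL in \<open>simp_all add: sz_def\<close>)
qed

lemma relax_prog_ok:
  assumes m: "env m" "m ''e'' 0 = e" "e < ne" "m ''base'' 0 = ST e" "m ''sz'' 0 = inp (ST e + 2)"
    "m ''w2'' = w" "m ''tot'' 0 = cost w" "small w"
  shows "ok relax_prog m (\<lambda>m'. m' ''w2'' = relax (table_edge e) w \<and> m' ''tot'' 0 = cost (relax (table_edge e) w))"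
proof -
  have env: "m ''input'' = inp" "m ''Q'' 0 = Q" "m ''SC'' = SC" "m ''ST'' = ST" "m ''N'' 0 = N" "m ''ne'' 0 = ne"
    using m(1) by (auto simp: env_def)
  have wB: "weight e < 2 ^ b" using weight[OF m(3)] B(1) by simp
  then have "weight e div (4 * sz e) < 2 ^ b" by (rule le_less_trans[OF div_le_dividend])
  show ?thesis
    unfolding relax_prog_def
  proof (rule ok_Seq, rule ok_Write, goal_cases)
    case 1 show ?case using wB m env by (simp add: weight_def)
  next
    case 2
    show ?case
    proof (rule ok_Seq, rule ok_Write, goal_cases)
      case 1 show ?case using \<open>weight e div (4 * sz e) < 2 ^ b\<close> m env by (simp add: weight_def sz_def)
    next
      case 2
      show ?case
      proof (rule ok_For[where n = 8 and Inv = "\<lambda>k m'.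
          m' ''w2'' = (step (table_edge e) ^^ k) w \<and> m' ''tot'' 0 = cost ((step (table_edge e) ^^ k) w)"], goal_cases)
        case (6 k m')
        have fr: "m' x = m x" if "x \<notin> writes relax_prog" for x
          using 6(3)[of x] that by auto
        have va: "m' ''val'' 0 = weight e" "m' ''add'' 0 = weight e div (4 * sz e)"
          using 6(3)[of "''val''"] 6(3)[of "''add''"] m env by (auto simp: weight_def sz_def)
        have env': "env m'" by (rule env_frame[OF m(1)], erule fr, simp)
        have vals: "m' ''e'' 0 = e" "m' ''base'' 0 = ST e" "m' ''sz'' 0 = inp (ST e + 2)"
          using fr m by simp_all
        show ?case
          by (rule ok_weaken[OF step_prog_ok[OF env' vals(1) m(3) vals(2,3) va]])
            (use 6(5) small_funpow_step[OF m(3,8), of k] in simp_all)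
      qed (use m L8 in \<open>simp_all add: relax_def\<close>)
    qed
  qed
qed

lemma fetch_ok:
  assumes m: "env m" "bounded_mem b m" "m ''e'' 0 = e"
    and R: "ok P (put (put m ''base'' 0 (ST e)) ''sz'' 0 (inp (ST e + 2))) R"
  shows "ok (fetch_prog P) m R"
  using m R env_simps[OF m(1)] env_less[OF m(1,2)]
  by (intro ok_Seq ok_Write) simp_all

lemma serve_prog_ok:
  assumes m: "env m" "m ''v'' 0 = v" "m ''w2'' = w" "m ''tot'' 0 = cost w" "small w"
  shows "ok serve_prog m (\<lambda>m'. m' ''w2'' = serve v w \<and> m' ''tot'' 0 = cost (serve v w))"
proof -
  define W where "W = (\<lambda>k. relax_all (map table_edge (filter (has v) [0..<k])) w)"
  have small_W: "small (W k)" if "k \<le> ne" for k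
    unfolding W_def by (rule small_relax_all) (use that m in auto)
  show ?thesis
    unfolding serve_prog_def
  proof (rule ok_For[where n = ne and Inv = "\<lambda>k m'. m' ''w2'' = W k \<and> m' ''tot'' 0 = cost (W k)"], goal_cases)
    case (6 k m')
    have fr: "m' x = m x" if "x \<notin> writes serve_prog" for x
      using 6(3)[of x] that by (simp add: serve_prog_def)
    have env': "env m'" by (rule env_frame[OF m(1)], erule fr, simp)
    define m1 where "m1 = put (put (put m' ''base'' 0 (ST k)) ''sz'' 0 (inp (ST k + 2))) ''hit'' 0 0"
    have env1: "env m1" unfolding m1_def by (intro env_put env') simp_all
    have m1: "m1 ''base'' 0 = ST k" "m1 ''sz'' 0 = inp (ST k + 2)" "m1 ''hit'' 0 = 0"
      "m1 ''e'' 0 = k" "m1 ''v'' 0 = v" "m1 ''w2'' = W k" "m1 ''tot'' 0 = cost (W k)"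
      using 6(2,5) fr[of "''v''"] m by (simp_all add: m1_def)
    have search: "ok (For ''j'' (scalar ''sz'')
       (Cond (Plus (Minus element_expr (scalar ''v'')) (Minus (scalar ''v'') element_expr))
          Skip (assign ''hit'' (Const 1)))) m1 (\<lambda>m'. m' ''hit'' 0 = of_bool (has v k))"
    proof (rule ok_For[where n = "sz k" and Inv = "\<lambda>i m'. m' ''hit'' 0 = of_bool (\<exists>j<i. element k j = v)"], goal_cases)
      case (6 i m2)
      have fr2: "m2 x = m1 x" if "x \<notin> {''j'', ''hit''}" for x
        using 6(3)[of x] that by auto
      have el: "m2 ''input'' (m2 ''base'' 0 + (3 + m2 ''j'' 0)) = element k i"
        using m1 6(2) env_simps[OF env1] by (simp add: fr2 element_def)
      have v2: "m2 ''v'' 0 = v" using m1 by (simp add: fr2)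
      show ?case
        by (rule ok_Cond; (rule ok_Skip | rule ok_Write))
          (use 6(2,5) el v2 L_less in \<open>auto simp: less_Suc_eq\<close>)
    qed (use m1 sz[OF 6(1)] in \<open>simp_all add: sz_def has_def\<close>)
    show ?case
    proof (rule fetch_ok[OF env' 6(4) 6(2)], rule ok_Seq, rule ok_Write, goal_cases)
      case 2
      show ?case
        unfolding eval.simps m1_def[symmetric]
      proof (rule ok_Seq, rule ok_frame[OF search], goal_cases)
        case (1 m2)
        have fr2: "m2 x = m1 x" if "x \<notin> {''j'', ''hit''}" for x
          using 1(3)[of x] that by auto
        have env2: "env m2" by (rule env_frame[OF env1], erule fr2, simp)
        have eq: "W (Suc k) = (if has v k then relax (table_edge k) (W k) else W k)"
          by (simp add: W_def relax_all_append)
        show ?case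
        proof (rule ok_Cond, goal_cases)
          case 1
          then have "has v k" using \<open>m2 ''hit'' 0 = of_bool (has v k)\<close> by simp
          then show ?case
            using \<open>k < ne\<close> m1 small_W[of k] eq
            by (intro ok_weaken[OF relax_prog_ok[OF env2]]) (simp_all add: fr2)
        next
          case 2
          then have "\<not> has v k" using \<open>m2 ''hit'' 0 = of_bool (has v k)\<close> by (auto split: if_splits)
          then show ?case using m1 eq by (intro ok_Skip) (simp add: fr2)
        qed
      qed
    qed simp
  qed (use m ne env_simps[OF m(1)] in \<open>simp_all add: W_def serve_def es_def\<close>)
qed

lemma copy_prog_ok:
  assumes m: "env m" "\<And>c. c \<notin> U \<Longrightarrow> m X c = 0" "\<And>c. c \<notin> U \<Longrightarrow> m Y c = 0"
    and XY: "X \<noteq> Y" "{X, Y} \<inter> {''e'', ''base'', ''sz'', ''j'', ''c''} = {}" "{X, Y} \<inter> env_vars = {}"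
  shows "ok (copy_prog X Y) m (\<lambda>m'. m' Y = m X)"
proof -
  have XY': "X \<noteq> ''e''" "X \<noteq> ''base''" "X \<noteq> ''sz''" "X \<noteq> ''j''" "X \<noteq> ''c''"
    "Y \<noteq> ''e''" "Y \<noteq> ''base''" "Y \<noteq> ''sz''" "Y \<noteq> ''j''" "Y \<noteq> ''c''"
    using XY by auto
  define D where "D = (\<lambda>k. \<Union>e<k. code e ` {..<sz e})"
  show ?thesis
    unfolding copy_prog_def
  proof (rule ok_For[where n = ne and Inv = "\<lambda>k m'. m' Y = (\<lambda>c. if c \<in> D k then m X c else m Y c)"], goal_cases)
    case (6 k m')
    have fr: "m' x = m x" if "x \<notin> writes (copy_prog X Y)" for x
      using 6(3)[of x] that by (simp add: copy_prog_def)
    have env': "env m'" by (rule env_frame[OF m(1)], erule fr, use XY XY' in simp)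
    define m1 where "m1 = put (put m' ''base'' 0 (ST k)) ''sz'' 0 (inp (ST k + 2))"
    have env1: "env m1" unfolding m1_def by (intro env_put env') simp_all
    have m1: "m1 ''base'' 0 = ST k" "m1 ''sz'' 0 = inp (ST k + 2)" "m1 ''e'' 0 = k" "m1 X = m X"
      "m1 Y = m' Y"
      using 6(2,5) fr[of X] XY XY' by (simp_all add: m1_def)
    show ?case
    proof (rule fetch_ok[OF env' 6(4) 6(2)], fold m1_def,
        rule ok_For[where n = "sz k" and Inv = "\<lambda>i m'. m' Y = (\<lambda>c. if c \<in> D k \<union> code k ` {..<i} then m X c else m Y c)"], goal_cases)
      case (6 i m2)
      have fr2: "m2 x = m1 x" if "x \<notin> {''j'', ''c'', Y}" for x
        using 6(3)[of x] that by auto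
      have cd: "m2 ''input'' (m2 ''base'' 0 + (3 + m2 ''j'' 0)) * m2 ''N'' 0 + m2 ''SC'' (m2 ''e'' 0) = code k i"
        using m1 6(2) env_simps[OF env1] XY XY' by (simp add: fr2 element_def code_def)
      have X2: "m2 X = m X" using m1 XY XY' by (simp add: fr2)
      have lt: "m X c < 2 ^ b" for c
        using 6(4) unfolding bounded_mem_def X2[symmetric] by blast
      show ?case
        using 6(5) code_less[OF \<open>k < ne\<close> 6(1)] lt
        by (intro ok_Seq ok_Write) (simp_all add: image_lessThan_Suc fun_eq_iff cd X2 XY(1) XY')
    next
      case (7 m2)
      have "D (Suc k) = D k \<union> code k ` {..<sz k}" by (auto simp: D_def lessThan_Suc)
      then show ?case using 7(3) XY'(6) by simp
    qed (use m1 6(5) XY' sz[OF 6(1)] in \<open>simp_all add: sz_def\<close>)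
  next
    case (7 m')
    have "D ne = U" by (simp add: D_def U_def)
    then have "m' Y c = m X c" for c using 7(3) m(2)[of c] m(3)[of c] by simp
    then show ?case by (rule ext)
  qed (use m ne XY XY' env_simps[OF m(1)] in \<open>simp_all add: D_def\<close>)
qed

lemma small_fold_serve: "small w \<Longrightarrow> small (fold serve is w)"
  by (induction "is" arbitrary: w) (auto simp: small_serve)

lemma small_zero: "small (\<lambda>_. 0)"
  by (simp add: small_def)

lemma greedy_small: "greedy S w \<Longrightarrow> small w"
  by (induction rule: greedy.induct) (auto simp: base_def small_zero small_fold_serve small_serve)

lemma base_prog_ok:
  assumes m: "env m" "m ''w2'' = (\<lambda>_. 0)" "m ''w'' = (\<lambda>_. 0)" "m ''tot'' 0 = 0"
  shows "ok base_prog m (\<lambda>m'. m' ''w'' = base \<and> m' ''w2'' = base \<and> m' ''totw'' 0 = cost base)"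
  unfolding base_prog_def
proof (rule ok_Seq, rule ok_For[where n = nb and Inv = "\<lambda>k m'.
    m' ''w2'' = fold serve (take k bs) (\<lambda>_. 0) \<and> m' ''tot'' 0 = cost (fold serve (take k bs) (\<lambda>_. 0))"], goal_cases)
  case (6 k m')
  have env': "env m'" by (rule env_frame[OF m(1)], erule 6(3), simp)
  have v: "inp (4 + (inp 2 + k)) = bs ! k" using 6(1) by (simp add: bs_def)
  have "fold serve (take (Suc k) bs) (\<lambda>_. 0) = serve (bs ! k) (fold serve (take k bs) (\<lambda>_. 0))"
    using 6(1) by (simp add: take_Suc_conv_app_nth bs_def)
  then show ?case
    using 6(2,5) env_simps[OF env'] env_less(1)[OF env' 6(4), of "4 + (inp 2 + k)"] v
    by (intro ok_Seq ok_Write ok_weaken[OF serve_prog_ok[where v = "bs ! k"]])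
      (simp_all add: env_put[OF env'] small_fold_serve small_zero)
next
  case (7 m1)
  have env1: "env m1" by (rule env_frame[OF m(1)], erule 7(1), simp)
  have bs: "take nb bs = bs" by (simp add: bs_def)
  have sm: "small base" unfolding base_def by (intro small_fold_serve small_zero)
  have m1: "m1 ''w2'' = base" "m1 ''tot'' 0 = cost base" "m1 ''w'' = (\<lambda>_. 0)"
    using 7(1)[of "''w''"] 7(3) m bs by (simp_all add: base_def)
  show ?case
  proof (rule ok_Seq, rule ok_frame[OF copy_prog_ok[OF env1]], goal_cases)
    case (6 m2)
    then show ?case
      using 6(3)[of "''w2''"] 6(3)[of "''tot''"] m1 small_cost[OF sm] by (intro ok_Write) simp_all
  qed (use m1 sm in \<open>simp_all add: small_def\<close>)
qed (use m nb env_simps[OF m(1)] in \<open>simp_all add: cost_def\<close>)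

lemma try_prog_ok:
  assumes m: "env m" "m ''v'' 0 = v" "m ''w'' = w" "m ''totw'' 0 = cost w" "small w"
    "\<And>c. c \<notin> U \<Longrightarrow> m ''w2'' c = 0"
  shows "ok try_prog m (\<lambda>m'. m' ''w2'' = serve v w \<and> m' ''tot'' 0 = cost (serve v w))"
  unfolding try_prog_def
proof (rule ok_Seq, rule ok_frame[OF copy_prog_ok[OF m(1)]], goal_cases)
  case (6 m1)
  have env1: "env m1" by (rule env_frame[OF m(1)], erule 6(3), simp)
  show ?case
    using 6(1) 6(3)[of "''v''"] 6(3)[of "''totw''"] m small_cost[OF m(5)] env_put[OF env1, of "''tot''"]
    by (intro ok_Seq ok_Write serve_prog_ok) simp_all
qed (use m in \<open>simp_all add: small_def\<close>)

lemma select_prog_ok: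
  assumes m: "env m" "m ''w'' = w" "m ''totw'' 0 = cost w" "m ''ch'' = (\<lambda>c. of_bool (c \<in> S))" "m ''best'' 0 = 0"
    "\<And>c. c \<notin> U \<Longrightarrow> m ''w2'' c = 0"
    and w: "small w" and S: "\<not> cand \<subseteq> S"
  shows "ok select_prog m (\<lambda>m'. m' ''bv'' 0 \<in> cand - S \<and>
    (\<forall>j\<in>cand - S. cost (serve j w) \<le> cost (serve (m' ''bv'' 0) w)) \<and> (\<forall>c. c \<notin> U \<longrightarrow> m' ''w2'' c = 0))"
proof -
  define A where "A = (\<lambda>k. (\<lambda>i. inp (3 + i)) ` {..<k} - S)"
  \<comment> \<open>\<open>bv\<close> carries no information until an unchosen candidate has been
    tried, hence the case distinction on \<open>A k = {}\<close>.\<close>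
  define Inv where "Inv = (\<lambda>k m'. (\<forall>c. c \<notin> U \<longrightarrow> m' ''w2'' c = (0::nat)) \<and>
    (\<forall>j\<in>A k. cost (serve j w) \<le> m' ''best'' 0) \<and>
    (if A k = {} then m' ''best'' 0 = 0 else m' ''bv'' 0 \<in> A k \<and> cost (serve (m' ''bv'' 0) w) = m' ''best'' (0::nat)))"
  have A_na: "A (inp 2) = cand - S" by (simp add: A_def cand_def)
  show ?thesis
    unfolding select_prog_def
  proof (rule ok_For[where n = "inp 2" and Inv = Inv], goal_cases)
    case (6 k m')
    define v where "v = inp (3 + k)"
    have fr: "m' x = m x" if "x \<notin> writes select_prog" for x
      using 6(3)[of x] that by (simp add: select_prog_def)
    have env': "env m'" by (rule env_frame[OF m(1)], erule fr, simp)
    define m1 where "m1 = put m' ''v'' 0 v"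
    have env1: "env m1" unfolding m1_def by (rule env_put[OF env']) simp
    have m1: "m1 ''v'' 0 = v" "m1 ''w'' = w" "m1 ''totw'' 0 = cost w" "m1 ''ch'' = (\<lambda>c. of_bool (c \<in> S))"
      "m1 ''best'' = m' ''best''" "m1 ''bv'' = m' ''bv''" "m1 ''w2'' = m' ''w2''"
      using m fr[of "''w''"] fr[of "''totw''"] fr[of "''ch''"] by (simp_all add: m1_def)
    have A_Suc: "A (Suc k) = (if v \<in> S then A k else insert v (A k))"
      by (auto simp: A_def v_def image_lessThan_Suc)
    have w2: "m' ''w2'' c = 0" if "c \<notin> U" for c using 6(5) that by (simp add: Inv_def)
    have "ok (Cond (Read ''ch'' (scalar ''v'')) Skip
       (Seq try_prog
       (Cond (Minus (Plus (scalar ''tot'') (Const 1)) (scalar ''best''))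
         (Seq (assign ''best'' (scalar ''tot'')) (assign ''bv'' (scalar ''v''))) Skip))) m1
       (\<lambda>m''. Inv (Suc k) (put m'' ''i'' 0 (Suc k)))"
    proof (rule ok_Cond)
      assume "eval (Read ''ch'' (scalar ''v'')) m1 \<noteq> 0"
      then have "v \<in> S" using m1 by simp
      then show "ok Skip m1 (\<lambda>m''. Inv (Suc k) (put m'' ''i'' 0 (Suc k)))"
        using 6(5) by (intro ok_Skip) (simp add: Inv_def A_Suc m1)
    next
      assume "eval (Read ''ch'' (scalar ''v'')) m1 = 0"
      then have v: "v \<notin> S" using m1 by simp
      show "ok (Seq try_prog
       (Cond (Minus (Plus (scalar ''tot'') (Const 1)) (scalar ''best''))
         (Seq (assign ''best'' (scalar ''tot'')) (assign ''bv'' (scalar ''v''))) Skip)) m1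
        (\<lambda>m''. Inv (Suc k) (put m'' ''i'' 0 (Suc k)))"
      proof (rule ok_Seq, rule ok_frame[OF try_prog_ok[OF env1 m1(1-3) w]], goal_cases)
        case (2 m2)
        define c where "c = cost (serve v w)"
        have m2: "m2 ''tot'' 0 = c" "m2 ''best'' 0 = m' ''best'' 0" "m2 ''bv'' 0 = m' ''bv'' 0" "m2 ''v'' 0 = v"
          using 2(1) 2(3)[of "''best''"] 2(3)[of "''bv''"] 2(3)[of "''v''"] m1 by (simp_all add: c_def)
        have out: "m2 ''w2'' x = 0" if "x \<notin> U" for x
          using 2(1) that small_serve[OF w] by (simp add: small_def)
        have cb: "c < 2 ^ b" using small_cost[OF small_serve[OF w, of v]] by (simp add: c_def)
        have vb: "v < 2 ^ b" using env_less(1)[OF env' 6(4)] by (simp add: v_def)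
        have old: "\<forall>j\<in>A k. cost (serve j w) \<le> m' ''best'' 0"
          "if A k = {} then m' ''best'' 0 = 0 else m' ''bv'' 0 \<in> A k \<and> cost (serve (m' ''bv'' 0) w) = m' ''best'' 0"
          using 6(5) by (simp_all add: Inv_def)
        show ?case
        proof (rule ok_Cond, goal_cases)
          case 1
          then have "m' ''best'' 0 \<le> c" using m2 by simp
          then have "\<forall>j\<in>A (Suc k). cost (serve j w) \<le> c" using old(1) v by (force simp: A_Suc c_def)
          then show ?case using out cb vb v m2
            by (intro ok_Seq ok_Write) (simp_all add: Inv_def A_Suc c_def)
        next
          case 2
          then have "c < m' ''best'' 0" using m2 by simp
          then show ?case using out old v m2
            by (intro ok_Skip) (simp add: Inv_def A_Suc c_def split: if_splits)
        qed
      qed (use w2 m1 in simp)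
    qed
    then show ?case
      using 6(2) env_simps[OF env'] env_less(1)[OF env' 6(4), of "3 + k"]
      by (intro ok_Seq ok_Write) (simp_all add: m1_def v_def)
  next
    case (7 m')
    have "A (inp 2) \<noteq> {}" using S A_na by auto
    then show ?case using 7(3) unfolding Inv_def A_na by auto
  qed (use m na env_simps[OF m(1)] in \<open>simp_all add: Inv_def A_def\<close>)
qed

definition inv :: "nat \<Rightarrow> mem \<Rightarrow> bool" where
  "inv k m \<longleftrightarrow> (\<exists>S xs. greedy S (m ''w'') \<and> distinct xs \<and> set xs = S \<and> length xs = k \<and>
     m ''totw'' 0 = cost (m ''w'') \<and> m ''ch'' = (\<lambda>c. of_bool (c \<in> S)) \<and> (\<forall>c. c \<notin> U \<longrightarrow> m ''w2'' c = 0) \<and>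
     (\<forall>j<k. m ''output'' (Suc j) = xs ! j))"

lemma extend_prog_ok:
  assumes m: "env m" "m ''t'' 0 = k" "inv k m" and k: "k < card cand"
  shows "ok extend_prog m (inv (Suc k))"
proof -
  obtain S xs where g: "greedy S (m ''w'')" and xs: "distinct xs" "set xs = S" "length xs = k" "\<forall>j<k. m ''output'' (Suc j) = xs ! j"
    and st: "m ''totw'' 0 = cost (m ''w'')" "m ''ch'' = (\<lambda>c. of_bool (c \<in> S))" "\<And>c. c \<notin> U \<Longrightarrow> m ''w2'' c = 0"
    using m(3) unfolding inv_def by blast
  define w where "w = m ''w''"
  have w: "small w" using greedy_small[OF g] by (simp add: w_def)
  \<comment> \<open>The selection needs a remaining candidate, otherwise \<open>bv\<close> would not
    name one.\<close>
  have "\<not> cand \<subseteq> S"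
  proof
    assume "cand \<subseteq> S"
    then have "card cand \<le> card S" using xs by (intro card_mono) auto
    also have "card S = k" using xs distinct_card by blast
    finally show False using k by simp
  qed
  note S = this
  define m1 where "m1 = put m ''best'' 0 0"
  have env1: "env m1" unfolding m1_def by (rule env_put[OF m(1)]) simp
  have m1: "m1 ''w'' = w" "m1 ''totw'' 0 = cost w" "m1 ''ch'' = (\<lambda>c. of_bool (c \<in> S))" "m1 ''best'' 0 = 0"
    "\<And>c. c \<notin> U \<Longrightarrow> m1 ''w2'' c = 0"
    using st by (simp_all add: m1_def w_def)
  show ?thesis
    unfolding extend_prog_def
  proof (rule ok_Seq, rule ok_Write, goal_cases)
    case 2
    show ?case
      unfolding eval.simps m1_def[symmetric]
    proof (rule ok_Seq, rule ok_frame[OF select_prog_ok[OF env1 m1 w S]], goal_cases)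
      case (2 m2)
      define v where "v = m2 ''bv'' 0"
      have v: "v \<in> cand - S" "\<And>j. j \<in> cand - S \<Longrightarrow> cost (serve j w) \<le> cost (serve v w)"
        using 2(1) by (auto simp: v_def)
      have vb: "v < 2 ^ b" using 2(2) by (simp add: v_def bounded_mem_def)
      have env2: "env m2" by (rule env_frame[OF env1], erule 2(3), simp)
      define m3 where "m3 = put m2 ''v'' 0 v"
      have env3: "env m3" unfolding m3_def by (rule env_put[OF env2]) simp
      have m3: "m3 ''v'' 0 = v" "m3 ''w'' = w" "m3 ''totw'' 0 = cost w"
        using m1 2(3)[of "''w''"] 2(3)[of "''totw''"] by (simp_all add: m3_def)
      have m3': "m3 ''w2'' c = 0" if "c \<notin> U" for c using 2(1) that by (simp add: m3_def)
      have m3'': "m3 ''ch'' = m ''ch''" "m3 ''output'' = m ''output''" "m3 ''t'' = m ''t''"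
        using 2(3)[of "''ch''"] 2(3)[of "''output''"] 2(3)[of "''t''"] by (simp_all add: m3_def m1_def)
      show ?case
      proof (rule ok_Seq, rule ok_Write, goal_cases)
        case 2
        show ?case
          unfolding eval.simps v_def[symmetric] m3_def[symmetric]
        proof (rule ok_Seq, rule ok_frame[OF try_prog_ok[OF env3 m3 w m3']], goal_cases)
          case (2 m4)
          have env4: "env m4" by (rule env_frame[OF env3], erule 2(3), simp)
          have w': "small (serve v w)" by (rule small_serve[OF w])
          have m4: "m4 ''w2'' = serve v w" "m4 ''tot'' 0 = cost (serve v w)" "m4 ''w'' = w" "m4 ''v'' 0 = v"
            "m4 ''ch'' = m ''ch''" "m4 ''output'' = m ''output''" "m4 ''t'' = m ''t''"
            using 2(1) 2(3)[of "''w''"] 2(3)[of "''v''"] 2(3)[of "''ch''"] 2(3)[of "''output''"] 2(3)[of "''t''"]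
              m3 m3'' by simp_all
          show ?case
          proof (rule ok_Seq, rule ok_frame[OF copy_prog_ok[OF env4, where X = "''w2''" and Y = "''w''"]], goal_cases)
            case (6 m5)
            have m5: "m5 ''w'' = serve v w" "m5 ''tot'' 0 = cost (serve v w)" "m5 ''v'' 0 = v"
              "m5 ''ch'' = m ''ch''" "m5 ''output'' = m ''output''" "m5 ''t'' 0 = k" "m5 ''w2'' = serve v w"
              using 6(1) 6(3)[of "''tot''"] 6(3)[of "''v''"] 6(3)[of "''ch''"] 6(3)[of "''output''"] 6(3)[of "''t''"]
                6(3)[of "''w2''"] m4 m(2) by simp_all
            have gr: "greedy (insert v S) (serve v w)"
              using greedy_step[of S w v] g v by (simp add: w_def)
            have ch: "(m ''ch'')(v := Suc 0) = (\<lambda>c. of_bool (c \<in> insert v S))"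
              using st by (auto simp: fun_eq_iff)
            have fin: "inv (Suc k) m'" if "m' ''w'' = serve v w" "m' ''totw'' 0 = cost (serve v w)"
              "m' ''ch'' = (m ''ch'')(v := Suc 0)" "m' ''output'' = (m ''output'')(Suc k := v)"
              "m' ''w2'' = serve v w" for m'
              unfolding inv_def that
            proof (intro exI conjI)
              show "distinct (xs @ [v])" "set (xs @ [v]) = insert v S" using xs v by auto
              show "\<forall>j<Suc k. ((m ''output'')(Suc k := v)) (Suc j) = (xs @ [v]) ! j"
                using xs by (auto simp: nth_append)
            qed (use xs gr ch that w' in \<open>simp_all add: small_def\<close>)
            show ?case
              by (intro ok_Seq ok_Write fin) (use m5 small_cost[OF w'] vb L_less in \<open>simp_all add: fun_upd_def\<close>)
          qed (use m4 w w' in \<open>simp_all add: small_def\<close>)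
        qed
      qed (use vb in \<open>simp add: v_def\<close>)
    qed
  qed simp
qed

lemma greedy_prog_ok:
  assumes m: "env m" "m ''w2'' = (\<lambda>_. 0)" "m ''w'' = (\<lambda>_. 0)" "m ''tot'' 0 = 0" "m ''ch'' = (\<lambda>_. 0)"
  shows "ok greedy_prog m (\<lambda>m'. \<exists>S w xs. greedy S w \<and> card S = min (inp 1) (card cand) \<and>
    distinct xs \<and> set xs = S \<and> returns m' (length xs # xs))"
proof -
  define n where "n = min (inp 1) (card cand)"
  have cand: "card cand = inp 2" unfolding cand_def using card_image[OF inj_SA] by simp
  have nL: "n \<le> L" using na cand by (simp add: n_def)
  show ?thesis
    unfolding greedy_prog_def
  proof (rule ok_Seq, rule ok_frame[OF base_prog_ok[OF m(1-4)]], goal_cases)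
    case (1 m1)
    have fr: "m1 x = m x" if "x \<notin> {''i'', ''v'', ''w'', ''totw''} \<union> writes serve_prog" for x
      using 1(3)[of x] that by (simp add: base_prog_def)
    have env1: "env m1" by (rule env_frame[OF m(1)], erule fr, simp)
    have n: "inp 2 - (inp 2 - inp 1) = n" by (simp add: n_def cand)
    define m2 where "m2 = put m1 ''n'' 0 n"
    have env2: "env m2" unfolding m2_def by (rule env_put[OF env1]) simp
    have base: "small base" using greedy_small greedy_base by blast
    have "ok (For ''t'' (scalar ''n'') extend_prog) m2 (\<lambda>m'. inv n m' \<and> m' ''n'' 0 = n)"
    proof (rule ok_For[where n = n and Inv = inv], goal_cases)
      case 5
      show ?case unfolding inv_def
        by (intro exI[of _ "{}"] exI[of _ "[]"])
          (use 1(1) base fr[of "''ch''"] m greedy_base in \<open>simp add: m2_def small_def\<close>)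
    next
      case (6 k m')
      have env': "env m'" by (rule env_frame[OF env2], erule 6(3), simp)
      show ?case
        by (rule ok_weaken[OF extend_prog_ok[OF env' 6(2,5)]])
          (use 6(1) in \<open>simp_all add: n_def inv_def\<close>)
    next
      case (7 m')
      then show ?case using 7(1)[of "''n''"] by (simp add: m2_def)
    qed (use nL in \<open>simp_all add: m2_def\<close>)
    note loop = this
    have "ok (Seq (For ''t'' (scalar ''n'') extend_prog) (Write ''output'' (Const 0) (scalar ''n''))) m2
      (\<lambda>m'. \<exists>S w xs. greedy S w \<and> card S = n \<and> distinct xs \<and> set xs = S \<and> returns m' (length xs # xs))"
    proof (rule ok_Seq, rule ok_weaken[OF loop], rule ok_Write, goal_cases)
      case (1 m3)
      then show ?case using nL L_less by simp
    next
      case (2 m3)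
      then obtain S xs where "greedy S (m3 ''w'')" "distinct xs" "set xs = S" "length xs = n"
        "\<forall>j<n. m3 ''output'' (Suc j) = xs ! j" unfolding inv_def by blast
      moreover from this have "card S = n" using distinct_card by blast
      moreover have "returns (put m3 ''output'' 0 n) (length xs # xs)"
        using calculation by (auto simp: returns_def nth_Cons split: nat.splits)
      ultimately show ?case using 2 by (intro exI[of _ S] exI[of _ "m3 ''w''"] exI[of _ xs]) simp
    qed
    then show ?case
      using env_simps[OF env1] nL L_less n
      by (intro ok_Seq[of "assign _ _"] ok_Write) (simp_all add: m2_def n_def)
  qed
qed

end

section \<open>Parsing the input\<close>

definition occurs :: "nat list \<Rightarrow> nat \<Rightarrow> nat list \<Rightarrow> bool" where
  "occurs l i k \<longleftrightarrow> (\<exists>pre post. l = pre @ k @ post \<and> length pre = i)"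

lemma occurs_append: "occurs l i (k @ k') \<Longrightarrow> occurs l i k \<and> occurs l (i + length k) k'"
  unfolding occurs_def
proof (elim exE conjE)
  fix pre post assume l: "l = pre @ (k @ k') @ post" "length pre = i"
  then have "l = pre @ k @ (k' @ post)" "l = (pre @ k) @ k' @ post" "length (pre @ k) = i + length k" by auto
  then show "(\<exists>pre post. l = pre @ k @ post \<and> length pre = i) \<and>
      (\<exists>pre post. l = pre @ k' @ post \<and> length pre = i + length k)" using l(2) by metis
qed

lemma occurs_length: "occurs l i k \<Longrightarrow> i + length k \<le> length l"
  by (auto simp: occurs_def)

lemma occurs_nth: "occurs l i k \<Longrightarrow> j < length k \<Longrightarrow> l ! (i + j) = k ! j"
  by (auto simp: occurs_def nth_append)

lemma occurs_Cons: "occurs l i (x # k) \<Longrightarrow> i < length l \<and> l ! i = x \<and> occurs l (Suc i) k"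
proof -
  assume "occurs l i (x # k)"
  then have "occurs l i [x]" "occurs l (Suc i) k" using occurs_append[of l i "[x]" k] by simp_all
  then show ?thesis using occurs_length[of l i "[x]"] occurs_nth[of l i "[x]" 0] by simp
qed

lemma occurs_concat:
  "occurs l i (concat ls) \<Longrightarrow> j < length ls \<Longrightarrow> occurs l (i + length (concat (take j ls))) (ls ! j)"
proof -
  assume o: "occurs l i (concat ls)" and j: "j < length ls"
  have "concat ls = concat (take j ls) @ ls ! j @ concat (drop (Suc j) ls)"
    using arg_cong[OF id_take_nth_drop[OF j], of concat] by simp
  then show ?thesis
    using occurs_append[of l i "concat (take j ls)"] occurs_append[of l _ "ls ! j"] o by metis
qed

text \<open>Counts are written in binary and might be exponential in the input size. Since every
  listed item has a nonempty code, the numbers of scenarios and of hyperedges are at most the input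
  length, and so they can serve as loop bounds.\<close>

lemma length_le_concat: "(\<And>y. y \<in> set ls \<Longrightarrow> y \<noteq> []) \<Longrightarrow> length ls \<le> length (concat ls)"
proof (induction ls)
  case (Cons y ls)
  then have "length ls \<le> length (concat ls)" "length y > 0" by simp_all
  then show ?case unfolding length_Cons concat.simps length_append by linarith
qed simp

lemma bit_size_take: "occurs l i k \<Longrightarrow> bit_size (take (i + length k) l) = bit_size (take i l) + bit_size k"
  by (auto simp: occurs_def bit_size_def)

lemma length_le_bit_size: "length l \<le> bit_size l"
  by (induction l) (auto simp: bit_size_def bits_def)

lemma bits_le_bit_size: "x \<in> set l \<Longrightarrow> bits x \<le> bit_size l"
  unfolding bit_size_def by (rule member_le_sum_list) auto

lemma bit_size_take_le: "bit_size (take i l) \<le> bit_size l"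
  using append_take_drop_id[of i l] unfolding bit_size_def
  by (metis le_add1 map_append sum_list_append)

lemma less_two_power_bit_size: "x \<in> set l \<Longrightarrow> x < 2 ^ bit_size l"
  by (rule less_le_trans[OF less_two_power_bits power_increasing[OF bits_le_bit_size]]) auto

lemma enc_set_iff: "enc_set S l \<longleftrightarrow> (\<exists>xs. distinct xs \<and> set xs = S \<and> l = length xs # xs)"
proof -
  have "list_all2 (\<lambda>n l. l = [n]) xs ls \<longleftrightarrow> ls = map (\<lambda>n. [n]) xs" for xs :: "nat list" and ls
    by (auto simp: list_all2_conv_all_nth list_eq_iff_nth_eq)
  then show ?thesis by (auto simp: enc_set_def enc_family_def concat_map_singleton)
qed

section \<open>The parser and its invariant\<close>

definition edge_prog :: prog where
  "edge_prog =
     Seq (Write ''ST'' (scalar ''ne'') (scalar ''pos''))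
    (Seq (Write ''SC'' (scalar ''ne'') (scalar ''xi''))
    (Seq (assign ''ne'' (Plus (scalar ''ne'') (Const 1)))
    (Seq (assign ''Q'' (Times (scalar ''Q'') (input (Plus (scalar ''pos'') (Const 1)))))
    (assign ''pos'' (Plus (scalar ''pos'') (Plus (Const 3) (input (Plus (scalar ''pos'') (Const 2)))))))))"

definition scenario_prog :: prog where
  "scenario_prog =
     Seq (assign ''pos'' (Plus (scalar ''pos'') (Plus (input (scalar ''pos'')) (Const 1))))
    (Seq (assign ''cnt'' (input (scalar ''pos'')))
    (Seq (assign ''pos'' (Plus (scalar ''pos'') (Const 1)))
    (For ''k'' (scalar ''cnt'') edge_prog)))"

definition parse_prog :: prog where
  "parse_prog =
     Seq (assign ''na'' (input (Const 2)))
    (Seq (assign ''nb'' (input (Plus (Const 3) (scalar ''na''))))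
    (Seq (assign ''N'' (input (Plus (Const 4) (Plus (scalar ''na'') (scalar ''nb'')))))
    (Seq (assign ''pos'' (Plus (Const 5) (Plus (scalar ''na'') (scalar ''nb''))))
    (Seq (assign ''Q'' (Const 1))
    (For ''xi'' (scalar ''N'') scenario_prog)))))"

lemma writes_edge_prog [simp]: "writes edge_prog = {''ST'', ''SC'', ''ne'', ''Q'', ''pos''}"
  by (simp add: edge_prog_def insert_commute)

lemma writes_scenario_prog [simp]: "writes scenario_prog = {''ST'', ''SC'', ''ne'', ''Q'', ''pos'', ''cnt'', ''k''}"
  by (simp add: scenario_prog_def insert_commute)

definition entry :: "inst \<Rightarrow> nat list \<Rightarrow> nat \<Rightarrow> nat set \<Rightarrow> nat \<Rightarrow> bool" where
  "entry I l \<xi> f i \<longleftrightarrow> (\<exists>k. enc_edge I \<xi> f k \<and> occurs l i k)"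

text \<open>Soundness and completeness of the table with respect to \<open>T\<close>. The
  divisibility makes the division in \<open>weight\<close> exact.\<close>

definition listing :: "inst \<Rightarrow> nat list \<Rightarrow> (nat \<times> nat set) set \<Rightarrow> (nat \<Rightarrow> nat) \<Rightarrow> (nat \<Rightarrow> nat) \<Rightarrow> nat \<Rightarrow> nat \<Rightarrow> bool" where
  "listing I l T ST SC ne Q \<longleftrightarrow>
     (\<forall>e<ne. \<exists>f. (SC e, f) \<in> T \<and> entry I l (SC e) f (ST e) \<and> l ! (ST e + 1) dvd Q) \<and>
     (\<forall>\<xi> f. (\<xi>, f) \<in> T \<longrightarrow> (\<exists>e<ne. SC e = \<xi> \<and> entry I l \<xi> f (ST e)))"

lemma listing_insert:
  assumes T: "listing I l T ST SC ne Q" and e: "entry I l \<xi> f i" and d: "d = l ! (i + 1)"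
  shows "listing I l (insert (\<xi>, f) T) (ST(ne := i)) (SC(ne := \<xi>)) (Suc ne) (Q * d)"
proof -
  have 1: "\<exists>f'. ((SC(ne := \<xi>)) j, f') \<in> insert (\<xi>, f) T \<and> entry I l ((SC(ne := \<xi>)) j) f' ((ST(ne := i)) j) \<and>
      l ! ((ST(ne := i)) j + 1) dvd Q * d" if "j < Suc ne" for j
  proof (cases "j = ne")
    case True
    then show ?thesis using e d by (intro exI[of _ f]) simp
  next
    case False
    then obtain f' where "(SC j, f') \<in> T" "entry I l (SC j) f' (ST j)" "l ! (ST j + 1) dvd Q"
      using T \<open>j < Suc ne\<close> unfolding listing_def by (metis less_SucE)
    then show ?thesis using False by (intro exI[of _ f']) simp
  qed
  have 2: "\<exists>j<Suc ne. (SC(ne := \<xi>)) j = \<xi>' \<and> entry I l \<xi>' f' ((ST(ne := i)) j)"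
    if "(\<xi>', f') \<in> insert (\<xi>, f) T" for \<xi>' f'
  proof (cases "(\<xi>', f') \<in> T")
    case True
    then obtain j where "j < ne" "SC j = \<xi>'" "entry I l \<xi>' f' (ST j)" using T unfolding listing_def by metis
    then show ?thesis by (intro exI[of _ j]) simp
  next
    case False
    then show ?thesis using that e by (intro exI[of _ ne]) simp
  qed
  show ?thesis unfolding listing_def using 1 2 by blast
qed

text \<open>While denominators are multiplied into \<open>Q\<close>, their bit lengths add up; so
  \<open>Q\<close> is bounded by 2 to the number of bits read so far. This is why the plain product
  of all denominators serves as a common denominator of acceptable size.\<close>

definition parsed :: "inst \<Rightarrow> nat list \<Rightarrow> (nat \<times> nat set) set \<Rightarrow> nat \<Rightarrow> mem \<Rightarrow> bool" where
  "parsed I l T pos m \<longleftrightarrow> m ''pos'' 0 = pos \<and> pos \<le> length l \<and>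
     listing I l T (m ''ST'') (m ''SC'') (m ''ne'' 0) (m ''Q'' 0) \<and>
     0 < m ''Q'' 0 \<and> m ''Q'' 0 \<le> 2 ^ bit_size (take pos l) \<and> m ''ne'' 0 \<le> pos"

context resources
begin

lemma ok_assign:
  assumes "ok P (put m x 0 v) R" "eval e m = v" "v < 2 ^ b"
  shows "ok (Seq (assign x e) P) m R"
  using assms by (intro ok_Seq ok_Write) simp_all

lemma edge_prog_ok:
  assumes m: "m ''input'' = load l ''input''" "m ''xi'' 0 = \<xi>" "parsed I l T pos m"
    and k: "enc_edge I \<xi> f k" "occurs l pos k"
    and b: "length l < 2 ^ b" "bit_size l < b" "\<xi> < 2 ^ b"
  shows "ok edge_prog m (parsed I l (insert (\<xi>, f) T) (pos + length k))"
proof -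
  obtain r xs where k': "k = nat (fst (quotient_of r)) # nat (snd (quotient_of r)) # length xs # xs"
    using k(1) by (auto simp: enc_edge_def enc_set_iff)
  define d where "d = nat (snd (quotient_of r))"
  have kd: "k = nat (fst (quotient_of r)) # d # length xs # xs" by (simp add: k' d_def)
  have len: "pos + length k \<le> length l" by (rule occurs_length[OF k(2)])
  have nth: "l ! (pos + j) = k ! j" if "j < length k" for j by (rule occurs_nth[OF k(2) that])
  have in1: "m ''input'' (pos + 1) = d" "m ''input'' (pos + 2) = length xs"
    using nth[of 1] nth[of 2] len by (auto simp: m(1) load_def kd)
  have d0: "d > 0" using quotient_of_denom_pos'[of r] by (simp add: d_def)
  have bs: "bit_size k \<ge> bits d" by (rule bits_le_bit_size) (simp add: kd)
  have "m ''Q'' 0 * d \<le> 2 ^ bit_size (take pos l) * 2 ^ bits d"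
    using m(3) less_two_power_bits[of d] by (intro mult_le_mono) (auto simp: parsed_def)
  also have "\<dots> \<le> 2 ^ bit_size (take (pos + length k) l)"
    unfolding bit_size_take[OF k(2)] power_add[symmetric] using bs by (intro power_increasing) auto
  finally have Q: "m ''Q'' 0 * d \<le> 2 ^ bit_size (take (pos + length k) l)" .
  also have "\<dots> < 2 ^ b" using bit_size_take_le[of "pos + length k" l] b(2)
    by (intro power_strict_increasing) auto
  finally have Qb: "m ''Q'' 0 * d < 2 ^ b" .
  have lst: "listing I l (insert (\<xi>, f) T) ((m ''ST'')(m ''ne'' 0 := pos)) ((m ''SC'')(m ''ne'' 0 := \<xi>))
    (Suc (m ''ne'' 0)) (m ''Q'' 0 * d)"
    by (rule listing_insert) (use m(3) k nth[of 1] in \<open>auto simp: parsed_def entry_def kd\<close>)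
  have fin: "parsed I l (insert (\<xi>, f) T) (pos + length k) m'"
    if "m' ''pos'' 0 = pos + length k" "m' ''ST'' = (m ''ST'')(m ''ne'' 0 := pos)"
      "m' ''SC'' = (m ''SC'')(m ''ne'' 0 := \<xi>)" "m' ''ne'' 0 = Suc (m ''ne'' 0)" "m' ''Q'' 0 = m ''Q'' 0 * d" for m'
    unfolding parsed_def that using lst Q d0 len m(3) by (auto simp: parsed_def kd)
  have pos: "m ''pos'' 0 = pos" "m ''ne'' 0 \<le> pos" using m(3) by (auto simp: parsed_def)
  show ?thesis
    unfolding edge_prog_def
    by (intro ok_Seq ok_Write fin) (use pos len Qb b m(2) in1 in \<open>simp_all add: kd fun_upd_def\<close>)
qed

lemma parsed_move:
  assumes "parsed I l T pos m" "pos \<le> pos'" "pos' \<le> length l" "m' ''pos'' 0 = pos'"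
    "m' ''ST'' = m ''ST''" "m' ''SC'' = m ''SC''" "m' ''ne'' = m ''ne''" "m' ''Q'' = m ''Q''"
  shows "parsed I l T pos' m'"
proof -
  have "take pos' l = take pos l @ take (pos' - pos) (drop pos l)"
    using take_add[of pos "pos' - pos" l] assms by simp
  then have "bit_size (take pos l) \<le> bit_size (take pos' l)" by (simp add: bit_size_def)
  then have "(2::nat) ^ bit_size (take pos l) \<le> 2 ^ bit_size (take pos' l)" by (intro power_increasing) auto
  with assms show ?thesis by (auto simp: parsed_def intro: order_trans)
qed

lemma scenario_prog_ok:
  assumes m: "m ''input'' = load l ''input''" "m ''xi'' 0 = \<xi>" "parsed I l T pos m"
    and k: "enc_scenario I \<xi> k" "occurs l pos k"
    and b: "length l < 2 ^ b" "bit_size l < b" "\<xi> < 2 ^ b" "length l \<le> L"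
  shows "ok scenario_prog m (parsed I l (T \<union> {\<xi>} \<times> edges I \<xi>) (pos + length k))"
proof -
  obtain ds xs ls where xs: "set xs = edges I \<xi>" "list_all2 (enc_edge I \<xi>) xs ls"
    and kd: "k = (length ds # ds) @ (length xs # concat ls)"
    using k(1) by (auto simp: enc_scenario_def enc_set_iff enc_family_def)
  have len: "pos + length k \<le> length l" by (rule occurs_length[OF k(2)])
  have nth: "l ! (pos + j) = k ! j" if "j < length k" for j by (rule occurs_nth[OF k(2) that])
  define p1 where "p1 = pos + (length ds + 1)"
  define p2 where "p2 = p1 + 1"
  have in1: "m ''input'' pos = length ds" "m ''input'' p1 = length xs"
    using nth[of 0] nth[of "length ds + 1"] len by (auto simp: m(1) load_def kd nth_append p1_def)
  have occ: "occurs l p2 (concat ls)"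
    using occurs_append[of l pos "length ds # ds" "length xs # concat ls"] k(2) occurs_Cons[of l p1]
    by (auto simp: kd p2_def p1_def)
  have lenls: "length ls = length xs" using xs(2) by (simp add: list_all2_lengthD)
  have "length ls \<le> length (concat ls)"
  proof (rule length_le_concat)
    fix y assume "y \<in> set ls"
    then obtain j where "j < length ls" "y = ls ! j" by (metis in_set_conv_nth)
    then show "y \<noteq> []" using list_all2_nthD2[OF xs(2), of j] by (auto simp: enc_edge_def)
  qed
  then have cntL: "length xs \<le> L" using len b(4) lenls by (simp add: kd)
  define m1 where "m1 = put (put (put m ''pos'' 0 p1) ''cnt'' 0 (length xs)) ''pos'' 0 p2"
  have pos: "m ''pos'' 0 = pos" using m(3) by (simp add: parsed_def)
  have m1: "m1 ''input'' = load l ''input''" "m1 ''xi'' 0 = \<xi>" "m1 ''cnt'' 0 = length xs"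
    using m by (simp_all add: m1_def)
  have parsed1: "parsed I l T p2 m1"
    by (rule parsed_move[OF m(3)]) (use len in \<open>simp_all add: m1_def p1_def p2_def kd\<close>)
  have "ok (For ''k'' (scalar ''cnt'') edge_prog) m1 (parsed I l (T \<union> {\<xi>} \<times> edges I \<xi>) (pos + length k))"
  proof (rule ok_For[where n = "length xs" and Inv = "\<lambda>j. parsed I l (T \<union> {\<xi>} \<times> set (take j xs)) (p2 + length (concat (take j ls)))"], goal_cases)
    case 5
    have "parsed I l T p2 (put m1 ''k'' 0 0)"
      by (rule parsed_move[OF parsed1]) (use occurs_length[OF occ] in \<open>simp_all add: m1_def\<close>)
    then show ?case by simp
  next
    case (6 j m')
    have j: "j < length ls" using 6(1) lenls by simp
    have e: "enc_edge I \<xi> (xs ! j) (ls ! j)" by (rule list_all2_nthD2[OF xs(2) j])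
    have m': "m' ''input'' = load l ''input''" "m' ''xi'' 0 = \<xi>"
      using 6(3)[of "''input''"] 6(3)[of "''xi''"] m1 by simp_all
    have T: "T \<union> {\<xi>} \<times> set (take (Suc j) xs) = insert (\<xi>, xs ! j) (T \<union> {\<xi>} \<times> set (take j xs))"
      using 6(1) by (simp add: take_Suc_conv_app_nth)
    have p: "p2 + length (concat (take (Suc j) ls)) = p2 + length (concat (take j ls)) + length (ls ! j)"
      using j by (simp add: take_Suc_conv_app_nth)
    show ?case
      unfolding T p
    proof (rule ok_weaken[OF edge_prog_ok[OF m' 6(5) e occurs_concat[OF occ j] b(1-3)]], goal_cases)
      case (1 m'')
      then have "m'' ''pos'' 0 \<le> length l \<and> m'' ''pos'' 0 = p2 + length (concat (take j ls)) + length (ls ! j)" by (simp add: parsed_def)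
      then show ?case by (intro parsed_move[OF 1]) simp_all
    qed
  next
    case (7 m')
    have "p2 + length (concat ls) = pos + length k" by (simp add: p2_def p1_def kd)
    then show ?case using 7(3) xs(1) lenls by simp
  qed (use m1 cntL in simp_all)
  then show ?thesis
    unfolding scenario_prog_def
    by (intro ok_Seq[of "assign _ _"] ok_Write) (use pos in1 b len cntL L_less in \<open>simp_all add: kd p1_def p2_def m1_def\<close>)
qed

lemma parse_prog_ok:
  assumes l: "l = cap_p I # budget I # (length as # as) @ (length bs # bs) @ scen I # concat ss"
    and ss: "list_all2 (enc_scenario I) [0..<scen I] ss"
    and b: "length l < 2 ^ b" "bit_size l < b" "length l \<le> L"
  shows "ok parse_prog (load l) (\<lambda>m. m ''na'' 0 = length as \<and> m ''nb'' 0 = length bs \<and> m ''N'' 0 = scen I \<and>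
    parsed I l {(\<xi>, f). \<xi> < scen I \<and> f \<in> edges I \<xi>} (length l) m)"
proof -
  let ?in = "load l ''input''"
  have lnth: "?in j = l ! j" if "j < length l" for j using that by (simp add: load_def)
  define p0 where "p0 = 5 + (length as + length bs)"
  have inp: "?in 2 = length as" "?in (3 + length as) = length bs" "?in (4 + (length as + length bs)) = scen I"
    by (simp_all add: load_def l nth_append nth_Cons')
  have len: "length l = p0 + length (concat ss)" by (simp add: l p0_def)
  have occ: "occurs l p0 (concat ss)"
    unfolding occurs_def
    by (rule exI[of _ "cap_p I # budget I # (length as # as) @ (length bs # bs) @ [scen I]"], rule exI[of _ "[]"])
      (simp add: l p0_def)
  have lens: "length ss = scen I" using list_all2_lengthD[OF ss] by simp
  have "length ss \<le> length (concat ss)"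
  proof (rule length_le_concat)
    fix y assume "y \<in> set ss"
    then obtain j where "j < length ss" "y = ss ! j" by (metis in_set_conv_nth)
    then show "y \<noteq> []" using list_all2_nthD2[OF ss, of j] by (auto simp: enc_scenario_def enc_set_iff)
  qed
  then have N: "scen I \<le> length l" using len lens by simp
  define m1 where "m1 = put (put (put (put (put (load l) ''na'' 0 (length as)) ''nb'' 0 (length bs)) ''N'' 0 (scen I)) ''pos'' 0 p0) ''Q'' 0 1"
  have m1: "m1 ''input'' = ?in" "m1 ''N'' 0 = scen I" "m1 ''na'' 0 = length as" "m1 ''nb'' 0 = length bs"
    by (simp_all add: m1_def)
  have parsed1: "parsed I l {} p0 m1"
    using len by (simp add: m1_def parsed_def listing_def load_def)
  have "ok (For ''xi'' (scalar ''N'') scenario_prog) m1 (\<lambda>m. m ''na'' 0 = length as \<and> m ''nb'' 0 = length bs \<and> m ''N'' 0 = scen I \<and>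
    parsed I l {(\<xi>, f). \<xi> < scen I \<and> f \<in> edges I \<xi>} (length l) m)"
  proof (rule ok_For[where n = "scen I" and Inv = "\<lambda>j. parsed I l {(\<xi>, f). \<xi> < j \<and> f \<in> edges I \<xi>} (p0 + length (concat (take j ss)))"], goal_cases)
    case 5
    have "parsed I l {} p0 (put m1 ''xi'' 0 0)"
      by (rule parsed_move[OF parsed1]) (use len parsed1 in \<open>simp_all add: parsed_def\<close>)
    then show ?case by simp
  next
    case (6 j m')
    have j: "j < length ss" using 6(1) lens by simp
    have e: "enc_scenario I j (ss ! j)" using list_all2_nthD2[OF ss j] 6(1) by simp
    have m': "m' ''input'' = load l ''input''"
      using 6(3)[of "''input''"] m1 by simp
    have T: "{(\<xi>, f). \<xi> < Suc j \<and> f \<in> edges I \<xi>} = {(\<xi>, f). \<xi> < j \<and> f \<in> edges I \<xi>} \<union> {j} \<times> edges I j"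
      by (auto simp: less_Suc_eq)
    have p: "p0 + length (concat (take (Suc j) ss)) = p0 + length (concat (take j ss)) + length (ss ! j)"
      using j by (simp add: take_Suc_conv_app_nth)
    have jb: "j < 2 ^ b" using 6(1) N b(1) by simp
    show ?case
      unfolding T p
    proof (rule ok_weaken[OF scenario_prog_ok[OF m' 6(2,5) e occurs_concat[OF occ j] b(1,2) jb b(3)]], goal_cases)
      case (1 m'')
      then have "m'' ''pos'' 0 \<le> length l \<and> m'' ''pos'' 0 = p0 + length (concat (take j ss)) + length (ss ! j)" by (simp add: parsed_def)
      then show ?case by (intro parsed_move[OF 1]) simp_all
    qed
  next
    case (7 m')
    then show ?case using 7(1)[of "''na''"] 7(1)[of "''nb''"] 7(1)[of "''N''"] m1 lens len by simp
  qed (use m1 N b in simp_all)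
  note loop = this
  show ?thesis
    unfolding parse_prog_def
    by (rule ok_assign[where v = "length as"], rule ok_assign[where v = "length bs"],
        rule ok_assign[where v = "scen I"], rule ok_assign[where v = p0],
        rule ok_assign[where v = 1], rule loop[unfolded m1_def])
      (use inp b len N L_less in \<open>simp_all add: p0_def\<close>)
qed

end

section \<open>The inner program and coverings\<close>

lemma edge_subset_ground: "valid_inst I \<Longrightarrow> \<xi> < scen I \<Longrightarrow> f \<in> edges I \<xi> \<Longrightarrow> f \<subseteq> ground I"
  unfolding valid_inst_def ground_def by blast

text \<open>Only the entries of scenario \<open>\<xi>\<close> at members of \<open>f\<close>
  survive. Multiplied by \<open>val I \<xi> f\<close>, the constraint of \<open>f\<close> thus
  becomes a covering constraint for \<open>N * u\<close> with the value as demand.\<close>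

lemma coef_sum:
  assumes I: "valid_inst I" and f: "\<xi> < scen I" "f \<in> edges I \<xi>"
  shows "(\<Sum>g\<in>ground I. \<Sum>\<xi>'<scen I. coef I (\<xi>, f) g \<xi>' * u g \<xi>') =
    real (scen I) / real_of_rat (val I \<xi> f) * (\<Sum>g\<in>f. u g \<xi>)"
proof -
  define c where "c = real (scen I) / real_of_rat (val I \<xi> f)"
  have fin: "finite (ground I)" using I by (auto simp: valid_inst_def ground_def)
  have sub: "f \<subseteq> ground I" by (rule edge_subset_ground[OF I f])
  have "(\<Sum>\<xi>'<scen I. coef I (\<xi>, f) g \<xi>' * u g \<xi>') = (if g \<in> f then c * u g \<xi> else 0)" for g
  proof -
    have "(\<Sum>\<xi>'<scen I. coef I (\<xi>, f) g \<xi>' * u g \<xi>') = (\<Sum>\<xi>'<scen I. if \<xi>' = \<xi> then (if g \<in> f then c * u g \<xi> else 0) else 0)"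
      by (intro sum.cong) (auto simp: coef_def c_def)
    then show ?thesis using f by simp
  qed
  then have "(\<Sum>g\<in>ground I. \<Sum>\<xi>'<scen I. coef I (\<xi>, f) g \<xi>' * u g \<xi>') = (\<Sum>g\<in>ground I. if g \<in> f then c * u g \<xi> else 0)"
    by simp
  also have "\<dots> = (\<Sum>g\<in>f. c * u g \<xi>)" using fin sub by (simp add: sum.If_cases Int_absorb1)
  finally show ?thesis by (simp add: c_def sum_distrib_left)
qed

lemma inj_on_pair_code: "inj_on (\<lambda>(g, \<xi>). g * N + \<xi>) (A \<times> {..<N::nat})"
proof (rule inj_onI, clarsimp)
  fix g \<xi> g' \<xi>' assume *: "\<xi> < N" "\<xi>' < N" "g * N + \<xi> = g' * N + \<xi>'"
  have "(h * N + z) div N = h \<and> (h * N + z) mod N = z" if "z < N" for h z using that by simp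
  then show "g = g' \<and> \<xi> = \<xi>'" using * by metis
qed

section \<open>Coverings of the table as solutions of the inner program\<close>

locale instance_table = edge_table inp ST SC N ne Q nb b L B
  for inp ST SC :: "nat \<Rightarrow> nat" and N ne Q nb b L B :: nat +
  fixes I :: inst and scale :: real
  assumes valid: "valid_inst I" and N: "N = scen I" "N > 0" and scale: "scale > 0"
    and cand: "cand = SA I" and bs: "set bs = SB I"
    and sound: "e < ne \<Longrightarrow> SC e < N \<and> element e ` {..<sz e} \<in> edges I (SC e) \<and>
      real (weight e) = real_of_rat (val I (SC e) (element e ` {..<sz e})) * scale"
    and complete: "\<xi> < N \<Longrightarrow> f \<in> edges I \<xi> \<Longrightarrow> \<exists>e<ne. SC e = \<xi> \<and> element e ` {..<sz e} = f"
begin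

definition members :: "nat \<Rightarrow> nat set" where
  "members e = element e ` {..<sz e}"

lemma val_pos: "\<xi> < N \<Longrightarrow> f \<in> edges I \<xi> \<Longrightarrow> real_of_rat (val I \<xi> f) > 0"
  using valid N by (simp add: valid_inst_def)

lemma sum_table_edge: "e < ne \<Longrightarrow> sum x (fst (table_edge e)) = (\<Sum>g\<in>members e. x (g * N + SC e))"
proof -
  assume e: "e < ne"
  have inj: "inj_on (element e) {..<sz e}"
    using inj_code[OF e] by (auto simp: inj_on_def code_def)
  have "sum x (fst (table_edge e)) = (\<Sum>i<sz e. x (code e i))"
    by (simp add: table_edge_def sum_code[OF e])
  also have "\<dots> = (\<Sum>g\<in>members e. x (g * N + SC e))"
    unfolding members_def by (subst sum.reindex[OF inj]) (simp add: code_def)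
  finally show ?thesis .
qed

lemma fst_table_edge: "fst (table_edge e) = (\<lambda>g. g * N + SC e) ` members e"
  by (auto simp: table_edge_def members_def code_def)

lemma members_ground: "e < ne \<Longrightarrow> members e \<subseteq> ground I"
  using sound[of e] edge_subset_ground[OF valid, of "SC e"] N by (simp add: members_def)

lemma feasible_iff:
  "feasible S x \<longleftrightarrow> (\<forall>i\<in>S \<union> set bs. \<forall>e<ne. i \<in> members e \<longrightarrow>
     real_of_rat (val I (SC e) (members e)) * scale \<le> (\<Sum>g\<in>members e. x (g * N + SC e)))"
proof -
  have "has i e \<longleftrightarrow> i \<in> members e" for i e by (auto simp: has_def members_def)
  then have "feasible S x \<longleftrightarrow> (\<forall>i\<in>S \<union> set bs. \<forall>e<ne. i \<in> members e \<longrightarrow> covers x (table_edge e))"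
    unfolding feasible_def es_def by auto
  moreover have "covers x (table_edge e) \<longleftrightarrow>
    real_of_rat (val I (SC e) (members e)) * scale \<le> (\<Sum>g\<in>members e. x (g * N + SC e))" if "e < ne" for e
  proof -
    have "snd (table_edge e) = weight e" by (simp add: table_edge_def)
    then show ?thesis
      using sound[OF that] by (simp add: covers_def sum_table_edge[OF that] members_def[symmetric])
  qed
  ultimately show ?thesis by auto
qed

definition pairs :: "(nat \<times> nat) set" where
  "pairs = ground I \<times> {..<N}"

lemma finite_pairs: "finite pairs"
  using valid by (auto simp: pairs_def ground_def valid_inst_def)

lemma U_subset: "U \<subseteq> (\<lambda>(g, \<xi>). g * N + \<xi>) ` pairs"
proof
  fix c assume "c \<in> U"
  then obtain e where e: "e < ne" "c \<in> fst (table_edge e)" by (auto simp: U_def table_edge_def)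
  then obtain g where "g \<in> members e" "c = g * N + SC e" unfolding fst_table_edge by blast
  then show "c \<in> (\<lambda>(g, \<xi>). g * N + \<xi>) ` pairs"
    using members_ground[OF e(1)] sound[OF e(1)]
    by (intro image_eqI[of _ _ "(g, SC e)"]) (auto simp: pairs_def)
qed

lemma code_in_U: "e < ne \<Longrightarrow> g \<in> members e \<Longrightarrow> g * N + SC e \<in> U"
  using wf_table_edge[of e] unfolding fst_table_edge by blast

lemma total_eq: "total I u = (\<Sum>(g, \<xi>)\<in>pairs. u g \<xi>)"
  unfolding total_def pairs_def N(1)[symmetric] by (rule sum.cartesian_product)

lemma sum_U: "sum x U = (\<Sum>(g, \<xi>)\<in>pairs. if g * N + \<xi> \<in> U then x (g * N + \<xi>) else (0::real))"
proof -
  let ?h = "\<lambda>(g, \<xi>). g * N + \<xi>"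
  have "sum x U = (\<Sum>c\<in>?h ` pairs. if c \<in> U then x c else 0)"
    using U_subset finite_pairs by (simp add: sum.If_cases Int_absorb1)
  also have "\<dots> = (\<Sum>z\<in>pairs. if ?h z \<in> U then x (?h z) else 0)"
    using inj_on_pair_code[of N "ground I"] by (subst sum.reindex) (auto simp: pairs_def comp_def)
  finally show ?thesis by (simp only: case_prod_unfold)
qed

text \<open>A covering \<open>x\<close> of the table is a solution of the inner program in units of
  \<open>1 / (N * scale)\<close>.\<close>

lemma inner_feasible_of_covering:
  assumes "feasible S x" "\<And>c. x c \<ge> 0"
  defines "u \<equiv> \<lambda>g \<xi>. if g * N + \<xi> \<in> U then x (g * N + \<xi>) / (real N * scale) else 0"
  shows "inner_feasible I S u" "total I u = sum x U / (real N * scale)"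
proof -
  show "inner_feasible I S u"
    unfolding inner_feasible_def
  proof (intro conjI ballI allI impI)
    fix i F assume i: "i \<in> S \<union> SB I" and F: "F \<in> Defs.F I i"
    obtain \<xi> f where f: "F = (\<xi>, f)" "\<xi> < scen I" "f \<in> edges I \<xi>" "i \<in> f"
      using F by (auto simp: F_def)
    obtain e where e: "e < ne" "SC e = \<xi>" "members e = f"
      using complete[of \<xi> f] f N by (auto simp: members_def)
    have v: "real_of_rat (val I \<xi> f) > 0" using val_pos f N by simp
    have "real_of_rat (val I \<xi> f) * scale \<le> (\<Sum>g\<in>f. x (g * N + \<xi>))"
      using assms(1) e f i unfolding feasible_iff bs by blast
    also have "\<dots> = real N * scale * (\<Sum>g\<in>f. u g \<xi>)"
      unfolding sum_distrib_left
      using code_in_U[OF e(1)] e N scale by (intro sum.cong) (auto simp: u_def)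
    finally have "real_of_rat (val I \<xi> f) \<le> real N * (\<Sum>g\<in>f. u g \<xi>)" using scale by simp
    then show "1 \<le> (\<Sum>g\<in>ground I. \<Sum>\<xi>'<scen I. coef I F g \<xi>' * u g \<xi>')"
      unfolding f(1) coef_sum[OF valid f(2,3)] using v N by (simp add: field_simps)
  next
    fix g \<xi> show "0 \<le> u g \<xi>" using assms(2) scale by (simp add: u_def)
  qed
  have "sum x U / (real N * scale) = (\<Sum>(g, \<xi>)\<in>pairs. u g \<xi>)"
    unfolding sum_U sum_divide_distrib by (intro sum.cong) (auto simp: u_def)
  then show "total I u = sum x U / (real N * scale)" by (simp add: total_eq)
qed

text \<open>Pairs outside \<open>U\<close> occur in no constraint and are dropped, so the total can
  only decrease; hence the inequality. Division and remainder by \<open>N\<close> recover element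
  and scenario from an index.\<close>

lemma covering_of_inner_feasible:
  assumes u: "inner_feasible I S u"
  defines "x \<equiv> \<lambda>c. if c \<in> U then real N * scale * u (c div N) (c mod N) else 0"
  shows "feasible S x" "x c \<ge> 0" "sum x U \<le> real N * scale * total I u"
proof -
  have pos: "u g \<xi> \<ge> 0" if "(g, \<xi>) \<in> pairs" for g \<xi>
    using u that by (auto simp: inner_feasible_def pairs_def N(1)[symmetric])
  have xg: "x (g * N + \<xi>) = (if g * N + \<xi> \<in> U then real N * scale * u g \<xi> else 0)" if "\<xi> < N" for g \<xi>
    using that by (simp add: x_def)
  show "x c \<ge> 0"
  proof (cases "c \<in> U")
    case True
    then obtain g \<xi> where z: "(g, \<xi>) \<in> pairs" "c = g * N + \<xi>" using U_subset by auto
    then have "\<xi> < N" by (simp add: pairs_def)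
    then show ?thesis using pos[OF z(1)] scale by (simp add: xg z(2))
  qed (simp add: x_def)
  show "feasible S x"
    unfolding feasible_iff
  proof (intro ballI allI impI)
    fix i e assume i: "i \<in> S \<union> set bs" and e: "e < ne" "i \<in> members e"
    have so: "SC e < scen I" "members e \<in> edges I (SC e)" using sound[OF e(1)] N by (auto simp: members_def)
    have v: "real_of_rat (val I (SC e) (members e)) > 0" using val_pos so N by simp
    have "(SC e, members e) \<in> F I i" using so e by (simp add: F_def)
    then have "1 \<le> real (scen I) / real_of_rat (val I (SC e) (members e)) * (\<Sum>g\<in>members e. u g (SC e))"
      using u i unfolding coef_sum[OF valid so, symmetric] inner_feasible_def bs by blast
    then have "real_of_rat (val I (SC e) (members e)) \<le> real N * (\<Sum>g\<in>members e. u g (SC e))"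
      using v N by (simp add: field_simps)
    then have "real_of_rat (val I (SC e) (members e)) * scale \<le> real N * (\<Sum>g\<in>members e. u g (SC e)) * scale"
      using scale by (intro mult_right_mono) auto
    also have "\<dots> = (\<Sum>g\<in>members e. real N * scale * u g (SC e))"
      by (simp add: sum_distrib_left sum_distrib_right mult_ac)
    also have "\<dots> = (\<Sum>g\<in>members e. x (g * N + SC e))"
      using code_in_U[OF e(1)] so by (intro sum.cong) (auto simp: xg N(1)[symmetric])
    finally show "real_of_rat (val I (SC e) (members e)) * scale \<le> (\<Sum>g\<in>members e. x (g * N + SC e))" .
  qed
  have "sum x U = (\<Sum>(g, \<xi>)\<in>pairs. if g * N + \<xi> \<in> U then real N * scale * u g \<xi> else 0)"
    unfolding sum_U by (intro sum.cong) (auto simp: xg pairs_def)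
  also have "\<dots> \<le> (\<Sum>(g, \<xi>)\<in>pairs. real N * scale * u g \<xi>)"
    using pos scale by (intro sum_mono) auto
  also have "\<dots> = real N * scale * total I u"
    by (simp add: total_eq sum_distrib_left case_prod_unfold)
  finally show "sum x U \<le> real N * scale * total I u" .
qed

lemma inner_bdd_below: "bdd_below (total I ` {u. inner_feasible I S u})"
proof (rule bdd_belowI2)
  fix u assume "u \<in> {u. inner_feasible I S u}"
  then show "0 \<le> total I u" unfolding total_def inner_feasible_def by (auto intro!: sum_nonneg)
qed

lemma inner_min_le:
  assumes "feasible S (\<lambda>c. real (w c))"
  shows "real N * scale * inner_min I S \<le> real (cost w)"
proof -
  note u = inner_feasible_of_covering[OF assms]
  have "inner_min I S \<le> sum (\<lambda>c. real (w c)) U / (real N * scale)"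
    unfolding inner_min_def u(2)[symmetric, simplified]
    by (rule cINF_lower[OF inner_bdd_below]) (use u(1) in simp)
  then show ?thesis using N(2) scale by (simp add: cost_def field_simps)
qed

text \<open>Serving all vehicles concerned from zero yields a covering. Nonemptiness is what lets
  lower bounds pass to the real infimum in \<open>inner_min\<close>.\<close>

lemma inner_feasible_nonempty: "finite S \<Longrightarrow> {u. inner_feasible I S u} \<noteq> {}"
proof -
  assume "finite S"
  then obtain xs where "set xs = S" using finite_list by blast
  then have "feasible S (\<lambda>c. real (fold serve (xs @ bs) (\<lambda>_. 0) c))"
    unfolding feasible_def by (intro ballI fold_serve_covers) auto
  then show ?thesis using inner_feasible_of_covering(1)[of S] by fastforce
qed

lemma inner_min_nonneg: "finite S \<Longrightarrow> 0 \<le> inner_min I S"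
  unfolding inner_min_def
  by (rule cINF_greatest[OF inner_feasible_nonempty])
    (auto simp: total_def inner_feasible_def intro!: sum_nonneg)

text \<open>Competitiveness holds against every real covering, hence against every feasible
  \<open>u\<close>. It passes to the infimum without an optimal solution being exhibited.\<close>

lemma inner_min_ge:
  assumes "greedy S w"
  shows "real (cost w) \<le> ratio (inp 0) * (real N * scale) * inner_min I S"
proof -
  have fin: "finite S" using greedy_subset[OF assms] finite_SA finite_subset by blast
  have r: "ratio (inp 0) > 0" using p1 by (simp add: ratio_def)
  have "real (cost w) / (ratio (inp 0) * (real N * scale)) \<le> inner_min I S"
    unfolding inner_min_def
  proof (rule cINF_greatest[OF inner_feasible_nonempty[OF fin]])
    fix u assume "u \<in> {u. inner_feasible I S u}"
    then have u: "inner_feasible I S u" by simp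
    note x = covering_of_inner_feasible[OF u]
    have "real (cost w) \<le> ratio (inp 0) * (real N * scale * total I u)"
      using greedy_competitive[OF assms x(2,1)] mult_left_mono[OF x(3), of "ratio (inp 0)"] r by linarith
    then show "real (cost w) / (ratio (inp 0) * (real N * scale)) \<le> total I u"
      using r N(2) scale by (simp add: field_simps)
  qed
  then show ?thesis using r N(2) scale by (simp add: field_simps)
qed

text \<open>Both comparisons meet at the cost of \<open>w\<close>, which the greedy argument bounds
  from below by the minimum of \<open>T\<close>, and competitiveness from above by that of
  \<open>S\<close>. The unit \<open>N * scale\<close> cancels.\<close>

lemma greedy_guarantee:
  assumes g: "greedy S w" and S: "card S = min n (card cand)" and T: "T \<subseteq> SA I" "card T \<le> n"
  shows "(1 - exp (-1)) * inner_min I T \<le> ratio (inp 0) * inner_min I S"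
proof -
  have T': "T \<subseteq> cand" "card T \<le> min n (card cand)"
    using T finite_SA card_mono[of cand T] by (auto simp: cand)
  have "finite T" using T'(1) finite_SA finite_subset by blast
  then have "(1 - exp (-1)) * (real N * scale * inner_min I T) \<le> real (cost w)"
    using scale inner_min_nonneg[of T] by (intro greedy_approx[OF g S T' _ inner_min_le]) auto
  also have "\<dots> \<le> ratio (inp 0) * (real N * scale) * inner_min I S" by (rule inner_min_ge[OF g])
  finally have "real N * scale * ((1 - exp (-1)) * inner_min I T) \<le> real N * scale * (ratio (inp 0) * inner_min I S)"
    by (simp add: mult_ac)
  then show ?thesis using N(2) scale by simp
qed

end

section \<open>The approximation algorithm\<close>

lemma entryD:
  assumes "entry I l \<xi> f i"
  obtains xs where "distinct xs" "set xs = f" "i + 3 + length xs \<le> length l"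
    "l ! i = nat (fst (quotient_of (val I \<xi> f)))" "l ! (i + 1) = nat (snd (quotient_of (val I \<xi> f)))"
    "l ! (i + 2) = length xs" "\<And>j. j < length xs \<Longrightarrow> l ! (i + (3 + j)) = xs ! j"
proof -
  obtain xs k where xs: "distinct xs" "set xs = f" "occurs l i k"
    and k: "k = nat (fst (quotient_of (val I \<xi> f))) # nat (snd (quotient_of (val I \<xi> f))) # length xs # xs"
    using assms by (auto simp: entry_def enc_edge_def enc_set_iff)
  show ?thesis
  proof (rule that[of xs])
    show "i + 3 + length xs \<le> length l" using occurs_length[OF xs(3)] by (simp add: k)
    show "l ! i = nat (fst (quotient_of (val I \<xi> f)))" using occurs_nth[OF xs(3), of 0] by (simp add: k)
    show "l ! (i + 1) = nat (snd (quotient_of (val I \<xi> f)))" using occurs_nth[OF xs(3), of 1] by (simp add: k)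
    show "l ! (i + 2) = length xs" using occurs_nth[OF xs(3), of 2] by (simp add: k)
    show "l ! (i + (3 + j)) = xs ! j" if "j < length xs" for j
      using occurs_nth[OF xs(3), of "3 + j"] that by (simp add: k)
  qed (use xs in auto)
qed

text \<open>One vehicle and at most \<open>p - 1\<close> requests: here \<open>p\<close> becomes the
  bound on edge sizes on which the competitive ratio depends.\<close>

lemma valid_edge_card:
  assumes "valid_inst I" "\<xi> < scen I" "f \<in> edges I \<xi>"
  shows "0 < card f \<and> card f \<le> cap_p I"
proof -
  have f: "f \<subseteq> SA I \<union> SB I \<union> req I \<xi>" "card (f \<inter> (SA I \<union> SB I)) = 1" "f \<inter> req I \<xi> \<noteq> {}"
    "card (f \<inter> req I \<xi>) \<le> cap_p I - 1" "finite (SA I)" "finite (SB I)" "finite (req I \<xi>)" "cap_p I \<ge> 2"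
    using assms unfolding valid_inst_def by blast+
  have fin: "finite f" using f(1,5-7) finite_subset by blast
  have "card f \<le> card ((f \<inter> (SA I \<union> SB I)) \<union> (f \<inter> req I \<xi>))"
    using f(1) fin by (intro card_mono) auto
  also have "\<dots> \<le> card (f \<inter> (SA I \<union> SB I)) + card (f \<inter> req I \<xi>)" by (rule card_Un_le)
  finally have "card f \<le> cap_p I" using f(2,4,8) by simp
  moreover have "0 < card f" using fin f(3) by (auto simp: card_gt_0_iff)
  ultimately show ?thesis by simp
qed

lemma rat_quotient:
  assumes "r > 0"
  defines "num \<equiv> nat (fst (quotient_of r))" and "den \<equiv> nat (snd (quotient_of r))"
  shows "num > 0" "den > 0" "real_of_rat r = real num / real den"
proof -
  obtain a d where q: "quotient_of r = (a, d)" by fastforce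
  have d: "d > 0" using quotient_of_denom_pos[OF q] .
  have r: "r = of_int a / of_int d" by (rule quotient_of_div[OF q])
  have a: "a > 0" using assms(1) d unfolding r by (simp add: zero_less_divide_iff)
  show "num > 0" "den > 0" using a d by (simp_all add: num_def den_def q)
  have "num = nat a" "den = nat d" by (simp_all add: num_def den_def q)
  moreover have "real_of_rat r = real_of_int a / real_of_int d"
    using d by (simp add: r of_rat_divide)
  ultimately show "real_of_rat r = real num / real den" using a d by simp
qed

text \<open>The input size \<open>n\<close> bounds all counts, and 8 is added for the rounds of
  \<open>relax\<close>. A scaled value is a product of a numerator, a quotient of \<open>Q\<close>
  and \<open>4 * p\<close>, whence the bound \<open>2 ^ (3 * n + 2)\<close>. At most
  \<open>2 ^ n * 2 ^ n\<close> weights of three times this size sum up to less than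
  \<open>2 ^ (5 * n + 5)\<close>, well within \<open>10 * n + 20\<close> bits.\<close>

lemma table_of_parsed:
  fixes l :: "nat list"
  defines "n \<equiv> bit_size l"
  assumes valid: "valid_inst I"
    and l: "l = cap_p I # budget I # (length as # as) @ (length bs # bs) @ scen I # concat ss"
    and as: "distinct as" "set as = SA I" and bs: "set bs = SB I" and ss: "length ss = scen I" "\<And>y. y \<in> set ss \<Longrightarrow> y \<noteq> []"
    and m: "parsed I l {(\<xi>, f). \<xi> < scen I \<and> f \<in> edges I \<xi>} (length l) m"
  shows "edge_table (load l ''input'') (m ''ST'') (m ''SC'') (scen I) (m ''ne'' 0) (m ''Q'' 0) (length bs)
      (10 * n + 20) (n + 8) (2 ^ (3 * n + 2))"
    and "scen I > 0 \<Longrightarrow> instance_table (load l ''input'') (m ''ST'') (m ''SC'') (scen I) (m ''ne'' 0) (m ''Q'' 0) (length bs)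
      (10 * n + 20) (n + 8) (2 ^ (3 * n + 2)) I (real (m ''Q'' 0 * (4 * cap_p I)))"
    and "table.cand (load l ''input'') = SA I"
proof -
  define inp ST SC ne Q where "inp = load l ''input''" and "ST = m ''ST''" and "SC = m ''SC''" and "ne = m ''ne'' 0"
    and "Q = m ''Q'' 0"
  define N where "N = scen I"
  interpret table inp ST SC N ne Q "length bs" .
  have inp: "inp j = l ! j" if "j < length l" for j using that by (simp add: inp_def load_def)
  have inp0: "inp 0 = cap_p I" "inp 2 = length as" "\<And>k. k < length as \<Longrightarrow> inp (3 + k) = as ! k"
    "\<And>k. k < length bs \<Longrightarrow> inp (4 + (length as + k)) = bs ! k"
    by (auto simp: inp_def load_def l nth_append nth_Cons')
  have len: "length l \<le> n" unfolding n_def by (rule length_le_bit_size)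
  have Nn: "N \<le> n"
  proof -
    have "N \<le> length (concat ss)" using length_le_concat[of ss] ss by (simp add: N_def)
    then show ?thesis using len by (simp add: l)
  qed
  have cp: "cap_p I \<ge> 2" using valid by (simp add: valid_inst_def)
  have inp_less: "inp j < 2 ^ n" for j
    using less_two_power_bit_size[of "l ! j" l] by (simp add: inp_def load_def n_def)
  have n_less: "n < 2 ^ n" by (rule less_exp)
  then have N_le: "N \<le> 2 ^ n" using Nn by linarith
  have ls: "listing I l {(\<xi>, f). \<xi> < scen I \<and> f \<in> edges I \<xi>} ST SC ne Q" and Q0: "Q > 0"
    and Qn: "Q \<le> 2 ^ n" and ne: "ne \<le> length l"
    using m by (auto simp: parsed_def ST_def SC_def ne_def Q_def n_def)
  have E: "SC e < N \<and> element e ` {..<sz e} \<in> edges I (SC e) \<and> inj_on (element e) {..<sz e} \<and>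
      sz e = card (element e ` {..<sz e}) \<and> sz e \<le> length l \<and>
      inp (ST e + 1) dvd Q \<and> inp (ST e) = nat (fst (quotient_of (val I (SC e) (element e ` {..<sz e})))) \<and>
      inp (ST e + 1) = nat (snd (quotient_of (val I (SC e) (element e ` {..<sz e}))))"
    and E': "entry I l \<xi> f (ST e) \<Longrightarrow> element e ` {..<sz e} = f" if e: "e < ne" for e \<xi> f
  proof -
    have EE: "element e ` {..<sz e} = f \<and> inj_on (element e) {..<sz e} \<and> sz e = card f \<and> sz e \<le> length l \<and>
      inp (ST e + 1) = l ! (ST e + 1) \<and>
      inp (ST e) = nat (fst (quotient_of (val I \<xi> f))) \<and> inp (ST e + 1) = nat (snd (quotient_of (val I \<xi> f)))"
      if en: "entry I l \<xi> f (ST e)" for \<xi> f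
    proof -
      obtain xs where xs: "distinct xs" "set xs = f" "ST e + 3 + length xs \<le> length l"
        "l ! ST e = nat (fst (quotient_of (val I \<xi> f)))" "l ! (ST e + 1) = nat (snd (quotient_of (val I \<xi> f)))"
        "l ! (ST e + 2) = length xs" "\<And>j. j < length xs \<Longrightarrow> l ! (ST e + (3 + j)) = xs ! j"
        using en by (rule entryD) blast
      have s: "sz e = length xs" using xs(3,6) by (simp add: sz_def inp)
      have el: "element e j = xs ! j" if "j < length xs" for j using xs(3,7) that by (simp add: element_def inp)
      have "element e ` {..<sz e} = (\<lambda>j. xs ! j) ` {..<length xs}" using el s by (intro image_cong) auto
      then have im: "element e ` {..<sz e} = f" using xs(2) by (auto simp: set_conv_nth)
      have "inj_on (element e) {..<sz e}"
        using xs(1) el s by (auto simp: inj_on_def nth_eq_iff_index_eq)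
      then show ?thesis using im s xs distinct_card[of xs] inp[of "ST e"] inp[of "ST e + 1"] by auto
    qed
    show "entry I l \<xi> f (ST e) \<Longrightarrow> element e ` {..<sz e} = f" using EE by blast
    obtain f where f: "SC e < scen I" "f \<in> edges I (SC e)" "entry I l (SC e) f (ST e)" "l ! (ST e + 1) dvd Q"
      using ls e unfolding listing_def by auto
    have im: "element e ` {..<sz e} = f" using EE[OF f(3)] by blast
    show "SC e < N \<and> element e ` {..<sz e} \<in> edges I (SC e) \<and> inj_on (element e) {..<sz e} \<and>
      sz e = card (element e ` {..<sz e}) \<and> sz e \<le> length l \<and>
      inp (ST e + 1) dvd Q \<and> inp (ST e) = nat (fst (quotient_of (val I (SC e) (element e ` {..<sz e})))) \<and>
      inp (ST e + 1) = nat (snd (quotient_of (val I (SC e) (element e ` {..<sz e}))))"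
      using f EE[OF f(3)] unfolding im N_def by metis
  qed
  have sz': "0 < sz e \<and> sz e \<le> inp 0 \<and> sz e \<le> n + 8" if "e < ne" for e
    using E[OF that] valid_edge_card[OF valid, of "SC e" "element e ` {..<sz e}"] len by (simp add: N_def inp0)
  have w: "real (weight e) = real_of_rat (val I (SC e) (element e ` {..<sz e})) * real (Q * (4 * cap_p I))"
    "4 * sz e \<le> weight e" "weight e \<le> 2 ^ (3 * n + 2)" if e: "e < ne" for e
  proof -
    define r where "r = val I (SC e) (element e ` {..<sz e})"
    define a where "a = inp (ST e)"
    define d where "d = inp (ST e + 1)"
    have r: "r > 0" using valid E[OF e] by (simp add: valid_inst_def r_def N_def)
    have q: "a > 0" "d > 0" "real_of_rat r = real a / real d"
      using rat_quotient[OF r] E[OF e] by (simp_all add: r_def a_def d_def)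
    have dQ: "d dvd Q" using E[OF e] unfolding d_def by blast
    have we: "weight e = a * (Q div d) * (4 * cap_p I)" by (simp add: weight_def a_def d_def inp0)
    have rd: "real (Q div d) = real Q / real d" using dQ by (rule real_of_nat_div)
    show "real (weight e) = real_of_rat (val I (SC e) (element e ` {..<sz e})) * real (Q * (4 * cap_p I))"
      unfolding r_def[symmetric] we q(3) of_nat_mult rd by simp
    have "Q div d \<ge> 1" using dQ Q0 q(2) dvd_imp_le[OF dQ Q0] by (simp add: div_greater_zero_iff Suc_leI)
    then have "1 * 1 * (4 * sz e) \<le> a * (Q div d) * (4 * cap_p I)"
      using q(1) sz'[OF e] inp0(1) by (intro mult_le_mono) auto
    then show "4 * sz e \<le> weight e" by (simp add: we)
    have "a * (Q div d) * (4 * cap_p I) \<le> 2 ^ n * 2 ^ n * (4 * 2 ^ n)"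
      using inp_less[of "ST e"] inp_less[of 0] Qn inp0(1) order_trans[OF div_le_dividend Qn, of d]
      by (intro mult_le_mono) (auto simp: a_def)
    also have "\<dots> = 2 ^ (n + n + (2 + n))" by (simp add: power_add)
    also have "n + n + (2 + n) = 3 * n + 2" by simp
    finally show "weight e \<le> 2 ^ (3 * n + 2)" by (simp add: we)
  qed
  have code_less: "code e j < 2 ^ (10 * n + 20)" if e: "e < ne" for e j
  proof -
    have "code e j < (inp (ST e + (3 + j)) + 1) * N" using E[OF e] by (simp add: code_def element_def)
    also have "\<dots> \<le> 2 ^ n * 2 ^ n" using inp_less[of "ST e + (3 + j)"] N_le by (intro mult_le_mono) auto
    also have "\<dots> \<le> 2 ^ (10 * n + 20)" unfolding power_add[symmetric] by (intro power_increasing) auto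
    finally show ?thesis .
  qed
  have cU: "card U \<le> 2 ^ n * 2 ^ n"
  proof -
    have "card U \<le> (\<Sum>e<ne. card (code e ` {..<sz e}))" unfolding U_def by (rule card_UN_le) simp
    also have "\<dots> \<le> (\<Sum>e<ne. n)"
    proof (rule sum_mono)
      fix e assume "e \<in> {..<ne}"
      then have "sz e \<le> n" using E[of e] len by simp
      then show "card (code e ` {..<sz e}) \<le> n" using card_image_le[of "{..<sz e}" "code e"] by simp
    qed
    also have "\<dots> = ne * n" by simp
    also have "\<dots> \<le> 2 ^ n * 2 ^ n" using ne len n_less by (intro mult_le_mono) linarith+
    finally show ?thesis .
  qed
  have B: "card U * (3 * 2 ^ (3 * n + 2)) + 1 < 2 ^ (10 * n + 20)"
  proof -
    have "card U * (3 * 2 ^ (3 * n + 2)) + 1 \<le> 2 ^ n * 2 ^ n * (3 * 2 ^ (3 * n + 2)) + 1"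
      using cU by (intro add_mono mult_le_mono) auto
    also have "2 ^ n * 2 ^ n * (3 * 2 ^ (3 * n + 2)) = 3 * (2::nat) ^ (n + n + (3 * n + 2))"
      by (simp only: power_add mult_ac)
    also have "n + n + (3 * n + 2) = 5 * n + 2" by simp
    also have "3 * (2::nat) ^ (5 * n + 2) + 1 < 2 ^ 2 * 2 ^ (5 * n + 2) + 1" by simp
    also have "\<dots> \<le> 2 ^ 3 * 2 ^ (5 * n + 2)" by simp
    also have "\<dots> \<le> 2 ^ (10 * n + 20)" unfolding power_add[symmetric] by (intro power_increasing) auto
    finally show ?thesis .
  qed
  have B1: "3 * (2::nat) ^ (3 * n + 2) < 2 ^ (10 * n + 20)"
  proof -
    have "3 * (2::nat) ^ (3 * n + 2) < 2 ^ 2 * 2 ^ (3 * n + 2)" by simp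
    also have "\<dots> \<le> 2 ^ (10 * n + 20)" unfolding power_add[symmetric] by (intro power_increasing) auto
    finally show ?thesis .
  qed
  have nb8: "Suc (n + 8) < 2 ^ (10 * n + 20)"
  proof -
    have "Suc (n + 8) < n + 20" by simp
    also have "\<dots> < 2 ^ (n + 20)" by (rule less_exp)
    also have "(2::nat) ^ (n + 20) \<le> 2 ^ (10 * n + 20)" by (intro power_increasing) auto
    finally show ?thesis .
  qed
  have inj_code: "inj_on (code e) {..<sz e}" if "e < ne" for e
  proof -
    have "N > 0" using E[OF that] by simp
    then show ?thesis using E[OF that] by (auto simp: inj_on_def code_def)
  qed
  have inj_as: "inj_on (\<lambda>k. inp (3 + k)) {..<inp 2}"
    using as(1) by (auto simp: inj_on_def inp0 nth_eq_iff_index_eq)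
  have "cand = (\<lambda>k. as ! k) ` {..<length as}" unfolding cand_def inp0(2) by (intro image_cong) (auto simp: inp0)
  then have cand: "cand = SA I" using as(2) by (auto simp: set_conv_nth)
  then show "table.cand (load l ''input'') = SA I" by (simp add: inp_def)
  have la: "length as \<le> n + 8" "length bs \<le> n + 8" using len by (simp_all add: l)
  have tab: "edge_table inp ST SC N ne Q (length bs) (10 * n + 20) (n + 8) (2 ^ (3 * n + 2))"
    by unfold_locales (use ne len la nb8 sz' inj_code code_less w inj_as cp B B1 inp0 in auto)
  then show "edge_table (load l ''input'') (m ''ST'') (m ''SC'') (scen I) (m ''ne'' 0) (m ''Q'' 0) (length bs)
      (10 * n + 20) (n + 8) (2 ^ (3 * n + 2))"
    by (simp add: inp_def ST_def SC_def ne_def Q_def N_def)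
  assume "scen I > 0"
  have sb: "set (table.bs inp (length bs)) = SB I"
  proof -
    have "table.bs inp (length bs) = map (\<lambda>k. bs ! k) [0..<length bs]"
      unfolding bs_def inp0(2) using inp0(4) by (intro map_cong) auto
    then show ?thesis using bs by (simp add: map_nth)
  qed
  interpret tb: edge_table inp ST SC N ne Q "length bs" "10 * n + 20" "n + 8" "2 ^ (3 * n + 2)" by (rule tab)
  have "instance_table inp ST SC N ne Q (length bs) (10 * n + 20) (n + 8) (2 ^ (3 * n + 2)) I (real (Q * (4 * cap_p I)))"
  proof unfold_locales
    fix e assume "e < ne"
    then show "SC e < N \<and> element e ` {..<sz e} \<in> edges I (SC e) \<and>
      real (weight e) = real_of_rat (val I (SC e) (element e ` {..<sz e})) * real (Q * (4 * cap_p I))"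
      using E w(1) by blast
  next
    fix \<xi> f assume "\<xi> < N" "f \<in> edges I \<xi>"
    then have "(\<xi>, f) \<in> {(\<xi>, f). \<xi> < scen I \<and> f \<in> edges I \<xi>}" by (simp add: N_def)
    then obtain e where "e < ne" "SC e = \<xi>" "entry I l \<xi> f (ST e)"
      using ls unfolding listing_def by blast
    then show "\<exists>e<ne. SC e = \<xi> \<and> element e ` {..<sz e} = f" using E' by blast
  qed (use valid \<open>scen I > 0\<close> Q0 cp cand sb in \<open>simp_all add: N_def\<close>)
  then show "instance_table (load l ''input'') (m ''ST'') (m ''SC'') (scen I) (m ''ne'' 0) (m ''Q'' 0) (length bs)
      (10 * n + 20) (n + 8) (2 ^ (3 * n + 2)) I (real (m ''Q'' 0 * (4 * cap_p I)))"
    by (simp add: inp_def ST_def SC_def ne_def Q_def N_def)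
qed

section \<open>The complete program and its guarantee\<close>

definition approx_prog :: prog where
  "approx_prog = Seq parse_prog greedy_prog"

lemma bounded_load:
  assumes "bit_size l \<le> b"
  shows "bounded_mem b (load l)"
proof -
  have "l ! j < 2 ^ b" if "j < length l" for j
  proof -
    have "l ! j < 2 ^ bit_size l" by (rule less_two_power_bit_size) (use that in simp)
    also have "(2::nat) ^ bit_size l \<le> 2 ^ b" by (rule power_increasing[OF assms]) simp
    finally show ?thesis .
  qed
  then show ?thesis by (auto simp: bounded_mem_def load_def)
qed

text \<open>The scaling by \<open>N\<close> needs at least one scenario. Without any, all objectives
  are empty sums and the guarantee is trivial.\<close>

lemma inner_min_no_scenario:
  assumes "scen I = 0"
  shows "inner_min I S = 0"
proof -
  have "total I u = 0" "inner_feasible I S u" for u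
    using assms by (simp_all add: total_def inner_feasible_def F_def)
  then show ?thesis by (simp add: inner_min_def)
qed

lemma approx_prog_correct:
  assumes valid: "valid_inst I" and enc: "enc_inst I l"
  defines "n \<equiv> bit_size l"
  shows "\<exists>t m S k. exec approx_prog (load l) t m \<and>
    t \<le> pcost approx_prog * (n + 8 + 1) ^ depth approx_prog * (10 * n + 20) \<and>
    enc_set S k \<and> returns m k \<and> outer_feasible I S \<and>
    (\<forall>T. outer_feasible I T \<longrightarrow> 0 \<le> inner_min I T \<and> (1 - exp (-1)) * inner_min I T \<le> ratio (cap_p I) * inner_min I S)"
proof -
  obtain as bs ss where l: "l = cap_p I # budget I # (length as # as) @ (length bs # bs) @ scen I # concat ss"
    and as: "distinct as" "set as = SA I" and bs: "set bs = SB I"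
    and ss: "list_all2 (enc_scenario I) [0..<scen I] ss"
    using enc by (auto simp: enc_inst_def enc_set_iff)
  have ss': "length ss = scen I" using list_all2_lengthD[OF ss] by simp
  have ssne: "y \<noteq> []" if y: "y \<in> set ss" for y
  proof -
    obtain j where "j < length ss" "y = ss ! j" using y by (metis in_set_conv_nth)
    then show "y \<noteq> []" using list_all2_nthD2[OF ss, of j] by (auto simp: enc_scenario_def enc_set_iff)
  qed
  have len: "length l \<le> n" unfolding n_def by (rule length_le_bit_size)
  have nb: "Suc (n + 8) < 2 ^ (10 * n + 20)"
  proof -
    have "Suc (n + 8) < n + 20" by simp
    also have "\<dots> < 2 ^ (n + 20)" by (rule less_exp)
    also have "(2::nat) ^ (n + 20) \<le> 2 ^ (10 * n + 20)" by (intro power_increasing) auto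
    finally show ?thesis .
  qed
  interpret resources "10 * n + 20" "n + 8" using nb by unfold_locales
  let ?R = "\<lambda>m. \<exists>S xs. distinct xs \<and> set xs = S \<and> returns m (length xs # xs) \<and> outer_feasible I S \<and>
    (\<forall>T. outer_feasible I T \<longrightarrow> 0 \<le> inner_min I T \<and> (1 - exp (-1)) * inner_min I T \<le> ratio (cap_p I) * inner_min I S)"
  have b: "length l < 2 ^ (10 * n + 20)" "bit_size l < 10 * n + 20" "length l \<le> n + 8"
    using nb len by (simp_all add: n_def)
  have "ok approx_prog (load l) ?R"
    unfolding approx_prog_def
  proof (rule ok_Seq, rule ok_frame[OF parse_prog_ok[OF l ss b]], goal_cases)
    case (1 m)
    then have m: "m ''na'' 0 = length as" "m ''nb'' 0 = length bs" "m ''N'' 0 = scen I"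
      "parsed I l {(\<xi>, f). \<xi> < scen I \<and> f \<in> edges I \<xi>} (length l) m" by simp_all
    note table = table_of_parsed[OF valid l as bs ss' ssne m(4), folded n_def]
    interpret tb: edge_table "load l ''input''" "m ''ST''" "m ''SC''" "scen I" "m ''ne'' 0" "m ''Q'' 0" "length bs"
      "10 * n + 20" "n + 8" "2 ^ (3 * n + 2)" by (rule table(1))
    have fr: "m x = load l x" if "x \<in> {''input'', ''w2'', ''w'', ''tot'', ''ch''}" for x
      using 1(3)[of x] that by (auto simp: parse_prog_def)
    have init: "m ''input'' = load l ''input''" "m ''w2'' = (\<lambda>_. 0)" "m ''w'' = (\<lambda>_. 0)" "m ''tot'' 0 = 0" "m ''ch'' = (\<lambda>_. 0)"
      by (simp_all add: fr load_def)
    have inp: "load l ''input'' 0 = cap_p I" "load l ''input'' 1 = budget I" "load l ''input'' 2 = length as"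
      by (simp_all add: load_def l)
    have env: "tb.env m" unfolding tb.env_def using init m inp by simp
    show ?case
    proof (rule ok_weaken[OF tb.greedy_prog_ok[OF env init(2-5)]])
      fix m' assume "\<exists>S w xs. tb.greedy S w \<and> card S = min (load l ''input'' 1) (card tb.cand) \<and>
        distinct xs \<and> set xs = S \<and> returns m' (length xs # xs)"
      then obtain S w xs where g: "tb.greedy S w" "card S = min (budget I) (card tb.cand)"
        and xs: "distinct xs" "set xs = S" "returns m' (length xs # xs)" unfolding inp by blast
      have "S \<subseteq> SA I" using tb.greedy_subset[OF g(1)] table(3) by simp
      then have out: "outer_feasible I S" using g(2) by (simp add: outer_feasible_def)
      have "0 \<le> inner_min I T \<and> (1 - exp (-1)) * inner_min I T \<le> ratio (cap_p I) * inner_min I S" if T: "outer_feasible I T" for T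
      proof (cases "scen I = 0")
        case False
        then interpret it: instance_table "load l ''input''" "m ''ST''" "m ''SC''" "scen I" "m ''ne'' 0" "m ''Q'' 0" "length bs"
          "10 * n + 20" "n + 8" "2 ^ (3 * n + 2)" I "real (m ''Q'' 0 * (4 * cap_p I))"
          using table(2) by simp
        have "finite T" using T valid finite_subset[of T "SA I"] by (auto simp: outer_feasible_def valid_inst_def)
        then show ?thesis
          using it.greedy_guarantee[OF g, of T] it.inner_min_nonneg[of T] T by (simp add: outer_feasible_def inp(1))
      qed (simp add: inner_min_no_scenario)
      then show "?R m'" using xs out by blast
    qed
  qed
  moreover have "bounded_mem (10 * n + 20) (load l)" by (rule bounded_load) (simp add: n_def)
  ultimately obtain t m where "exec approx_prog (load l) t m" "t \<le> time approx_prog" "?R m"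
    unfolding ok_def by blast
  moreover from this obtain xs where "distinct xs" "returns m (length xs # xs)" "outer_feasible I (set xs)"
    "\<forall>T. outer_feasible I T \<longrightarrow> 0 \<le> inner_min I T \<and> (1 - exp (-1)) * inner_min I T \<le> ratio (cap_p I) * inner_min I (set xs)" by blast
  moreover from this have "enc_set (set xs) (length xs # xs)" by (auto simp: enc_set_iff)
  ultimately show ?thesis unfolding time_def by blast
qed

lemma max_min_attained:
  assumes "valid_inst I"
  obtains T where "outer_feasible I T" "max_min I = inner_min I T"
proof -
  have fin: "finite (SA I)" using assms by (simp add: valid_inst_def)
  have "finite {S. outer_feasible I S}"
    by (rule finite_subset[of _ "Pow (SA I)"]) (auto simp: outer_feasible_def fin)
  moreover have "outer_feasible I {}" by (simp add: outer_feasible_def)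
  ultimately have "max_min I \<in> inner_min I ` {S. outer_feasible I S}"
    unfolding max_min_def by (intro Max_in) auto
  then show ?thesis using that by auto
qed

theorem theorem3:
  shows "\<exists>\<epsilon> :: nat \<Rightarrow> real.
    \<epsilon> \<longlonglongrightarrow> 0 \<and> (\<forall>p\<ge>2. 2 * exp 1 + \<epsilon> p > 0) \<and>
    (\<exists>P. poly_time_approx P (\<lambda>p. (exp 1 - 1) / ((2 * exp 1 + \<epsilon> p) * ln (real p))))"
proof (intro exI conjI allI impI)
  \<comment> \<open>The least nonnegative error for which \<open>exp 1 * ratio p\<close> is at most
    \<open>(2 * exp 1 + \<epsilon> p) * ln p\<close>; the cut at 0 keeps the denominator
    positive.\<close>
  define \<epsilon> where "\<epsilon> = (\<lambda>p. max 0 (exp 1 * ratio p / ln (real p) - 2 * exp 1))"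
  show "\<epsilon> \<longlonglongrightarrow> 0"
  proof (rule tendsto_eventually, rule eventually_sequentiallyI)
    \<comment> \<open>\<open>60 / 31 * (ln 480 + ln p) \<le> 2 * ln p\<close> amounts to
      \<open>30 * ln 480 \<le> ln p\<close>. From this threshold on, the error is exactly
      zero.\<close>
    fix p :: nat assume p: "p \<ge> 480 ^ 30"
    have p2: "real p \<ge> 480 ^ 30" using p by (metis of_nat_le_iff of_nat_numeral of_nat_power)
    have pp: "real p > 1" by (rule less_le_trans[OF _ p2]) simp
    have "real 30 * ln 480 = ln ((480::real) ^ 30)" by (rule ln_realpow[symmetric])
    also have "\<dots> \<le> ln (real p)" using p2 pp by (subst ln_le_cancel_iff) auto
    finally have "ratio p \<le> 2 * ln (real p)" using pp by (simp add: ratio_def ln_mult)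
    then have "exp 1 * ratio p \<le> exp 1 * (2 * ln (real p))" by (intro mult_left_mono) auto
    then have "exp 1 * ratio p / ln (real p) \<le> 2 * exp 1"
      using pp by (simp add: divide_le_eq mult_ac)
    then show "\<epsilon> p = 0" by (simp add: \<epsilon>_def)
  qed
  show "2 * exp 1 + \<epsilon> p > 0" for p by (simp add: \<epsilon>_def add_pos_nonneg)
  show "poly_time_approx approx_prog (\<lambda>p. (exp 1 - 1) / ((2 * exp 1 + \<epsilon> p) * ln (real p)))"
    unfolding poly_time_approx_def
  \<comment> \<open>The time bound \<open>pcost * (L + 1) ^ depth * b\<close> with
    \<open>L + 1 = n + 9\<close> and \<open>b = 10 * n + 20\<close>, written as a polynomial in the
    input size \<open>n\<close>.\<close>
  proof (intro exI[of _ "[:pcost approx_prog:] * [:9, 1:] ^ depth approx_prog * [:20, 10:]"] allI impI)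
    fix I l assume A: "valid_inst I \<and> enc_inst I l"
    define p where "p = cap_p I"
    obtain t m S k where run: "exec approx_prog (load l) t m"
      "t \<le> pcost approx_prog * (bit_size l + 8 + 1) ^ depth approx_prog * (10 * bit_size l + 20)"
      "enc_set S k" "returns m k" "outer_feasible I S"
      and approx: "\<And>T. outer_feasible I T \<Longrightarrow> 0 \<le> inner_min I T \<and> (1 - exp (-1)) * inner_min I T \<le> ratio p * inner_min I S"
      using approx_prog_correct[of I l] A unfolding p_def by blast
    obtain T where T: "outer_feasible I T" "max_min I = inner_min I T"
      using max_min_attained A by blast
    have p: "p \<ge> 2" using A by (simp add: p_def valid_inst_def)
    then have lnp: "ln (real p) > 0" by simp
    have r: "ratio p > 0" using p by (simp add: ratio_def)
    have "exp 1 * ratio p / ln (real p) \<le> 2 * exp 1 + \<epsilon> p" by (simp add: \<epsilon>_def)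
    then have "exp 1 * ratio p \<le> (2 * exp 1 + \<epsilon> p) * ln (real p)"
      using lnp by (simp add: divide_le_eq)
    moreover have pos: "exp 1 * ratio p > 0" using r by simp
    ultimately have "(exp 1 - 1) / ((2 * exp 1 + \<epsilon> p) * ln (real p)) \<le> (exp 1 - 1) / (exp 1 * ratio p)"
      by (intro divide_left_mono) auto
    also have "\<dots> = (1 - exp (-1)) / ratio p"
      using r by (simp add: exp_minus field_simps)
    finally have \<alpha>: "(exp 1 - 1) / ((2 * exp 1 + \<epsilon> p) * ln (real p)) \<le> (1 - exp (-1)) / ratio p" .
    have "max_min I \<ge> 0" using approx[OF T(1)] T(2) by simp
    then have "(exp 1 - 1) / ((2 * exp 1 + \<epsilon> p) * ln (real p)) * max_min I \<le> (1 - exp (-1)) / ratio p * max_min I"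
      using \<alpha> by (intro mult_right_mono)
    also have "\<dots> \<le> inner_min I S" using approx[OF T(1)] r by (simp add: T(2) field_simps)
    finally have "inner_min I S \<ge> (exp 1 - 1) / ((2 * exp 1 + \<epsilon> p) * ln (real p)) * max_min I" .
    moreover have "t \<le> poly ([:pcost approx_prog:] * [:9, 1:] ^ depth approx_prog * [:20, 10:]) (bit_size l)"
      using run(2) by (simp add: algebra_simps)
    ultimately show "\<exists>t m S k. exec approx_prog (load l) t m \<and>
        t \<le> poly ([:pcost approx_prog:] * [:9, 1:] ^ depth approx_prog * [:20, 10:]) (bit_size l) \<and>
        enc_set S k \<and> returns m k \<and> outer_feasible I S \<and>
        (exp 1 - 1) / ((2 * exp 1 + \<epsilon> (cap_p I)) * ln (real (cap_p I))) * max_min I \<le> inner_min I S"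
      using run unfolding p_def by blast
  qed
qed

end
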